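(* Let $\mathbb K$ be an algebraically closed field of characteristic $3$, let $A=(a_{ij})$ be a purely even Cartan matrix of size $n$ such that the Lie algebra $\mathfrak g(A)$ is finite-dimensional, let $\mathcal I=\{i_1,\dots,i_l\}$ be an admissible set of boundary nodes with adjacent nodes $\mathcal J=\{j_1,\dots,j_l\}$, let $\widetilde A$ be the associated $(n-l)\times(n-l)$ Cartan matrix (with its parities), and regard $\mathfrak g(A)^{(1)}$ as a Lie algebra in $\mathrm{Rep}\,\alpha_3$ with respect to $\mathrm{ad}\,e$, where $e=\sum_{r=1}^l e_{i_r}$. (All notions are defined in the context.) If $\mathrm{sdim}\,\overline{\mathfrak g(A)^{(1)}}=\mathrm{sdim}\,\mathfrak g(\widetilde A)^{(1)}$, then $\overline{\mathfrak g(A)^{(1)}}^{\,gen}=\overline{\mathfrak g(A)^{(1)}}$, and $\overline{\mathfrak g(A)^{(1)}}$ is isomorphic, as a Lie superalgebra, to $\mathfrak g(\widetilde A)^{(1)}$.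
   Context: **Contragredient Lie superalgebras.** $\mathbb K$ is algebraically closed of characteristic $p=3$. Lie superalgebras in characteristic $3$ are required to satisfy $[x,[x,x]]=0$ for odd $x$. Let $A=(a_{ij})$ be an $n\times n$ integer matrix (a Cartan matrix) with a parity $\mathrm{par}(i)\in\mathbb Z/2$ for each index; let $\overline A=(\overline a_{ij})$ be its reduction mod $p$, of rank $s$. Let $\widetilde{\mathfrak h}$ be a $\mathbb K$-vector space of dimension $2n-s$ with linearly independent $h_1,\dots,h_n\in\widetilde{\mathfrak h}$ and linearly independent $\alpha_1,\dots,\alpha_n\in\widetilde{\mathfrak h}^*$ such that $\alpha_j(h_i)=\overline a_{ij}$. $\widetilde{\mathfrak g}(A)$ is the Lie superalgebra generated by $\widetilde{\mathfrak h}$ (even) and $e_i,f_i$ ($1\le i\le n$) of parity $\mathrm{par}(i)$, with relations $[e_i,f_j]=\delta_{ij}h_i$, $[h,e_j]=\alpha_j(h)e_j$, $[h,f_j]=-\alpha_j(h)f_j$, $[\widetilde{\mathfrak h},\widetilde{\mathfrak h}]=0$. It is graded by the free abelian group $Q=\bigoplus_k\mathbb Z\alpha_k$ with $\deg e_i=\alpha_i$, $\deg f_i=-\alpha_i$, $\deg h=0$. $\mathfrak g(A)=\widetilde{\mathfrak g}(A)/\mathfrak r$, where $\mathfrak r$ is the largest $Q$-graded ideal meeting $\widetilde{\mathfrak h}$ trivially; images of $e_i,f_i,h_i$ keep their names and are called Chevalley generators. $X^{(1)}=[X,X]$; $\widetilde{\mathfrak g}(A)^{(1)}$ and $\mathfrak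 g(A)^{(1)}$ are generated by the Chevalley generators, and $\mathfrak h=\mathrm{span}(h_1,\dots,h_n)$ is called the Cartan subalgebra. Cartan matrices are assumed to satisfy: $a_{ii}\in\{0,2\}$ if $\mathrm{par}(i)=0$; $a_{ii}\in\{0,1\}$ if $\mathrm{par}(i)=1$; if $a_{ii}\in\{1,2\}$ then $a_{ij}\in\mathbb Z_{\le0}$ for all $j\neq i$; and $a_{ij}=0\Leftrightarrow a_{ji}=0$ for $i\ne j$. $A$ is purely even if all parities are $0$ (then $\mathfrak g(A)$ is a Lie algebra). **Setup.** In the Dynkin diagram of $\mathfrak g(A)$ the nodes are $1,\dots,n$, and $i\ne j$ are adjacent iff $a_{ij}\ne0$; they are joined by a single edge if $a_{ij}=a_{ji}=-1$. A set $\mathcal I=\{i_1,\dots,i_l\}$ of nodes is admissible if each $i_r$ is adjacent to exactly one node $j_r$, by a single edge; the $i_r$ are pairwise non-adjacent; the $j_r$ are pairwise distinct; and $a_{kk}=2$ for all $k\in\mathcal I\cup\mathcal J$, $\mathcal J=\{j_1,\dots,j_l\}$. $\widetilde A$ is obtained from $A$ by setting $a_{j_rj_r}=0$ for all $r$ and deleting the rows and columns $i_1,\dots,i_l$; in $\widetilde A$ the indices coming from $\mathcal J$ are odd, all others are even. Put $e=\sum_r e_{i_r}$, $f=\sum_r f_{i_r}$. One has $(\mathrm{ad}\,e)^3=0$. **Semisimplification.** $\mathrm{Rep}\,\alpha_3$ (representations of the Frobenius kernel of $\mathbb G_a$) is the symmetric tensor category of finite-dimensional $\mathbb K[t]/(t^3)$-modules,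 with $t$ acting on $V\otimes W$ by $t\otimes1+1\otimes t$ and the flip as braiding. Its indecomposables are $J_1,J_2,J_3$, where $t$ acts on $J_n=\mathbb K^n$ as one nilpotent Jordan block; $v_1\mapsto\cdots\mapsto v_n$ denotes a copy of $J_n$ with basis $v_i$ and $tv_i=v_{i+1}$. A Lie algebra $\mathfrak g$ with a derivation $d$, $d^3=0$, is a Lie algebra in $\mathrm{Rep}\,\alpha_3$ with $t$ acting by $d$. The semisimplification functor $V\mapsto\overline V$ is the quotient of $\mathrm{Rep}\,\alpha_3$ by negligible morphisms ($u:V\to W$ with $\mathrm{tr}(u\circ v)=0$ for all $v:W\to V$), with target the Verlinde category $\mathrm{Ver}_3$, whose simple objects are $L_1=\overline{J_1}$, $L_2=\overline{J_2}$ ($\overline{J_3}=0$); $\mathrm{Ver}_3$ is identified with super vector spaces, $L_1$ being an even line and $L_2$ an odd line. So $\overline{\mathfrak g}$ is a Lie superalgebra (in the sense of super antisymmetry and super Jacobi). Explicitly, decompose $\mathfrak g$ into Jordan blocks $x_i$ ($i\le n_1$), $x_i\mapsto x_i'$ ($n_1<i\le n_1+n_2$), and blocks $x_i\mapsto x_i'\mapsto x_i''$. Then $\overline{\mathfrak g}$ has basis $y_i$ ($i\le n_1+n_2$), even for $i\le n_1$ and odd for $i>n_1$; the coefficient of $y_k$ in $[y_i,y_j]$ is the coefficient of $x_k$ in $[x_i,x_j]$ if the parities of $y_i,y_j,y_k$ are compatible and $y_i,y_j$ are not both odd; it is the coefficient of $x_k$ in $-[x_i,x_j']+[x_i',x_j]$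 if $i,j>n_1$, $k\le n_1$; and $0$ otherwise. $y_i$ is the basis vector associated to its block. $\mathrm{sdim}$ denotes superdimension (even dimension | odd dimension). **The subquotient $gen$.** Fix a decomposition of $\mathfrak g(A)^{(1)}$ into indecomposables for $\mathrm{ad}\,e$ that contains the blocks: $e_k$, $f_k$, $h_k$ ($k\notin\mathcal I\cup\mathcal J$) and $h_{j_r}-h_{i_r}$, of type $J_1$; $e_{j_r}\mapsto[e,e_{j_r}]$ and $[f,f_{j_r}]\mapsto f_{j_r}$, of type $J_2$; $f_{i_r}\mapsto h_{i_r}\mapsto e_{i_r}$, of type $J_3$ (such a decomposition exists). The image of a generator $e_k$ or $f_k$ is the basis vector of $\overline{\mathfrak g(A)^{(1)}}$ associated to the block containing it ($0$ for a $J_3$). $\overline{\mathfrak g(A)^{(1)}}^{\,gen}$ is the subquotient of $\overline{\mathfrak g(A)^{(1)}}$ obtained by taking the subalgebra generated by the images of the generators $e_k,f_k$ ($1\le k\le n$) and imposing $[x,[x,x]]=0$ for all odd $x$. *)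

theory Defs
  imports
    "HOL-Library.Poly_Mapping"
    "HOL-Library.Extended_Nat"
    "HOL-Computational_Algebra.Polynomial"
begin

section \<open>Linear algebra\<close>

text \<open>The vector space with basis \<open>'x\<close> is rendered as \<open>'x \<Rightarrow>\<^sub>0 'k\<close>, the basis vector
  of \<open>x\<close> being \<open>Poly_Mapping.single x 1\<close>.\<close>

definition pscale :: "'k::field \<Rightarrow> ('x \<Rightarrow>\<^sub>0 'k) \<Rightarrow> ('x \<Rightarrow>\<^sub>0 'k)" where
  "pscale c p = Poly_Mapping.map (\<lambda>a. c * a) p"

lemma lookup_pscale [simp]: "Poly_Mapping.lookup (pscale c p) x = c * Poly_Mapping.lookup p x"
  by (simp add: pscale_def map.rep_eq when_def)

lemma vector_space_pscale: "vector_space pscale"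
  by unfold_locales (auto intro!: poly_mapping_eqI simp: lookup_add algebra_simps)

definition bilinear_ext ::
  "('x \<Rightarrow> 'x \<Rightarrow> ('x \<Rightarrow>\<^sub>0 'k::field)) \<Rightarrow> ('x \<Rightarrow>\<^sub>0 'k) \<Rightarrow> ('x \<Rightarrow>\<^sub>0 'k) \<Rightarrow> ('x \<Rightarrow>\<^sub>0 'k)" where
  "bilinear_ext c p q =
     (\<Sum>u\<in>Poly_Mapping.keys p. \<Sum>v\<in>Poly_Mapping.keys q. pscale (Poly_Mapping.lookup p u * Poly_Mapping.lookup q v) (c u v))"

text \<open>The library's \<open>dim\<close> is \<open>0\<close> on infinite-dimensional spaces; \<open>edim\<close> separates these.\<close>

definition finite_dimensional ::
  "('k::field \<Rightarrow> 'v::ab_group_add \<Rightarrow> 'v) \<Rightarrow> 'v set \<Rightarrow> bool" where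
  "finite_dimensional s V \<longleftrightarrow> (\<exists>B. finite B \<and> V \<subseteq> module.span s B)"

definition edim :: "('k::field \<Rightarrow> 'v::ab_group_add \<Rightarrow> 'v) \<Rightarrow> 'v set \<Rightarrow> enat" where
  "edim s V = (if finite_dimensional s V then enat (vector_space.dim s V) else \<infinity>)"


section \<open>Lie superalgebras\<close>

text \<open>A superspace is given by two subspaces of an ambient vector space; operations matter
  only on the sum of these, the carrier.\<close>

record ('k, 'v) superalg =
  smul :: "'k \<Rightarrow> 'v \<Rightarrow> 'v"
  even_part :: "'v set"
  odd_part :: "'v set"
  brk :: "'v \<Rightarrow> 'v \<Rightarrow> 'v"

definition carrier :: "('k, 'v::ab_group_add) superalg \<Rightarrow> 'v set" where
  "carrier L = {x + y | x y. x \<in> even_part L \<and> y \<in> odd_part L}"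

text \<open>Parities are Booleans, with \<open>True\<close> for odd.\<close>

definition part :: "('k, 'v) superalg \<Rightarrow> bool \<Rightarrow> 'v set" where
  "part L a = (if a then odd_part L else even_part L)"

definition koszul :: "bool \<Rightarrow> bool \<Rightarrow> 'k::field" where
  "koszul a b = (if a \<and> b then - 1 else 1)"

definition superalgebra :: "('k::field, 'v::ab_group_add) superalg \<Rightarrow> bool" where
  "superalgebra L \<longleftrightarrow>
     vector_space (smul L) \<and>
     module.subspace (smul L) (even_part L) \<and> module.subspace (smul L) (odd_part L) \<and>
     even_part L \<inter> odd_part L = {0} \<and>
     (\<forall>a b. \<forall>x\<in>part L a. \<forall>y\<in>part L b. brk L x y \<in> part L (a \<noteq> b)) \<and>
     (\<forall>x\<in>carrier L. \<forall>y\<in>carrier L. \<forall>z\<in>carrier L.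
        brk L (x + y) z = brk L x z + brk L y z \<and> brk L z (x + y) = brk L z x + brk L z y) \<and>
     (\<forall>c. \<forall>x\<in>carrier L. \<forall>y\<in>carrier L.
        brk L (smul L c x) y = smul L c (brk L x y) \<and>
        brk L x (smul L c y) = smul L c (brk L x y))"

text \<open>The differences of the two sides of the identities: super antisymmetry, super Jacobi,
  and \<open>[x,[x,x]] = 0\<close> for odd \<open>x\<close>.\<close>

definition lie_relators :: "('k::field, 'v::ab_group_add) superalg \<Rightarrow> 'v set" where
  "lie_relators L =
     {brk L x y + smul L (koszul a b) (brk L y x) | a b x y. x \<in> part L a \<and> y \<in> part L b} \<union>
     {brk L x (brk L y z) - brk L (brk L x y) z - smul L (koszul a b) (brk L y (brk L x z))
        | a b c x y z. x \<in> part L a \<and> y \<in> part L b \<and> z \<in> part L c} \<union>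
     {brk L x (brk L x x) | x. x \<in> odd_part L}"

definition lie_superalgebra :: "('k::field, 'v::ab_group_add) superalg \<Rightarrow> bool" where
  "lie_superalgebra L \<longleftrightarrow> superalgebra L \<and> lie_relators L \<subseteq> {0}"

definition superalg_hom ::
  "('k::field, 'v::ab_group_add) superalg \<Rightarrow> ('k, 'w::ab_group_add) superalg \<Rightarrow> ('v \<Rightarrow> 'w) \<Rightarrow> bool"
where
  "superalg_hom L M \<phi> \<longleftrightarrow>
     (\<forall>x\<in>carrier L. \<forall>y\<in>carrier L. \<phi> (x + y) = \<phi> x + \<phi> y) \<and>
     (\<forall>c. \<forall>x\<in>carrier L. \<phi> (smul L c x) = smul M c (\<phi> x)) \<and>
     (\<forall>x\<in>carrier L. \<forall>y\<in>carrier L. \<phi> (brk L x y) = brk M (\<phi> x) (\<phi> y)) \<and>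
     \<phi> ` even_part L \<subseteq> even_part M \<and> \<phi> ` odd_part L \<subseteq> odd_part M"

definition lie_superalgebra_isomorphic ::
  "('k::field, 'v::ab_group_add) superalg \<Rightarrow> ('k, 'w::ab_group_add) superalg \<Rightarrow> bool" where
  "lie_superalgebra_isomorphic L M \<longleftrightarrow>
     lie_superalgebra L \<and> lie_superalgebra M \<and>
     (\<exists>\<phi>. superalg_hom L M \<phi> \<and> bij_betw \<phi> (carrier L) (carrier M))"

definition sdim :: "('k::field, 'v::ab_group_add) superalg \<Rightarrow> enat \<times> enat" where
  "sdim L = (edim (smul L) (even_part L), edim (smul L) (odd_part L))"

definition subalgebra :: "('k::field, 'v::ab_group_add) superalg \<Rightarrow> 'v set \<Rightarrow> bool" where
  "subalgebra L U \<longleftrightarrow>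
     module.subspace (smul L) U \<and> U \<subseteq> carrier L \<and> (\<forall>x\<in>U. \<forall>y\<in>U. brk L x y \<in> U)"

text \<open>Homogeneity of \<open>J\<close> for the parity is not required: the ideals below are generated by
  parity-homogeneous elements or are graded by \<open>Q\<close>, which determines the parity.\<close>

definition ideal :: "('k::field, 'v::ab_group_add) superalg \<Rightarrow> 'v set \<Rightarrow> bool" where
  "ideal L J \<longleftrightarrow>
     module.subspace (smul L) J \<and> J \<subseteq> carrier L \<and>
     (\<forall>x\<in>carrier L. \<forall>y\<in>J. brk L x y \<in> J \<and> brk L y x \<in> J)"

text \<open>Used only for \<open>U\<close> spanned by homogeneous elements, so that its carrier is \<open>U\<close>.\<close>

definition restrict_to :: "('k, 'v) superalg \<Rightarrow> 'v set \<Rightarrow> ('k, 'v) superalg" where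
  "restrict_to L U = L\<lparr>even_part := even_part L \<inter> U, odd_part := odd_part L \<inter> U\<rparr>"

definition derived :: "('k::field, 'v::ab_group_add) superalg \<Rightarrow> ('k, 'v) superalg" where
  "derived L =
     restrict_to L (module.span (smul L) {brk L x y | x y. x \<in> carrier L \<and> y \<in> carrier L})"

text \<open>\<open>M\<close> is the quotient of \<open>L\<close> by the ideal \<open>N\<close>, with projection \<open>\<pi>\<close>.\<close>

definition is_quotient ::
  "('k::field, 'v::ab_group_add) superalg \<Rightarrow> 'v set \<Rightarrow> ('k, 'w::ab_group_add) superalg \<Rightarrow>
     ('v \<Rightarrow> 'w) \<Rightarrow> bool" where
  "is_quotient L N M \<pi> \<longleftrightarrow>
     superalgebra M \<and> superalg_hom L M \<pi> \<and> \<pi> ` carrier L = carrier M \<and>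
     {x \<in> carrier L. \<pi> x = 0} = N"


section \<open>Contragredient Lie superalgebras\<close>

text \<open>Cartan matrices are indexed by a finite set \<open>S\<close>; their size is \<open>card S\<close>.\<close>

definition cartan_matrix :: "'i set \<Rightarrow> ('i \<Rightarrow> bool) \<Rightarrow> ('i \<Rightarrow> 'i \<Rightarrow> int) \<Rightarrow> bool" where
  "cartan_matrix S par A \<longleftrightarrow>
     finite S \<and>
     (\<forall>i\<in>S. \<not> par i \<longrightarrow> A i i \<in> {0, 2}) \<and>
     (\<forall>i\<in>S. par i \<longrightarrow> A i i \<in> {0, 1}) \<and>
     (\<forall>i\<in>S. A i i \<in> {1, 2} \<longrightarrow> (\<forall>j\<in>S. j \<noteq> i \<longrightarrow> A i j \<le> 0)) \<and>
     (\<forall>i\<in>S. \<forall>j\<in>S. i \<noteq> j \<longrightarrow> (A i j = 0 \<longleftrightarrow> A j i = 0))"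

text \<open>The rank (row rank) of the reduction of \<open>A\<close> to the field \<open>'k\<close>.\<close>

definition reduction_rank :: "'k::field itself \<Rightarrow> 'i set \<Rightarrow> ('i \<Rightarrow> 'i \<Rightarrow> int) \<Rightarrow> nat" where
  "reduction_rank _ S A =
     vector_space.dim (pscale :: 'k \<Rightarrow> ('i \<Rightarrow>\<^sub>0 'k) \<Rightarrow> ('i \<Rightarrow>\<^sub>0 'k))
       ((\<lambda>i. \<Sum>j\<in>S. Poly_Mapping.single j (of_int (A i j))) ` S)"

text \<open>The space underlying the type \<open>'h\<close> is the extended Cartan subalgebra, of dimension
  \<open>2n - s\<close>; \<open>\<alpha> j\<close> is the linear functional \<open>\<alpha>\<^sub>j\<close>.\<close>

definition realization ::
  "'i set \<Rightarrow> ('i \<Rightarrow> 'i \<Rightarrow> int) \<Rightarrow> ('k::field \<Rightarrow> 'h::ab_group_add \<Rightarrow> 'h) \<Rightarrow>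
     ('i \<Rightarrow> 'h) \<Rightarrow> ('i \<Rightarrow> 'h \<Rightarrow> 'k) \<Rightarrow> bool" where
  "realization S A sH h \<alpha> \<longleftrightarrow>
     vector_space sH \<and>
     edim sH UNIV = enat (2 * card S - reduction_rank TYPE('k) S A) \<and>
     (\<forall>c. (\<Sum>i\<in>S. sH (c i) (h i)) = 0 \<longrightarrow> (\<forall>i\<in>S. c i = 0)) \<and>
     (\<forall>j\<in>S. Vector_Spaces.linear sH (*) (\<alpha> j)) \<and>
     (\<forall>c. (\<forall>x. (\<Sum>j\<in>S. c j * \<alpha> j x) = 0) \<longrightarrow> (\<forall>j\<in>S. c j = 0)) \<and>
     (\<forall>i\<in>S. \<forall>j\<in>S. \<alpha> j (h i) = of_int (A i j))"

datatype ('i, 'h) gen = HG 'h | EG 'i | FG 'i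

datatype 'x mono = Gen 'x | Br "'x mono" "'x mono"

primrec gen_par :: "('i \<Rightarrow> bool) \<Rightarrow> ('i, 'h) gen \<Rightarrow> bool" where
  "gen_par par (HG x) = False"
| "gen_par par (EG i) = par i"
| "gen_par par (FG i) = par i"

primrec gen_weight :: "('i, 'h) gen \<Rightarrow> ('i \<Rightarrow>\<^sub>0 int)" where
  "gen_weight (HG x) = 0"
| "gen_weight (EG i) = frag_of i"
| "gen_weight (FG i) = - frag_of i"

primrec mono_par :: "('i \<Rightarrow> bool) \<Rightarrow> ('i, 'h) gen mono \<Rightarrow> bool" where
  "mono_par par (Gen g) = gen_par par g"
| "mono_par par (Br u v) = (mono_par par u \<noteq> mono_par par v)"

primrec mono_weight :: "('i, 'h) gen mono \<Rightarrow> ('i \<Rightarrow>\<^sub>0 int)" where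
  "mono_weight (Gen g) = gen_weight g"
| "mono_weight (Br u v) = mono_weight u + mono_weight v"

definition generators :: "'i set \<Rightarrow> ('i, 'h) gen set" where
  "generators S = range HG \<union> EG ` S \<union> FG ` S"

text \<open>The free nonassociative superalgebra on the generators.\<close>

definition free_superalg ::
  "'i set \<Rightarrow> ('i \<Rightarrow> bool) \<Rightarrow> ('k::field, ('i, 'h) gen mono \<Rightarrow>\<^sub>0 'k) superalg" where
  "free_superalg S par =
     \<lparr>smul = pscale,
      even_part = {p. \<forall>u\<in>Poly_Mapping.keys p. set_mono u \<subseteq> generators S \<and> \<not> mono_par par u},
      odd_part = {p. \<forall>u\<in>Poly_Mapping.keys p. set_mono u \<subseteq> generators S \<and> mono_par par u},
      brk = bilinear_ext (\<lambda>u v. Poly_Mapping.single (Br u v) 1)\<rparr>"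

definition gvar :: "'x \<Rightarrow> ('x mono \<Rightarrow>\<^sub>0 'k::field)" where
  "gvar g = Poly_Mapping.single (Gen g) 1"

text \<open>The first two sets make \<open>x \<mapsto> HG x\<close> linear.\<close>

definition chevalley_relators ::
  "'i set \<Rightarrow> ('i \<Rightarrow> bool) \<Rightarrow> ('k::field \<Rightarrow> 'h::ab_group_add \<Rightarrow> 'h) \<Rightarrow>
     ('i \<Rightarrow> 'h) \<Rightarrow> ('i \<Rightarrow> 'h \<Rightarrow> 'k) \<Rightarrow> (('i, 'h) gen mono \<Rightarrow>\<^sub>0 'k) set" where
  "chevalley_relators S par sH h \<alpha> =
     (let br = brk (free_superalg S par) in
       {gvar (HG (x + y)) - gvar (HG x) - gvar (HG y) | x y. True} \<union>
       {gvar (HG (sH c x)) - pscale c (gvar (HG x)) | c x. True} \<union>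
       {br (gvar (HG x)) (gvar (HG y)) | x y. True} \<union>
       {br (gvar (HG x)) (gvar (EG j)) - pscale (\<alpha> j x) (gvar (EG j)) | x j. j \<in> S} \<union>
       {br (gvar (HG x)) (gvar (FG j)) + pscale (\<alpha> j x) (gvar (FG j)) | x j. j \<in> S} \<union>
       {br (gvar (EG i)) (gvar (FG j)) - (if i = j then gvar (HG (h i)) else 0)
          | i j. i \<in> S \<and> j \<in> S})"

text \<open>The kernel of the projection from the free superalgebra onto \<open>g~(A)\<close>.\<close>

definition tilde_ideal ::
  "'i set \<Rightarrow> ('i \<Rightarrow> bool) \<Rightarrow> ('k::field \<Rightarrow> 'h::ab_group_add \<Rightarrow> 'h) \<Rightarrow>
     ('i \<Rightarrow> 'h) \<Rightarrow> ('i \<Rightarrow> 'h \<Rightarrow> 'k) \<Rightarrow> (('i, 'h) gen mono \<Rightarrow>\<^sub>0 'k) set" where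
  "tilde_ideal S par sH h \<alpha> =
     ideal (free_superalg S par) hull
       (lie_relators (free_superalg S par) \<union> chevalley_relators S par sH h \<alpha>)"

definition weight_space ::
  "'i set \<Rightarrow> ('i \<Rightarrow> bool) \<Rightarrow> ('i \<Rightarrow>\<^sub>0 int) \<Rightarrow> (('i, 'h) gen mono \<Rightarrow>\<^sub>0 'k::field) set" where
  "weight_space S par \<beta> = {p \<in> carrier (free_superalg S par). \<forall>u\<in>Poly_Mapping.keys p. mono_weight u = \<beta>}"

definition Q_graded ::
  "'i set \<Rightarrow> ('i \<Rightarrow> bool) \<Rightarrow> (('i, 'h) gen mono \<Rightarrow>\<^sub>0 'k::field) set \<Rightarrow> bool" where
  "Q_graded S par J \<longleftrightarrow> J = module.span pscale (\<Union>\<beta>. J \<inter> weight_space S par \<beta>)"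

text \<open>Ideals of \<open>g~(A)\<close> are written as the ideals \<open>J\<close> of the free superalgebra that contain
  \<open>tilde_ideal\<close>. Such a \<open>J\<close> meets the image of \<open>'h\<close> trivially in the quotient iff every \<open>HG x\<close>
  lying in \<open>J\<close> is already zero in \<open>g~(A)\<close>. The result is the kernel of the projection onto
  \<open>g(A)\<close>.\<close>

definition contragredient_ideal ::
  "'i set \<Rightarrow> ('i \<Rightarrow> bool) \<Rightarrow> ('k::field \<Rightarrow> 'h::ab_group_add \<Rightarrow> 'h) \<Rightarrow>
     ('i \<Rightarrow> 'h) \<Rightarrow> ('i \<Rightarrow> 'h \<Rightarrow> 'k) \<Rightarrow> (('i, 'h) gen mono \<Rightarrow>\<^sub>0 'k) set" where
  "contragredient_ideal S par sH h \<alpha> =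
     (GREATEST J. ideal (free_superalg S par) J \<and> tilde_ideal S par sH h \<alpha> \<subseteq> J \<and>
        Q_graded S par J \<and>
        (\<forall>x. gvar (HG x) \<in> J \<longrightarrow> gvar (HG x) \<in> tilde_ideal S par sH h \<alpha>))"

text \<open>\<open>G\<close> is \<open>g(A)\<close> built from the realization \<open>(sH, h, \<alpha>)\<close> of \<open>A\<close>; the Chevalley generators
  are \<open>gE \<pi> i\<close>, \<open>gF \<pi> i\<close> and \<open>gH \<pi> h i\<close>.\<close>

definition contragredient ::
  "'i set \<Rightarrow> ('i \<Rightarrow> bool) \<Rightarrow> ('i \<Rightarrow> 'i \<Rightarrow> int) \<Rightarrow> ('k::field \<Rightarrow> 'h::ab_group_add \<Rightarrow> 'h) \<Rightarrow>
     ('i \<Rightarrow> 'h) \<Rightarrow> ('i \<Rightarrow> 'h \<Rightarrow> 'k) \<Rightarrow> ('k, 'g::ab_group_add) superalg \<Rightarrow>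
     ((('i, 'h) gen mono \<Rightarrow>\<^sub>0 'k) \<Rightarrow> 'g) \<Rightarrow> bool" where
  "contragredient S par A sH h \<alpha> G \<pi> \<longleftrightarrow>
     realization S A sH h \<alpha> \<and>
     is_quotient (free_superalg S par) (contragredient_ideal S par sH h \<alpha>) G \<pi>"

definition gE :: "((('i, 'h) gen mono \<Rightarrow>\<^sub>0 'k::field) \<Rightarrow> 'g) \<Rightarrow> 'i \<Rightarrow> 'g" where
  "gE \<pi> i = \<pi> (gvar (EG i))"

definition gF :: "((('i, 'h) gen mono \<Rightarrow>\<^sub>0 'k::field) \<Rightarrow> 'g) \<Rightarrow> 'i \<Rightarrow> 'g" where
  "gF \<pi> i = \<pi> (gvar (FG i))"

definition gH :: "((('i, 'h) gen mono \<Rightarrow>\<^sub>0 'k::field) \<Rightarrow> 'g) \<Rightarrow> ('i \<Rightarrow> 'h) \<Rightarrow> 'i \<Rightarrow> 'g" where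
  "gH \<pi> h i = \<pi> (gvar (HG (h i)))"


section \<open>Admissible sets of nodes\<close>

definition adjacent :: "('i \<Rightarrow> 'i \<Rightarrow> int) \<Rightarrow> 'i \<Rightarrow> 'i \<Rightarrow> bool" where
  "adjacent A i j \<longleftrightarrow> i \<noteq> j \<and> A i j \<noteq> 0"

text \<open>\<open>nb\<close> sends \<open>i\<^sub>r\<close> to \<open>j\<^sub>r\<close>.\<close>

definition admissible ::
  "'i set \<Rightarrow> ('i \<Rightarrow> 'i \<Rightarrow> int) \<Rightarrow> 'i set \<Rightarrow> ('i \<Rightarrow> 'i) \<Rightarrow> bool" where
  "admissible S A I nb \<longleftrightarrow>
     I \<subseteq> S \<and>
     (\<forall>i\<in>I. {j \<in> S. adjacent A i j} = {nb i} \<and> A i (nb i) = - 1 \<and> A (nb i) i = - 1) \<and>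
     (\<forall>i\<in>I. \<forall>i'\<in>I. \<not> adjacent A i i') \<and>
     inj_on nb I \<and>
     (\<forall>k\<in>I \<union> nb ` I. A k k = 2)"

text \<open>Deletion of the rows and columns in \<open>I\<close> is expressed by the index set \<open>S - I\<close>.\<close>

definition tilde_matrix :: "('i \<Rightarrow> 'i \<Rightarrow> int) \<Rightarrow> 'i set \<Rightarrow> 'i \<Rightarrow> 'i \<Rightarrow> int" where
  "tilde_matrix A J i j = (if i = j \<and> i \<in> J then 0 else A i j)"


section \<open>Semisimplification\<close>

text \<open>A Jordan block is the list \<open>[x]\<close>, \<open>[x, x']\<close> or \<open>[x, x', x'']\<close> of its basis vectors.\<close>

definition jordan_decomposition ::
  "('k::field, 'v::ab_group_add) superalg \<Rightarrow> ('v \<Rightarrow> 'v) \<Rightarrow> 'v list set \<Rightarrow> bool" where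
  "jordan_decomposition L d \<B> \<longleftrightarrow>
     (\<forall>b\<in>\<B>. length b \<in> {1, 2, 3} \<and>
        (\<forall>m. Suc m < length b \<longrightarrow> d (b ! m) = b ! Suc m) \<and> d (last b) = 0) \<and>
     inj_on (\<lambda>(b, m). b ! m) (SIGMA b:\<B>. {..<length b}) \<and>
     \<not> module.dependent (smul L) (\<Union>b\<in>\<B>. set b) \<and>
     module.span (smul L) (\<Union>b\<in>\<B>. set b) = carrier L"

text \<open>The coefficient of \<open>y\<^sub>c\<close> in \<open>[y\<^sub>a, y\<^sub>b]\<close>, where \<open>y\<^sub>b\<close> is the basis vector of the
  semisimplification belonging to the block \<open>b\<close>. In the case of two odd vectors,
  \<open>x' \<otimes> y - x \<otimes> y'\<close> spans the copy of \<open>J\<^sub>1\<close> in \<open>J\<^sub>2 \<otimes> J\<^sub>2 = J\<^sub>1 \<oplus> J\<^sub>3\<close>.\<close>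

definition structure_constant ::
  "('k::field, 'v::ab_group_add) superalg \<Rightarrow> 'v list set \<Rightarrow> 'v list \<Rightarrow> 'v list \<Rightarrow> 'v list \<Rightarrow> 'k"
where
  "structure_constant L \<B> a b c =
     (let coef = (\<lambda>v. module.representation (smul L) (\<Union>b\<in>\<B>. set b) v (c ! 0)) in
      if (length a, length b, length c) \<in> {(1, 1, 1), (1, 2, 2), (2, 1, 2)}
        then coef (brk L (a ! 0) (b ! 0))
      else if (length a, length b, length c) = (2, 2, 1)
        then coef (- brk L (a ! 0) (b ! 1) + brk L (a ! 1) (b ! 0))
      else 0)"

definition semisimplification ::
  "('k::field, 'v::ab_group_add) superalg \<Rightarrow> 'v list set \<Rightarrow> ('k, 'v list \<Rightarrow>\<^sub>0 'k) superalg" where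
  "semisimplification L \<B> =
     \<lparr>smul = pscale,
      even_part = {p. Poly_Mapping.keys p \<subseteq> {b \<in> \<B>. length b = 1}},
      odd_part = {p. Poly_Mapping.keys p \<subseteq> {b \<in> \<B>. length b = 2}},
      brk = bilinear_ext (\<lambda>a b. \<Sum>c\<in>\<B>. Poly_Mapping.single c (structure_constant L \<B> a b c))\<rparr>"

definition block_image :: "'v list \<Rightarrow> ('v list \<Rightarrow>\<^sub>0 'k::field)" where
  "block_image b = (if length b = 3 then 0 else Poly_Mapping.single b 1)"


section \<open>The generated subquotient\<close>

definition ad_e ::
  "('k::field, 'g::ab_group_add) superalg \<Rightarrow> ((('i, 'h) gen mono \<Rightarrow>\<^sub>0 'k) \<Rightarrow> 'g) \<Rightarrow> 'i set \<Rightarrow>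
     'g \<Rightarrow> 'g" where
  "ad_e G \<pi> I = brk G (\<Sum>i\<in>I. gE \<pi> i)"

definition adapted_decomposition ::
  "'i set \<Rightarrow> ('i \<Rightarrow> 'h) \<Rightarrow> ('k::field, 'g::ab_group_add) superalg \<Rightarrow>
     ((('i, 'h) gen mono \<Rightarrow>\<^sub>0 'k) \<Rightarrow> 'g) \<Rightarrow> 'i set \<Rightarrow> ('i \<Rightarrow> 'i) \<Rightarrow> 'g list set \<Rightarrow> bool" where
  "adapted_decomposition S h G \<pi> I nb \<B> \<longleftrightarrow>
     jordan_decomposition (derived G) (ad_e G \<pi> I) \<B> \<and>
     (\<forall>k\<in>S - (I \<union> nb ` I). [gE \<pi> k] \<in> \<B> \<and> [gF \<pi> k] \<in> \<B> \<and> [gH \<pi> h k] \<in> \<B>) \<and>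
     (\<forall>i\<in>I.
        [gH \<pi> h (nb i) - gH \<pi> h i] \<in> \<B> \<and>
        [gE \<pi> (nb i), ad_e G \<pi> I (gE \<pi> (nb i))] \<in> \<B> \<and>
        [brk G (\<Sum>r\<in>I. gF \<pi> r) (gF \<pi> (nb i)), gF \<pi> (nb i)] \<in> \<B> \<and>
        [gF \<pi> i, gH \<pi> h i, gE \<pi> i] \<in> \<B>)"

definition generator_images ::
  "'i set \<Rightarrow> ((('i, 'h) gen mono \<Rightarrow>\<^sub>0 'k::field) \<Rightarrow> 'g) \<Rightarrow> 'g list set \<Rightarrow> ('g list \<Rightarrow>\<^sub>0 'k) set"
where
  "generator_images S \<pi> \<B> =
     {block_image b | b. b \<in> \<B> \<and> (\<exists>k\<in>S. gE \<pi> k \<in> set b \<or> gF \<pi> k \<in> set b)}"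

text \<open>A pair \<open>(U, N)\<close> of a subalgebra \<open>U\<close> of \<open>L\<close> and an ideal \<open>N\<close> of \<open>U\<close> stands for the
  subquotient \<open>U / N\<close> of \<open>L\<close>; thus \<open>L\<close> itself is the subquotient \<open>(L, {0})\<close>.\<close>

definition gen_subquotient ::
  "('k::field, 'v::ab_group_add) superalg \<Rightarrow> 'v set \<Rightarrow> ('k, 'v) superalg \<times> 'v set" where
  "gen_subquotient L X =
     (let U = restrict_to L (subalgebra L hull X)
      in (U, ideal U hull {brk U x (brk U x x) | x. x \<in> odd_part U}))"

end

theory Submission
  imports Defs
begin

text \<open>With \<open>t = ad e\<close>, the even part of the semisimplification of \<open>g(A)\<^sup>(\<^sup>1\<^sup>)\<close> is \<open>ker t\<close> modulo the image of
  \<open>t\<close>, and its odd part is \<open>ker t\<^sup>2\<close> modulo \<open>ker t + im t\<close>; in characteristic \<open>3\<close> the bracket descends to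
  these quotients and satisfies super antisymmetry and super Jacobi. Hence it is graded by \<open>Q\<close>
  modulo the \<open>\<alpha>\<^sub>i\<close> with \<open>i \<in> I\<close>, although the Jordan blocks need not be homogeneous.

  The images of \<open>e\<^sub>k\<close>, \<open>f\<^sub>k\<close> with \<open>k \<notin> I\<close> satisfy the Chevalley relations of the matrix \<open>A~\<close>, where the
  Cartan elements are the classes of \<open>h\<^sub>k\<close> and of \<open>h\<^sub>j - h\<^sub>i\<close> for \<open>j = nb i\<close>. Let \<open>F\<close> be the free algebra on
  these generators, \<open>\<psi>\<close> its map to the semisimplification and \<open>\<pi>'\<close> its map onto \<open>g(A~)\<^sup>(\<^sup>1\<^sup>)\<close>. The
  kernel of \<open>\<psi>\<close> is graded, and its weight-zero part lies in the kernel of \<open>\<pi>'\<close>: by the triangular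
  decomposition modulo the common kernel, weight zero is spanned by the \<open>[e\<^sub>k, f\<^sub>k]\<close>, whose images under
  \<open>\<psi>\<close> are independent. By maximality of the ideal defining \<open>g(A~)\<close>, the kernel of \<open>\<psi>\<close> lies in that of
  \<open>\<pi>'\<close>. Thus \<open>g(A~)\<^sup>(\<^sup>1\<^sup>)\<close> is a quotient of the image of \<open>\<psi>\<close>, and equality of the superdimensions forces
  \<open>\<psi>\<close> to be surjective with the same kernel as \<open>\<pi>'\<close>.\<close>

section \<open>Linear algebra over formal linear combinations\<close>

text \<open>Two obstacles shape the argument. The identity [x,[x,x]] = 0 is not known for the
  semisimplification beforehand, so the kernel of \<open>\<psi>\<close> is not known to contain the
  cubic relators. Up to the dimension count only antisymmetry and Jacobi are used there; the cubic
  identity is carried over from g(A~) once the kernels agree. Also, \<open>\<psi>\<close> is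
  meaningful only on words in the e_k and f_k, since the extended Cartan subalgebra of g(A~) has no
  counterpart in the semisimplification. Maximality is therefore applied to the sum of
  \<open>contragredient_ideal\<close> and the kernel of \<open>\<psi>\<close>, whose stability under
  Cartan generators comes from the grading of that kernel. Independence of the Cartan images rests
  on the embedding of the Cartan subalgebra into g(A), proved with an explicit module.
  Characteristic 3 enters twice: in the bracket identities for t, and in the difference of rows j
  and i of A, whose entries -1 - 2 and 2 + 1 vanish. The former makes h_j - h_i commute with e_i,
  the latter gives A~ its zero diagonal entry.\<close>

interpretation pm: vector_space pscale by (rule vector_space_pscale)

abbreviation lookup :: "('x \<Rightarrow>\<^sub>0 'k::zero) \<Rightarrow> 'x \<Rightarrow> 'k" where "lookup \<equiv> Poly_Mapping.lookup"
abbreviation keys :: "('x \<Rightarrow>\<^sub>0 'k::zero) \<Rightarrow> 'x set" where "keys \<equiv> Poly_Mapping.keys"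
abbreviation single :: "'x \<Rightarrow> 'k \<Rightarrow> ('x \<Rightarrow>\<^sub>0 'k::zero)" where "single \<equiv> Poly_Mapping.single"

abbreviation mon :: "'x \<Rightarrow> ('x \<Rightarrow>\<^sub>0 'k::field)" where
  "mon u \<equiv> single u 1"

definition mspan :: "'x set \<Rightarrow> ('x \<Rightarrow>\<^sub>0 'k::field) set" where
  "mspan M = {p. keys p \<subseteq> M}"

lemma pscale_single [simp]: "pscale c (single u a) = single u (c * a)"
  by (rule poly_mapping_eqI) (simp add: lookup_single when_def)

lemma mspan_iff: "p \<in> mspan M \<longleftrightarrow> (\<forall>u. lookup p u \<noteq> 0 \<longrightarrow> u \<in> M)"
  by (auto simp: mspan_def in_keys_iff)

lemma subspace_mspan [simp]: "pm.subspace (mspan M)"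
proof (rule pm.subspaceI)
  show "x + y \<in> mspan M" if "x \<in> mspan M" "y \<in> mspan M" for x y
    using that unfolding mspan_iff lookup_add by (metis add_0)
qed (auto simp: mspan_iff)

lemmas mspan_0 = pm.subspace_0[OF subspace_mspan]
  and mspan_add = pm.subspace_add[OF subspace_mspan]
  and mspan_diff = pm.subspace_diff[OF subspace_mspan]
  and mspan_neg = pm.subspace_neg[OF subspace_mspan]
  and mspan_scale = pm.subspace_scale[OF subspace_mspan]
  and mspan_sum = pm.subspace_sum[OF subspace_mspan]

lemma single_in_mspan [simp]: "u \<in> M \<Longrightarrow> single u c \<in> mspan M"
  by (auto simp: mspan_iff lookup_single when_def)

lemma mspan_mono: "M \<subseteq> N \<Longrightarrow> p \<in> mspan M \<Longrightarrow> p \<in> mspan N"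
  by (auto simp: mspan_iff)

lemma sum_singles: "(\<Sum>u\<in>keys p. single u (lookup p u)) = p"
proof (rule poly_mapping_eqI)
  fix v
  show "lookup (\<Sum>u\<in>keys p. single u (lookup p u)) v
      = lookup p v"
    by (simp add: lookup_sum lookup_single when_def in_keys_iff)
qed

lemma mspan_induct [consumes 1, case_names zero single add]:
  assumes p: "p \<in> mspan M" and z: "P 0"
    and s: "\<And>c u. u \<in> M \<Longrightarrow> P (single u c)"
    and a: "\<And>p q. p \<in> mspan M \<Longrightarrow> q \<in> mspan M \<Longrightarrow> P p \<Longrightarrow> P q \<Longrightarrow> P (p + q)"
  shows "P p"
proof -
  have "(\<Sum>u\<in>U. single u (lookup p u)) \<in> mspan M \<and>
        P (\<Sum>u\<in>U. single u (lookup p u))"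
    if "finite U" "U \<subseteq> keys p" for U
    using that
  proof (induction U)
    case empty
    then show ?case using z by (simp add: pm.subspace_0)
  next
    case (insert u U)
    then have "u \<in> M" using p by (auto simp: mspan_def)
    with insert show ?case
      by (auto intro!: a s pm.subspace_add)
  qed
  from this[OF finite_keys order_refl] show ?thesis by (simp add: sum_singles)
qed

lemma mspan_subset:
  assumes "pm.subspace X" "\<And>u. u \<in> M \<Longrightarrow> mon u \<in> X" "p \<in> mspan M"
  shows "p \<in> X"
  using assms(3)
proof (induction rule: mspan_induct)
  case (single c u)
  have "pscale c (mon u) \<in> X" using assms(1,2) single by (blast intro: pm.subspace_scale)
  then show ?case by simp
qed (auto intro: pm.subspace_add pm.subspace_0 assms(1))

definition lext :: "('k::field \<Rightarrow> 'v::ab_group_add \<Rightarrow> 'v) \<Rightarrow> ('x \<Rightarrow> 'v) \<Rightarrow> ('x \<Rightarrow>\<^sub>0 'k) \<Rightarrow> 'v" where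
  "lext s f p = (\<Sum>u\<in>keys p. s (lookup p u) (f u))"

context vector_space
begin

lemma lext_superset:
  assumes "finite U" "keys p \<subseteq> U"
  shows "lext scale f p = (\<Sum>u\<in>U. scale (lookup p u) (f u))"
  unfolding lext_def using assms by (intro sum.mono_neutral_left) (auto simp: in_keys_iff)

lemma lext_single [simp]: "lext scale f (single u c) = scale c (f u)"
  by (subst lext_superset[of "{u}"]) auto

lemma lext_add [simp]: "lext scale f (p + q) = lext scale f p + lext scale f q"
proof -
  let ?U = "keys p \<union> keys q"
  have "keys (p + q) \<subseteq> ?U" by (rule keys_add)
  then show ?thesis
    by (simp add: lext_superset[of ?U] lookup_add scale_left_distrib sum.distrib)
qed

lemma lext_scale [simp]: "lext scale f (pscale c p) = scale c (lext scale f p)"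
proof -
  have "keys (pscale c p) \<subseteq> keys p" by (auto simp: in_keys_iff)
  then have "lext scale f (pscale c p) = (\<Sum>u\<in>keys p. scale (c * lookup p u) (f u))"
    by (simp add: lext_superset[of "keys p"])
  then show ?thesis by (simp only: lext_def scale_sum_right scale_scale)
qed

lemma lext_zero [simp]: "lext scale f 0 = 0"
  by (simp add: lext_def)

lemma lext_diff [simp]: "lext scale f (p - q) = lext scale f p - lext scale f q"
  using lext_add[of f "p - q" q] by (simp add: algebra_simps)

lemma lext_uminus [simp]: "lext scale f (- p) = - lext scale f p"
  using lext_diff[of f 0 p] by simp

lemma lext_sum: "lext scale f (\<Sum>i\<in>A. g i) = (\<Sum>i\<in>A. lext scale f (g i))"
  by (induction A rule: infinite_finite_induct) auto

lemma lext_in_subspace: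
  "subspace X \<Longrightarrow> (\<And>u. u \<in> M \<Longrightarrow> f u \<in> X) \<Longrightarrow> p \<in> mspan M \<Longrightarrow> lext scale f p \<in> X"
  unfolding lext_def mspan_def by (auto intro!: subspace_sum subspace_scale)

end

lemma bilinear_ext_lext:
  "bilinear_ext c p q = lext pscale (\<lambda>u. lext pscale (c u) q) p"
  by (simp add: bilinear_ext_def lext_def pm.scale_sum_right)

text \<open>With the order of summation exchanged, the outer extension runs over the second
  argument; linearity in that argument is then linearity of \<open>lext\<close>.\<close>

lemma bilinear_ext_lext':
  "bilinear_ext c p q = lext pscale (\<lambda>v. lext pscale (\<lambda>u. c u v) p) q"
  unfolding bilinear_ext_def lext_def pm.scale_sum_right
  by (subst sum.swap) (simp add: mult.commute)

lemma bilinear_ext_add_left: "bilinear_ext c (p + q) r = bilinear_ext c p r + bilinear_ext c q r"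
  and bilinear_ext_diff_left: "bilinear_ext c (p - q) r = bilinear_ext c p r - bilinear_ext c q r"
  and bilinear_ext_uminus_left: "bilinear_ext c (- p) r = - bilinear_ext c p r"
  and bilinear_ext_zero_left: "bilinear_ext c 0 r = 0"
  and bilinear_ext_scale_left: "bilinear_ext c (pscale a p) r = pscale a (bilinear_ext c p r)"
  by (simp_all add: bilinear_ext_lext)

lemma bilinear_ext_add_right: "bilinear_ext c r (p + q) = bilinear_ext c r p + bilinear_ext c r q"
  and bilinear_ext_diff_right: "bilinear_ext c r (p - q) = bilinear_ext c r p - bilinear_ext c r q"
  and bilinear_ext_uminus_right: "bilinear_ext c r (- p) = - bilinear_ext c r p"
  and bilinear_ext_zero_right: "bilinear_ext c r 0 = 0"
  and bilinear_ext_scale_right: "bilinear_ext c r (pscale a p) = pscale a (bilinear_ext c r p)"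
  by (simp_all add: bilinear_ext_lext')

lemma bilinear_ext_single:
  "bilinear_ext c (single u a) (single v b) = pscale (a * b) (c u v)"
  by (simp add: bilinear_ext_lext mult.commute)

lemmas bilinear_ext_simps =
  bilinear_ext_add_left bilinear_ext_diff_left bilinear_ext_uminus_left bilinear_ext_zero_left
  bilinear_ext_scale_left bilinear_ext_add_right bilinear_ext_diff_right
  bilinear_ext_uminus_right bilinear_ext_zero_right bilinear_ext_scale_right bilinear_ext_single

text \<open>Coordinate projection. Homogeneous components for the weight, for the coarser weight
  modulo I, and for the parity are all instances.\<close>

definition pres :: "('x \<Rightarrow> bool) \<Rightarrow> ('x \<Rightarrow>\<^sub>0 'k::field) \<Rightarrow> ('x \<Rightarrow>\<^sub>0 'k)" where
  "pres P = lext pscale (\<lambda>u. if P u then mon u else 0)"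

lemma lookup_pres: "lookup (pres P p) u = (if P u then lookup p u else 0)"
proof -
  have "lookup (pres P p) u =
    (\<Sum>v\<in>keys p. if v = u then (if P u then lookup p u else 0) else 0)"
    unfolding pres_def lext_def lookup_sum
    by (intro sum.cong) (auto simp: lookup_single when_def)
  then show ?thesis by (auto simp: in_keys_iff)
qed

lemma pres_add [simp]: "pres P (p + q) = pres P p + pres P q"
  and pres_diff [simp]: "pres P (p - q) = pres P p - pres P q"
  and pres_zero [simp]: "pres P 0 = 0"
  and pres_scale [simp]: "pres P (pscale c p) = pscale c (pres P p)"
  and pres_single: "pres P (single u c) = (if P u then single u c else 0)"
  by (auto simp: pres_def)

lemma pres_sum: "pres P (\<Sum>i\<in>A. g i) = (\<Sum>i\<in>A. pres P (g i))"
  by (simp add: pres_def pm.lext_sum)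

lemma pres_mspan: "p \<in> mspan M \<Longrightarrow> pres P p \<in> mspan {u \<in> M. P u}"
  by (auto simp: mspan_iff lookup_pres)

lemma pres_mspan': "p \<in> mspan M \<Longrightarrow> pres P p \<in> mspan M"
  by (auto simp: mspan_iff lookup_pres)

lemma pres_id: "p \<in> mspan {u. P u} \<Longrightarrow> pres P p = p"
  by (rule poly_mapping_eqI) (auto simp: mspan_iff lookup_pres)

lemma pres_eq_0: "p \<in> mspan {u. \<not> P u} \<Longrightarrow> pres P p = 0"
  by (rule poly_mapping_eqI) (auto simp: mspan_iff lookup_pres)

lemma sum_pres:
  assumes "finite Z" "f ` keys p \<subseteq> Z"
  shows "(\<Sum>\<gamma>\<in>Z. pres (\<lambda>u. f u = \<gamma>) p) = p"
proof (rule poly_mapping_eqI)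
  fix u
  show "lookup (\<Sum>\<gamma>\<in>Z. pres (\<lambda>u. f u = \<gamma>) p) u = lookup p u"
  proof (cases "f u \<in> Z")
    case True
    then show ?thesis using assms(1) by (simp add: lookup_sum lookup_pres)
  next
    case False
    then have "lookup p u = 0" using assms(2) in_keys_iff[of u p] by blast
    then have "(if f u = \<gamma> then lookup p u else 0) = 0" for \<gamma> by simp
    with False show ?thesis by (simp only: lookup_sum lookup_pres sum.neutral_const \<open>lookup p u = 0\<close>)
  qed
qed

text \<open>Since \<open>ker f \<subseteq> ker g\<close>, the image of \<open>g\<close> is a quotient of the image of \<open>f\<close>.\<close>

lemma kernels_equal_by_dimension:
  fixes s1 :: "'k::field \<Rightarrow> 'u::ab_group_add \<Rightarrow> 'u" and s2 :: "'k \<Rightarrow> 'a::ab_group_add \<Rightarrow> 'a"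
    and s3 :: "'k \<Rightarrow> 'b::ab_group_add \<Rightarrow> 'b"
  assumes V1: "vector_space s1" and V2: "vector_space s2" and V3: "vector_space s3"
    and V: "module.subspace s1 V" and A: "module.subspace s2 A"
    and f: "\<And>x y. x \<in> V \<Longrightarrow> y \<in> V \<Longrightarrow> f (x + y) = f x + f y"
           "\<And>c x. x \<in> V \<Longrightarrow> f (s1 c x) = s2 c (f x)"
    and g: "\<And>x y. x \<in> V \<Longrightarrow> y \<in> V \<Longrightarrow> g (x + y) = g x + g y"
           "\<And>c x. x \<in> V \<Longrightarrow> g (s1 c x) = s3 c (g x)"
    and fA: "f ` V \<subseteq> A" and ker: "\<And>x. x \<in> V \<Longrightarrow> f x = 0 \<Longrightarrow> g x = 0"
    and fin: "finite_dimensional s2 A" and dim: "edim s2 A = edim s3 (g ` V)"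
  shows "f ` V = A" and "\<And>x. x \<in> V \<Longrightarrow> g x = 0 \<Longrightarrow> f x = 0"
proof -
  interpret v1: vector_space s1 by fact
  interpret v2: vector_space s2 by fact
  interpret v3: vector_space s3 by fact
  have fin3: "finite_dimensional s3 (g ` V)"
    using fin dim by (auto simp: edim_def split: if_splits)
  have dim': "v2.dim A = v3.dim (g ` V)" using fin fin3 dim by (simp add: edim_def)
  obtain b where b: "b \<subseteq> g ` V" "v3.independent b" "g ` V \<subseteq> v3.span b" "card b = v3.dim (g ` V)"
    by (rule v3.basis_exists[of "g ` V"])
  have finb: "finite b"
  proof -
    obtain B where "finite B" "g ` V \<subseteq> v3.span B" using fin3 by (auto simp: finite_dimensional_def)
    then show ?thesis using v3.independent_span_bound[of B b] b by auto
  qed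
  \<comment> \<open>The lifts \<open>l x\<close> of a basis of the image of g are carried by f to a
    basis of A: independent because ker f lies in ker g, spanning because the dimensions
    agree.\<close>
  obtain l where l: "\<And>x. x \<in> b \<Longrightarrow> l x \<in> V \<and> g (l x) = x"
    using b(1) by (metis image_iff subsetD)
  have lin: "(\<Sum>x\<in>b. s1 (c x) (l x)) \<in> V \<and> f (\<Sum>x\<in>b. s1 (c x) (l x)) = (\<Sum>x\<in>b. s2 (c x) (f (l x)))
    \<and> g (\<Sum>x\<in>b. s1 (c x) (l x)) = (\<Sum>x\<in>b. s3 (c x) x)" for c
  proof -
    have "(\<Sum>x\<in>b'. s1 (c x) (l x)) \<in> V \<and> f (\<Sum>x\<in>b'. s1 (c x) (l x)) = (\<Sum>x\<in>b'. s2 (c x) (f (l x)))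
       \<and> g (\<Sum>x\<in>b'. s1 (c x) (l x)) = (\<Sum>x\<in>b'. s3 (c x) x)" if "finite b'" "b' \<subseteq> b" for b'
      using that
    proof (induction b')
      case empty
      have "f 0 = 0" "g 0 = 0"
        using f(1)[of 0 0] g(1)[of 0 0] V v1.subspace_0 by auto
      then show ?case using V v1.subspace_0 by auto
    next
      case (insert x b')
      then have "s1 (c x) (l x) \<in> V" using V l by (auto intro: v1.subspace_scale)
      then show ?case using insert V l f g by (auto intro: v1.subspace_add)
    qed
    then show ?thesis using finb by blast
  qed
  have c0: "\<forall>x\<in>b. c x = 0" if "(\<Sum>x\<in>b. s3 (c x) x) = 0" for c
    using v3.independentD[OF b(2) finb order_refl that] by blast
  have fl0: "\<forall>x\<in>b. c x = 0" if "(\<Sum>x\<in>b. s2 (c x) (f (l x))) = 0" for c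
    using lin[of c] ker[of "\<Sum>x\<in>b. s1 (c x) (l x)"] that c0[of c] by simp
  have inj: "inj_on (\<lambda>x. f (l x)) b"
  proof (rule inj_onI, rule ccontr)
    fix x y assume xy: "x \<in> b" "y \<in> b" "f (l x) = f (l y)" "x \<noteq> y"
    \<comment> \<open>Two lifts with equal images under f would give a nontrivial relation with
      coefficients 1 and -1.\<close>
    let ?c = "\<lambda>z. if z = x then 1 else if z = y then -1 else (0::'k)"
    have "(\<Sum>z\<in>b. s2 (?c z) (f (l z))) = (\<Sum>z\<in>{x,y}. s2 (?c z) (f (l z)))"
      using xy finb by (intro sum.mono_neutral_right) auto
    also have "\<dots> = 0" using xy by simp
    finally have "\<forall>z\<in>b. ?c z = 0" by (rule fl0)
    then show False using xy by auto
  qed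
  let ?fb = "(\<lambda>x. f (l x)) ` b"
  have indep: "v2.independent ?fb"
  proof -
    have "\<forall>v\<in>?fb. u v = 0" if "(\<Sum>v\<in>?fb. s2 (u v) v) = 0" for u
      using fl0[of "\<lambda>x. u (f (l x))"] that by (simp add: sum.reindex[OF inj])
    then show ?thesis using v2.independent_if_scalars_zero[of ?fb] finb by blast
  qed
  have sub: "?fb \<subseteq> A" using l fA by auto
  have "A \<subseteq> v2.span ?fb"
  proof -
    obtain B where B: "finite B" "A \<subseteq> v2.span B" using fin by (auto simp: finite_dimensional_def)
    obtain C where C: "?fb \<subseteq> C" "C \<subseteq> A" "v2.independent C" "A \<subseteq> v2.span C"
      by (rule v2.maximal_independent_subset_extend[OF sub indep])
    have finC: "finite C" using v2.independent_span_bound[OF B(1) C(3)] B(2) C(2) by auto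
    have "card C = v2.dim A" using v2.dim_unique[OF C(2,4,3) refl] by simp
    also have "\<dots> = card ?fb" using dim' b(4) card_image[OF inj] by simp
    finally have "C = ?fb" using C(1) finC card_subset_eq by metis
    then show ?thesis using C by blast
  qed
  then have rep: "\<exists>c. a = (\<Sum>x\<in>b. s2 (c x) (f (l x)))" if "a \<in> A" for a
  proof -
    from that have "a \<in> v2.span ?fb" using \<open>A \<subseteq> v2.span ?fb\<close> by blast
    then obtain u where "a = (\<Sum>v\<in>?fb. s2 (u v) v)" using v2.span_finite[of ?fb] finb by auto
    then show ?thesis by (auto simp: sum.reindex[OF inj] intro!: exI[of _ "\<lambda>x. u (f (l x))"])
  qed
  show "f ` V = A"
  proof
    show "A \<subseteq> f ` V"
    proof
      fix a assume "a \<in> A"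
      then obtain c where "a = (\<Sum>x\<in>b. s2 (c x) (f (l x)))" using rep by blast
      then show "a \<in> f ` V" using lin[of c] by (metis imageI)
    qed
  qed (fact fA)
  show "f x = 0" if x: "x \<in> V" "g x = 0" for x
  proof -
    obtain c where c: "f x = (\<Sum>x\<in>b. s2 (c x) (f (l x)))" using rep x fA by blast
    \<comment> \<open>\<open>?y\<close> is a combination of lifts with the same value under f as x,
      hence also under g; as \<open>g x = 0\<close>, independence of the basis b kills all its
      coefficients.\<close>
    let ?y = "\<Sum>x\<in>b. s1 (c x) (l x)"
    have y: "?y \<in> V" "f ?y = f x" "g ?y = (\<Sum>x\<in>b. s3 (c x) x)" using lin[of c] c by auto
    have my: "s1 (-1) ?y \<in> V" using V y by (blast intro: v1.subspace_scale)
    have "f (x + s1 (-1) ?y) = 0"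
      using f(1)[OF x(1) my] f(2)[OF y(1), of "-1"] y by simp
    then have "g (x + s1 (-1) ?y) = 0" using ker V x my v1.subspace_add by blast
    then have "g ?y = 0" using g(1)[OF x(1) my] g(2)[OF y(1), of "-1"] x by simp
    then have "\<forall>x\<in>b. c x = 0" using c0 y by simp
    then show ?thesis using c by simp
  qed
qed


section \<open>The free superalgebra modulo an ideal\<close>

abbreviation fbr :: "('x mono \<Rightarrow>\<^sub>0 'k::field) \<Rightarrow> ('x mono \<Rightarrow>\<^sub>0 'k) \<Rightarrow> ('x mono \<Rightarrow>\<^sub>0 'k)" where
  "fbr \<equiv> bilinear_ext (\<lambda>u v. mon (Br u v))"

definition words :: "'x set \<Rightarrow> 'x mono set" where
  "words \<Gamma> = {u. set_mono u \<subseteq> \<Gamma>}"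

lemma Gen_in_words [simp]: "Gen g \<in> words \<Gamma> \<longleftrightarrow> g \<in> \<Gamma>"
  and Br_in_words [simp]: "Br u v \<in> words \<Gamma> \<longleftrightarrow> u \<in> words \<Gamma> \<and> v \<in> words \<Gamma>"
  by (auto simp: words_def)

lemma words_mono: "\<Gamma> \<subseteq> \<Gamma>' \<Longrightarrow> words \<Gamma> \<subseteq> words \<Gamma>'"
  by (auto simp: words_def)

lemma fbr_in_subspace:
  assumes "pm.subspace X" "\<And>u v. u \<in> A \<Longrightarrow> v \<in> B \<Longrightarrow> mon (Br u v) \<in> X" "p \<in> mspan A" "q \<in> mspan B"
  shows "fbr p q \<in> X"
  unfolding bilinear_ext_lext using assms by (intro pm.lext_in_subspace) auto

lemma fbr_mspan: "p \<in> mspan (words \<Gamma>) \<Longrightarrow> q \<in> mspan (words \<Gamma>) \<Longrightarrow> fbr p q \<in> mspan (words \<Gamma>)"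
  by (rule fbr_in_subspace[of _ "words \<Gamma>" "words \<Gamma>"]) auto

lemma pscale_minus_one [simp]: "pscale (- 1) p = - p"
  by (rule poly_mapping_eqI) simp

lemma pscale_one [simp]: "pscale 1 p = p"
  by (rule poly_mapping_eqI) simp

text \<open>Linearity as a predicate, so that multilinear statements can be reduced to monomials in
  one argument at a time.\<close>

definition plin :: "(('x \<Rightarrow>\<^sub>0 'k::field) \<Rightarrow> ('y \<Rightarrow>\<^sub>0 'k)) \<Rightarrow> bool" where
  "plin f \<longleftrightarrow> (\<forall>p q. f (p + q) = f p + f q) \<and> (\<forall>c p. f (pscale c p) = pscale c (f p))"

lemma plin_mspan:
  assumes "plin f" "pm.subspace X" "\<And>u. u \<in> M \<Longrightarrow> f (mon u) \<in> X" "p \<in> mspan M"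
  shows "f p \<in> X"
proof (rule mspan_subset[of "{p. f p \<in> X}", simplified])
  have "f 0 = 0" using assms(1) unfolding plin_def by (metis add_cancel_left_left)
  then show "pm.subspace {p. f p \<in> X}"
    using assms(1,2) by (auto simp: plin_def pm.subspace_def)
qed (use assms in auto)

text \<open>For a subspace W of relations, membership in \<open>A \<oplus> W\<close> means that the
  class modulo W is represented by an element of A.\<close>

definition plus_sets :: "('x \<Rightarrow>\<^sub>0 'k::field) set \<Rightarrow> ('x \<Rightarrow>\<^sub>0 'k) set \<Rightarrow> ('x \<Rightarrow>\<^sub>0 'k) set" (infixl "\<oplus>" 65) where
  "A \<oplus> W = {x + y | x y. x \<in> A \<and> y \<in> W}"

lemma subspace_plus_sets [simp]: "pm.subspace A \<Longrightarrow> pm.subspace W \<Longrightarrow> pm.subspace (A \<oplus> W)"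
  unfolding plus_sets_def by (rule pm.subspace_sums)

lemma plus_setsI: "x \<in> A \<Longrightarrow> y \<in> W \<Longrightarrow> x + y \<in> A \<oplus> W"
  by (auto simp: plus_sets_def)

lemma plus_setsE: "z \<in> A \<oplus> W \<Longrightarrow> (\<And>x y. x \<in> A \<Longrightarrow> y \<in> W \<Longrightarrow> z = x + y \<Longrightarrow> P) \<Longrightarrow> P"
  by (auto simp: plus_sets_def)

lemma plus_sets_left: "pm.subspace W \<Longrightarrow> x \<in> A \<Longrightarrow> x \<in> A \<oplus> W"
  using plus_setsI[of x A 0 W] pm.subspace_0 by fastforce

lemma plus_sets_right: "pm.subspace A \<Longrightarrow> x \<in> W \<Longrightarrow> x \<in> A \<oplus> W"
  using plus_setsI[of 0 A x W] pm.subspace_0 by fastforce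

lemma plus_sets_cong_mod:
  assumes "pm.subspace W" "pm.subspace A" "x \<in> A \<oplus> W" "y - x \<in> W" shows "y \<in> A \<oplus> W"
proof -
  have "y - x \<in> A \<oplus> W" using assms by (intro plus_sets_right)
  with assms have "x + (y - x) \<in> A \<oplus> W" by (intro pm.subspace_add) auto
  then show ?thesis by simp
qed

text \<open>The sign is governed by the explicit parities a and b instead of being read off from x
  and y, so the expression is linear in each of x, y, z.\<close>

definition jac_rel :: "bool \<Rightarrow> bool \<Rightarrow> ('x mono \<Rightarrow>\<^sub>0 'k::field) \<Rightarrow> ('x mono \<Rightarrow>\<^sub>0 'k) \<Rightarrow> ('x mono \<Rightarrow>\<^sub>0 'k)
    \<Rightarrow> ('x mono \<Rightarrow>\<^sub>0 'k)" where
  "jac_rel a b x y z = fbr x (fbr y z) - fbr (fbr x y) z - pscale (koszul a b) (fbr y (fbr x z))"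

definition anti_rel :: "bool \<Rightarrow> bool \<Rightarrow> ('x mono \<Rightarrow>\<^sub>0 'k::field) \<Rightarrow> ('x mono \<Rightarrow>\<^sub>0 'k)
    \<Rightarrow> ('x mono \<Rightarrow>\<^sub>0 'k)" where
  "anti_rel a b x y = fbr x y + pscale (koszul a b) (fbr y x)"

text \<open>The generating set \<Gamma> is a parameter because two cases occur: all generators, and
  the e and f generators only. The cubic identity is left out on purpose, as it is not yet known for
  the common kernel \<open>W\<close> below.\<close>

locale lie_ideal =
  fixes par :: "'i \<Rightarrow> bool" and \<Gamma> :: "('i, 'h) gen set" and W :: "(('i, 'h) gen mono \<Rightarrow>\<^sub>0 'k::field) set"
  assumes subspace_W [simp]: "pm.subspace W"
    and ideal_W: "\<And>x y. x \<in> mspan (words \<Gamma>) \<Longrightarrow> y \<in> W \<Longrightarrow> fbr x y \<in> W \<and> fbr y x \<in> W"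
    and anti_mon: "\<And>u v. u \<in> words \<Gamma> \<Longrightarrow> v \<in> words \<Gamma> \<Longrightarrow>
      anti_rel (mono_par par u) (mono_par par v) (mon u) (mon v) \<in> W"
    and jac_mon: "\<And>u v w. u \<in> words \<Gamma> \<Longrightarrow> v \<in> words \<Gamma> \<Longrightarrow> w \<in> words \<Gamma> \<Longrightarrow>
      jac_rel (mono_par par u) (mono_par par v) (mon u) (mon v) (mon w) \<in> W"
begin

lemma plin_anti: "plin (\<lambda>x. anti_rel a b x y)" "plin (\<lambda>y. anti_rel a b x y)"
  by (simp_all add: plin_def anti_rel_def bilinear_ext_simps algebra_simps)

lemma anti:
  assumes "p \<in> mspan {u \<in> words \<Gamma>. mono_par par u = a}" "q \<in> mspan {u \<in> words \<Gamma>. mono_par par u = b}"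
  shows "anti_rel a b p q \<in> W"
proof -
  have 1: "anti_rel a b p (mon v) \<in> W" if "v \<in> {u \<in> words \<Gamma>. mono_par par u = b}" for v
    by (rule plin_mspan[OF plin_anti(1) subspace_W _ assms(1)]) (use that anti_mon in blast)
  show ?thesis
    by (rule plin_mspan[OF plin_anti(2) subspace_W _ assms(2)]) (use 1 in blast)
qed

lemma plin_jac:
  "plin (\<lambda>x. jac_rel a b x y z)" "plin (\<lambda>y. jac_rel a b x y z)" "plin (\<lambda>z. jac_rel a b x y z)"
  by (simp_all add: plin_def jac_rel_def bilinear_ext_simps algebra_simps)

lemma jac:
  assumes "p \<in> mspan {u \<in> words \<Gamma>. mono_par par u = a}" "q \<in> mspan {u \<in> words \<Gamma>. mono_par par u = b}"
    "r \<in> mspan (words \<Gamma>)"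
  shows "jac_rel a b p q r \<in> W"
proof -
  have 1: "jac_rel a b p (mon v) (mon w) \<in> W"
    if "v \<in> {u \<in> words \<Gamma>. mono_par par u = b}" "w \<in> words \<Gamma>" for v w
    by (rule plin_mspan[OF plin_jac(1) subspace_W _ assms(1)]) (use that jac_mon in blast)
  have 2: "jac_rel a b p q (mon w) \<in> W" if "w \<in> words \<Gamma>" for w
    by (rule plin_mspan[OF plin_jac(2) subspace_W _ assms(2)]) (use that 1 in blast)
  show ?thesis
    by (rule plin_mspan[OF plin_jac(3) subspace_W _ assms(3)]) (use 2 in blast)
qed

text \<open>Terms with a factor in W stay in W because it is an ideal, so a bracket computation
  modulo W reduces to monomial representatives.\<close>

lemma fbr_plus_sets:
  assumes "pm.subspace X" "p \<in> mspan A \<oplus> W" "q \<in> mspan B \<oplus> W"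
    and "\<And>u v. u \<in> A \<Longrightarrow> v \<in> B \<Longrightarrow> mon (Br u v) \<in> X \<oplus> W"
    and "A \<subseteq> words \<Gamma>" "B \<subseteq> words \<Gamma>" "W \<subseteq> mspan (words \<Gamma>)"
  shows "fbr p q \<in> X \<oplus> W"
proof -
  obtain p1 p2 where p: "p1 \<in> mspan A" "p2 \<in> W" "p = p1 + p2" using assms(2) by (rule plus_setsE)
  obtain q1 q2 where q: "q1 \<in> mspan B" "q2 \<in> W" "q = q1 + q2" using assms(3) by (rule plus_setsE)
  have "fbr p1 q1 \<in> X \<oplus> W"
    by (rule fbr_in_subspace[OF _ assms(4) p(1) q(1)]) (use assms in auto)
  moreover have "fbr p1 q2 \<in> W" "fbr p2 q1 \<in> W" "fbr p2 q2 \<in> W"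
    using p q assms(5-7) ideal_W mspan_mono by blast+
  then have "fbr p1 q2 + fbr p2 q1 + fbr p2 q2 \<in> X \<oplus> W"
    using assms(1) by (intro plus_sets_right) (auto intro!: pm.subspace_add)
  ultimately have "fbr p1 q1 + (fbr p1 q2 + fbr p2 q1 + fbr p2 q2) \<in> X \<oplus> W"
    by (rule pm.subspace_add[OF subspace_plus_sets[OF assms(1) subspace_W]])
  then show ?thesis by (simp add: p q bilinear_ext_simps algebra_simps)
qed

text \<open>Jacobi in the form "ad u is a superderivation": it moves u into the inner
  bracket.\<close>

lemma derivation_step:
  assumes X: "pm.subspace X" and uvw: "u \<in> words \<Gamma>" "v \<in> words \<Gamma>" "w \<in> words \<Gamma>"
    and "fbr (mon (Br u v)) (mon w) \<in> X \<oplus> W" "fbr (mon v) (mon (Br u w)) \<in> X \<oplus> W"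
  shows "mon (Br u (Br v w)) \<in> X \<oplus> W"
proof -
  let ?k = "koszul (mono_par par u) (mono_par par v)"
  have *: "fbr (mon (Br u v)) (mon w) + pscale ?k (fbr (mon v) (mon (Br u w))) \<in> X \<oplus> W"
    using assms by (auto intro!: pm.subspace_add pm.subspace_scale)
  have "mon (Br u (Br v w)) - (fbr (mon (Br u v)) (mon w) + pscale ?k (fbr (mon v) (mon (Br u w)))) \<in> W"
    using jac_mon[OF uvw] by (simp add: jac_rel_def bilinear_ext_simps algebra_simps)
  then show ?thesis using plus_sets_cong_mod[OF _ X *] by auto
qed

lemma swap_step:
  assumes X: "pm.subspace X" and uv: "u \<in> words \<Gamma>" "v \<in> words \<Gamma>"
    and "mon (Br u v) \<in> X \<oplus> W"
  shows "mon (Br v u) \<in> X \<oplus> W"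
proof -
  let ?k = "koszul (mono_par par v) (mono_par par u)"
  have *: "pscale (- ?k) (mon (Br u v)) \<in> X \<oplus> W"
    using assms by (intro pm.subspace_scale) auto
  have "mon (Br v u) - pscale (- ?k) (mon (Br u v)) \<in> W"
    using anti_mon[OF uv(2,1)]
    by (simp add: anti_rel_def bilinear_ext_simps single_uminus)
  then show ?thesis using plus_sets_cong_mod[OF _ X *] by auto
qed

text \<open>Jacobi solved for the left-nested term, which lets a compound left factor be split into
  its two halves.\<close>

lemma bracket_assoc_step:
  assumes X: "pm.subspace X" and uvw: "u \<in> words \<Gamma>" "v \<in> words \<Gamma>" "w \<in> words \<Gamma>"
    and "fbr (mon u) (mon (Br v w)) \<in> X \<oplus> W" "fbr (mon v) (mon (Br u w)) \<in> X \<oplus> W"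
  shows "mon (Br (Br u v) w) \<in> X \<oplus> W"
proof -
  let ?k = "koszul (mono_par par u) (mono_par par v)"
  have *: "fbr (mon u) (mon (Br v w)) - pscale ?k (fbr (mon v) (mon (Br u w))) \<in> X \<oplus> W"
    using assms by (auto intro!: pm.subspace_diff pm.subspace_scale)
  have "- (mon (Br (Br u v) w) - (fbr (mon u) (mon (Br v w)) - pscale ?k (fbr (mon v) (mon (Br u w))))) \<in> W"
    using jac_mon[OF uvw] by (simp add: jac_rel_def bilinear_ext_simps algebra_simps)
  then have "mon (Br (Br u v) w) - (fbr (mon u) (mon (Br v w)) - pscale ?k (fbr (mon v) (mon (Br u w)))) \<in> W"
    using pm.subspace_neg[OF subspace_W] by (metis minus_minus)
  then show ?thesis using plus_sets_cong_mod[OF _ X *] by auto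
qed

end

section \<open>Triangular decomposition modulo an ideal\<close>

text \<open>The monomials in \<open>Hm\<close> represent the Cartan part of the quotient by \<open>W\<close>.\<close>

locale triangular = lie_ideal par \<Gamma> W
  for par :: "'i \<Rightarrow> bool" and \<Gamma> :: "('i, 'h) gen set" and W :: "(('i, 'h) gen mono \<Rightarrow>\<^sub>0 'k::field) set" +
  fixes S :: "'i set" and Hm :: "('i, 'h) gen mono set"
  assumes W_sub: "W \<subseteq> mspan (words \<Gamma>)"
    and gens: "EG ` S \<subseteq> \<Gamma>" "FG ` S \<subseteq> \<Gamma>" "\<And>g. g \<in> \<Gamma> \<Longrightarrow> g \<in> EG ` S \<union> FG ` S \<or> Gen g \<in> Hm"
    and Hm_sub: "Hm \<subseteq> words \<Gamma>"
    and HH: "\<And>u v. u \<in> Hm \<Longrightarrow> v \<in> Hm \<Longrightarrow> mon (Br u v) \<in> mspan Hm \<oplus> W"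
    and HE: "\<And>u i. u \<in> Hm \<Longrightarrow> i \<in> S \<Longrightarrow> mon (Br u (Gen (EG i))) \<in> mspan (words (EG ` S)) \<oplus> W"
    and HF: "\<And>u i. u \<in> Hm \<Longrightarrow> i \<in> S \<Longrightarrow> mon (Br u (Gen (FG i))) \<in> mspan (words (FG ` S)) \<oplus> W"
    and EF: "\<And>i j. i \<in> S \<Longrightarrow> j \<in> S \<Longrightarrow> mon (Br (Gen (EG i)) (Gen (FG j))) \<in> mspan Hm \<oplus> W"
begin

text \<open>The Cartan part acts by derivations, so stability need only be checked on letters.
  \<Delta> is instantiated with the e letters and with the f letters.\<close>

lemma H_class:
  assumes "\<Delta> \<subseteq> \<Gamma>" "\<And>u g. u \<in> Hm \<Longrightarrow> g \<in> \<Delta> \<Longrightarrow> mon (Br u (Gen g)) \<in> mspan (words \<Delta>) \<oplus> W"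
    and h: "h \<in> Hm" and u: "u \<in> words \<Delta>"
  shows "mon (Br h u) \<in> mspan (words \<Delta>) \<oplus> W"
  using u
proof (induction u)
  case (Gen g)
  then show ?case using assms by auto
next
  case (Br u v)
  have s: "words \<Delta> \<subseteq> words \<Gamma>" using assms(1) by (rule words_mono)
  show ?case
  proof (rule derivation_step)
    show "fbr (mon (Br h u)) (mon v) \<in> mspan (words \<Delta>) \<oplus> W"
      by (rule fbr_plus_sets[of _ _ "words \<Delta>" _ "words \<Delta>"])
        (use Br s W_sub in \<open>auto intro!: plus_sets_left\<close>)
    show "fbr (mon u) (mon (Br h v)) \<in> mspan (words \<Delta>) \<oplus> W"
      by (rule fbr_plus_sets[of _ _ "words \<Delta>" _ "words \<Delta>"])
        (use Br s W_sub in \<open>auto intro!: plus_sets_left\<close>)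
  qed (use Br h Hm_sub s in auto)
qed

abbreviation "E \<equiv> words (EG ` S)"
abbreviation "F \<equiv> words (FG ` S)"
abbreviation "R \<equiv> E \<union> Hm \<union> F"

lemma subs: "E \<subseteq> words \<Gamma>" "F \<subseteq> words \<Gamma>" "R \<subseteq> words \<Gamma>"
  using words_mono[OF gens(1)] words_mono[OF gens(2)] Hm_sub by auto

lemma HE': "h \<in> Hm \<Longrightarrow> u \<in> E \<Longrightarrow> mon (Br h u) \<in> mspan E \<oplus> W"
  using H_class[OF gens(1)] HE by auto

lemma HF': "h \<in> Hm \<Longrightarrow> u \<in> F \<Longrightarrow> mon (Br h u) \<in> mspan F \<oplus> W"
  using H_class[OF gens(2)] HF by auto

lemma mspan_W_mono: "A \<subseteq> B \<Longrightarrow> x \<in> mspan A \<oplus> W \<Longrightarrow> x \<in> mspan B \<oplus> W"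
  using mspan_mono by (auto elim!: plus_setsE intro!: plus_setsI)

text \<open>Moving e_i through an f word either meets an f_j, leaving a Cartan element, or leaves a
  Cartan element bracketed with an f word, which \<open>HF'\<close> returns to f words.\<close>

lemma eF: 
  assumes "i \<in> S" "u \<in> F"
  shows "mon (Br (Gen (EG i)) u) \<in> mspan (Hm \<union> F) \<oplus> W"
  using assms(2)
proof (induction u)
  case (Gen g)
  then have "mon (Br (Gen (EG i)) (Gen g)) \<in> mspan Hm \<oplus> W" using EF assms(1) by auto
  then show ?case by (rule mspan_W_mono[rotated]) auto
next
  case (Br u v)
  have s: "Hm \<union> F \<subseteq> words \<Gamma>" using subs Hm_sub by auto
  show ?case
  proof (rule derivation_step)
    show "fbr (mon (Br (Gen (EG i)) u)) (mon v) \<in> mspan (Hm \<union> F) \<oplus> W"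
    proof (rule fbr_plus_sets[of _ _ "Hm \<union> F" _ F])
      show "mon (Br a b) \<in> mspan (Hm \<union> F) \<oplus> W" if "a \<in> Hm \<union> F" "b \<in> F" for a b
        using that HF'[of a b] mspan_W_mono[of F "Hm \<union> F"] by (auto intro: plus_sets_left)
    qed (use Br s W_sub subs in \<open>auto intro!: plus_sets_left\<close>)
    show "fbr (mon u) (mon (Br (Gen (EG i)) v)) \<in> mspan (Hm \<union> F) \<oplus> W"
    proof (rule fbr_plus_sets[of _ _ F _ "Hm \<union> F"])
      show "mon (Br a b) \<in> mspan (Hm \<union> F) \<oplus> W" if "a \<in> F" "b \<in> Hm \<union> F" for a b
        using that HF'[of b a] mspan_W_mono[of F "Hm \<union> F"] swap_step[of "mspan (Hm \<union> F)" b a] subs s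
        by (auto intro: plus_sets_left)
    qed (use Br s W_sub subs in \<open>auto intro!: plus_sets_left\<close>)
  qed (use Br assms subs gens in auto)
qed

text \<open>Induction on the e word: [[u1,u2],v] is rewritten by [u1,[u2,v]] and [u2,[u1,v]]. The
  inner bracket may leave the f words, so each half must be controlled against all of R; this is the
  content of the two auxiliary facts.\<close>

lemma EF':
  assumes "u \<in> E" "v \<in> F"
  shows "mon (Br u v) \<in> mspan R \<oplus> W"
  using assms
proof (induction u arbitrary: v)
  case (Gen g)
  then obtain i where "i \<in> S" "g = EG i" by auto
  then show ?case using eF[of i v] Gen mspan_W_mono[of "Hm \<union> F" R] by auto
next
  case (Br u1 u2)
  have *: "mon (Br u b) \<in> mspan R \<oplus> W"
    if "u \<in> E" "\<And>v. v \<in> F \<Longrightarrow> mon (Br u v) \<in> mspan R \<oplus> W" "b \<in> R" for u b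
  proof -
    have "mon (Br u b) \<in> mspan R \<oplus> W" if "b \<in> Hm"
      using HE'[of b u] that \<open>u \<in> E\<close> mspan_W_mono[of E R] subs by (intro swap_step[of _ b u]) auto
    then show ?thesis using that by (auto intro: plus_sets_left)
  qed
  have **: "fbr (mon u) q \<in> mspan R \<oplus> W"
    if u: "u \<in> E" "\<And>v. v \<in> F \<Longrightarrow> mon (Br u v) \<in> mspan R \<oplus> W" and q: "q \<in> mspan R \<oplus> W" for u q
  proof (rule fbr_plus_sets[of _ _ "{u}" _ R])
    show "mon (Br a b) \<in> mspan R \<oplus> W" if "a \<in> {u}" "b \<in> R" for a b
      using *[OF u] that by blast
    show "{u} \<subseteq> words \<Gamma>" using u subs by blast
  qed (use q W_sub subs in \<open>simp_all add: plus_sets_left\<close>)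
  have 12: "u1 \<in> E" "u2 \<in> E" using Br.prems by auto
  show ?case
  proof (rule bracket_assoc_step)
    show "fbr (mon u1) (mon (Br u2 v)) \<in> mspan R \<oplus> W"
      by (rule **[OF 12(1) Br.IH(1)[OF 12(1)] Br.IH(2)[OF 12(2) Br.prems(2)]])
    show "fbr (mon u2) (mon (Br u1 v)) \<in> mspan R \<oplus> W"
      by (rule **[OF 12(2) Br.IH(2)[OF 12(2)] Br.IH(1)[OF 12(1) Br.prems(2)]])
  qed (use Br.prems 12 subs in auto)
qed

lemma RR:
  assumes "u \<in> R" "v \<in> R"
  shows "mon (Br u v) \<in> mspan R \<oplus> W"
proof -
  have 1: "mon (Br a b) \<in> mspan R \<oplus> W" if "a \<in> E \<and> b \<in> F \<or> a \<in> Hm \<and> b \<in> E \<or> a \<in> Hm \<and> b \<in> F" for a b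
    using that EF' HE'[of a b] HF'[of a b] mspan_W_mono[of E R] mspan_W_mono[of F R] by blast
  have 2: "mon (Br b a) \<in> mspan R \<oplus> W" if "a \<in> E \<and> b \<in> F \<or> a \<in> Hm \<and> b \<in> E \<or> a \<in> Hm \<and> b \<in> F" for a b
    using 1[OF that] that subs by (intro swap_step[of _ a b]) auto
  have 3: "mon (Br u v) \<in> mspan R \<oplus> W" if "u \<in> Hm" "v \<in> Hm"
    using HH[OF that] mspan_W_mono[of Hm R] by auto
  have 4: "mon (Br u v) \<in> mspan R \<oplus> W" if "u \<in> E \<and> v \<in> E \<or> u \<in> F \<and> v \<in> F"
    using that by (intro plus_sets_left) auto
  show ?thesis using assms 1 2 3 4 by blast
qed

text \<open>The span of R modulo W contains every letter and is closed under brackets by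
  \<open>RR\<close>.\<close>

lemma spanning:
  assumes "p \<in> mspan (words \<Gamma>)"
  shows "p \<in> mspan R \<oplus> W"
proof -
  have "mon u \<in> mspan R \<oplus> W" if "u \<in> words \<Gamma>" for u
    using that
  proof (induction u)
    case (Gen g)
    then show ?case using gens(3)[of g] by (auto intro!: plus_sets_left)
  next
    case (Br u v)
    then have uv: "mon u \<in> mspan R \<oplus> W" "mon v \<in> mspan R \<oplus> W" by simp_all
    have "fbr (mon u) (mon v) \<in> mspan R \<oplus> W"
      by (rule fbr_plus_sets[OF subspace_mspan uv RR subs(3) subs(3) W_sub])
    then show ?case by (simp add: bilinear_ext_simps)
  qed
  with assms show ?thesis by (intro mspan_subset[OF _ _ assms]) auto
qed

lemma E_weight:
  "u \<in> E \<Longrightarrow> (\<forall>i. lookup (mono_weight u) i \<ge> 0) \<and> (\<exists>i. lookup (mono_weight u) i > 0)"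
proof (induction u)
  case (Gen g)
  then obtain i where "g = EG i" by auto
  then show ?case by (auto simp: lookup_single when_def)
next
  case (Br u v)
  then obtain i where i: "lookup (mono_weight u) i > 0" by auto
  have "lookup (mono_weight v) i \<ge> 0" using Br by auto
  with i have "lookup (mono_weight (Br u v)) i > 0" by (simp add: lookup_add)
  then show ?case using Br by (auto simp: lookup_add)
qed

lemma F_weight:
  "u \<in> F \<Longrightarrow> (\<forall>i. lookup (mono_weight u) i \<le> 0) \<and> (\<exists>i. lookup (mono_weight u) i < 0)"
proof (induction u)
  case (Gen g)
  then obtain i where "g = FG i" by auto
  then show ?case by (auto simp: lookup_single when_def)
next
  case (Br u v)
  then obtain i where i: "lookup (mono_weight u) i < 0" by auto
  have "lookup (mono_weight v) i \<le> 0" using Br by auto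
  with i have "lookup (mono_weight (Br u v)) i < 0" by (simp add: lookup_add)
  then show ?case using Br by (auto simp: lookup_add intro: add_nonpos_nonpos)
qed

lemma EF_weight_nonzero: "u \<in> E \<union> F \<Longrightarrow> mono_weight u \<noteq> 0"
  using E_weight[of u] F_weight[of u] by force

text \<open>Nonempty products of e's, or of f's, never have weight zero, so projecting a
  representation p = r + w to weight zero leaves only \<open>Hm\<close> in r; stability of W under
  this projection keeps the remainder in W.\<close>

lemma weight_zero:
  assumes p: "p \<in> mspan (words \<Gamma>)" and "p \<in> mspan {u. mono_weight u = 0}"
    and W0: "\<And>w. w \<in> W \<Longrightarrow> pres (\<lambda>u. mono_weight u = 0) w \<in> W"
  shows "p \<in> mspan Hm \<oplus> W"
proof -
  let ?P = "pres (\<lambda>u :: ('i, 'h) gen mono. mono_weight u = 0)"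
  obtain r w where rw: "r \<in> mspan R" "w \<in> W" "p = r + w"
    using spanning[OF p] by (rule plus_setsE)
  have "?P r \<in> mspan {u \<in> R. mono_weight u = 0}" using rw by (intro pres_mspan)
  then have "?P r \<in> mspan Hm" by (rule mspan_mono[rotated]) (use EF_weight_nonzero in auto)
  moreover have "?P p = p" using assms(2) by (rule pres_id)
  ultimately have "p = ?P r + ?P w" "?P r \<in> mspan Hm" using rw by auto
  then show ?thesis using W0[OF rw(2)] plus_setsI by metis
qed

end


section \<open>The ideals defining the contragredient superalgebra\<close>

lemma part_free: "part (free_superalg S par) a = mspan {u \<in> words (generators S). mono_par par u = a}"
  by (auto simp: part_def free_superalg_def mspan_def words_def)

lemma free_superalg_simps [simp]:
  "smul (free_superalg S par) = pscale"
  "brk (free_superalg S par) = fbr"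
  by (simp_all add: free_superalg_def)

lemma pres_parity_sum:
  "p = pres (\<lambda>u. \<not> mono_par par u) p + pres (\<lambda>u. mono_par par u) p"
  by (rule poly_mapping_eqI) (simp add: lookup_add lookup_pres)

lemma carrier_parts: "carrier L = {x + y | x y. x \<in> part L False \<and> y \<in> part L True}"
  by (simp add: carrier_def part_def)

lemma carrier_free:
  fixes S :: "'i set"
  shows "carrier (free_superalg S par :: ('k::field, ('i, 'h) gen mono \<Rightarrow>\<^sub>0 'k) superalg) = mspan (words (generators S))"
proof
  show "carrier (free_superalg S par :: ('k, ('i, 'h) gen mono \<Rightarrow>\<^sub>0 'k) superalg) \<subseteq> mspan (words (generators S))"
    unfolding carrier_parts part_free
    by (auto intro!: mspan_add elim: mspan_mono[rotated])
  show "mspan (words (generators S)) \<subseteq> carrier (free_superalg S par :: ('k, ('i, 'h) gen mono \<Rightarrow>\<^sub>0 'k) superalg)"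
  proof
    fix p :: "('i, 'h) gen mono \<Rightarrow>\<^sub>0 'k" assume p: "p \<in> mspan (words (generators S))"
    have "pres (\<lambda>u. \<not> mono_par par u) p \<in> mspan {u \<in> words (generators S). mono_par par u = False}"
      "pres (\<lambda>u. mono_par par u) p \<in> mspan {u \<in> words (generators S). mono_par par u = True}"
      using pres_mspan[OF p] by auto
    then show "p \<in> carrier (free_superalg S par)"
      unfolding carrier_parts part_free using pres_parity_sum by blast
  qed
qed

lemma ideal_free_iff:
  "ideal (free_superalg S par) J \<longleftrightarrow> pm.subspace J \<and> J \<subseteq> mspan (words (generators S)) \<and>
     (\<forall>x\<in>mspan (words (generators S)). \<forall>y\<in>J. fbr x y \<in> J \<and> fbr y x \<in> J)"
  by (simp add: ideal_def carrier_free)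

abbreviation wpres :: "('i \<Rightarrow>\<^sub>0 int) \<Rightarrow> (('i, 'h) gen mono \<Rightarrow>\<^sub>0 'k::field) \<Rightarrow> (('i, 'h) gen mono \<Rightarrow>\<^sub>0 'k)" where
  "wpres \<gamma> \<equiv> pres (\<lambda>u. mono_weight u = \<gamma>)"

lemma plin_pres: "plin (pres P)"
  by (simp add: plin_def)

lemma in_mspan_UNIV [simp]: "p \<in> mspan UNIV"
  by (simp add: mspan_def)

lemma plin_eq:
  assumes "plin f" "plin g" "\<And>u. u \<in> M \<Longrightarrow> f (mon u) = g (mon u)" "p \<in> mspan M"
  shows "f p = g p"
proof -
  have "plin (\<lambda>p. f p - g p)" using assms(1,2) by (auto simp: plin_def algebra_simps)
  then have "f p - g p \<in> {0}" by (rule plin_mspan) (use assms in auto)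
  then show ?thesis by simp
qed

text \<open>Bracketing with an element of degree \<gamma> shifts degrees by \<gamma>. The degree
  function is left general because both the weight by Q and its reduction modulo the \<alpha>'s of I
  are needed.\<close>

lemma pres_fbr:
  fixes wt :: "'x mono \<Rightarrow> 'w::ab_group_add"
  assumes wt: "\<And>u v. wt (Br u v) = wt u + wt v" and x: "x \<in> mspan {u. wt u = \<gamma>}"
  shows "pres (\<lambda>u. wt u = \<delta>) (fbr x y) = fbr x (pres (\<lambda>u. wt u = \<delta> - \<gamma>) y)"
    "pres (\<lambda>u. wt u = \<delta>) (fbr y x) = fbr (pres (\<lambda>u. wt u = \<delta> - \<gamma>) y) x"
proof -
  have [simp]: "\<delta> = a + b \<longleftrightarrow> b = \<delta> - a" for a b by (auto simp: algebra_simps)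
  have 1: "pres (\<lambda>u. wt u = \<delta>) (fbr (mon u) y) = fbr (mon u) (pres (\<lambda>u. wt u = \<delta> - \<gamma>) y) \<and>
      pres (\<lambda>u. wt u = \<delta>) (fbr y (mon u)) = fbr (pres (\<lambda>u. wt u = \<delta> - \<gamma>) y) (mon u)"
    if "wt u = \<gamma>" for u
  proof
    show "pres (\<lambda>u. wt u = \<delta>) (fbr (mon u) y) = fbr (mon u) (pres (\<lambda>u. wt u = \<delta> - \<gamma>) y)"
      by (rule plin_eq[where M = UNIV])
        (use that in \<open>auto simp: plin_def bilinear_ext_simps pres_single wt algebra_simps\<close>)
    show "pres (\<lambda>u. wt u = \<delta>) (fbr y (mon u)) = fbr (pres (\<lambda>u. wt u = \<delta> - \<gamma>) y) (mon u)"
      by (rule plin_eq[where M = UNIV])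
        (use that in \<open>auto simp: plin_def bilinear_ext_simps pres_single wt algebra_simps\<close>)
  qed
  show "pres (\<lambda>u. wt u = \<delta>) (fbr x y) = fbr x (pres (\<lambda>u. wt u = \<delta> - \<gamma>) y)"
    by (rule plin_eq[OF _ _ _ x]) (use 1 in \<open>auto simp: plin_def bilinear_ext_simps\<close>)
  show "pres (\<lambda>u. wt u = \<delta>) (fbr y x) = fbr (pres (\<lambda>u. wt u = \<delta> - \<gamma>) y) x"
    by (rule plin_eq[OF _ _ _ x]) (use 1 in \<open>auto simp: plin_def bilinear_ext_simps\<close>)
qed

locale chevalley_data =
  fixes S :: "'i set" and par :: "'i \<Rightarrow> bool" and sH :: "'k::field \<Rightarrow> 'h::ab_group_add \<Rightarrow> 'h"
    and h :: "'i \<Rightarrow> 'h" and \<alpha> :: "'i \<Rightarrow> 'h \<Rightarrow> 'k"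
begin

abbreviation L :: "('k, ('i, 'h) gen mono \<Rightarrow>\<^sub>0 'k) superalg" where "L \<equiv> free_superalg S par"
abbreviation M :: "('i, 'h) gen mono set" where "M \<equiv> words (generators S)"
abbreviation T :: "(('i, 'h) gen mono \<Rightarrow>\<^sub>0 'k) set" where "T \<equiv> tilde_ideal S par sH h \<alpha>"
abbreviation C :: "(('i, 'h) gen mono \<Rightarrow>\<^sub>0 'k) set" where "C \<equiv> contragredient_ideal S par sH h \<alpha>"
abbreviation Rel :: "(('i, 'h) gen mono \<Rightarrow>\<^sub>0 'k) set" where
  "Rel \<equiv> lie_relators L \<union> chevalley_relators S par sH h \<alpha>"
abbreviation Pt :: "bool \<Rightarrow> (('i, 'h) gen mono \<Rightarrow>\<^sub>0 'k) set" where
  "Pt a \<equiv> mspan {u \<in> M. mono_par par u = a}"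

lemma gens_M [simp]: "HG x \<in> generators S" "EG i \<in> generators S \<longleftrightarrow> i \<in> S" "FG i \<in> generators S \<longleftrightarrow> i \<in> S"
  by (auto simp: generators_def)

lemma Pt_M: "p \<in> Pt a \<Longrightarrow> p \<in> mspan M"
  by (erule mspan_mono[rotated]) auto

lemma lie_relators_L:
  "lie_relators L = {anti_rel a b x y | a b x y. x \<in> Pt a \<and> y \<in> Pt b} \<union>
     {jac_rel a b x y z | a b c x y z. x \<in> Pt a \<and> y \<in> Pt b \<and> z \<in> Pt c} \<union>
     {fbr x (fbr x x) | x. x \<in> Pt True}"
  unfolding lie_relators_def part_free free_superalg_simps anti_rel_def jac_rel_def
  by (simp add: part_free[of S par True, unfolded part_def, simplified])

lemma chevalley_relators_L:
  "chevalley_relators S par sH h \<alpha> =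
     {mon (Gen (HG (x + y))) - mon (Gen (HG x)) - mon (Gen (HG y)) | x y. True} \<union>
       {mon (Gen (HG (sH c x))) - pscale c (mon (Gen (HG x))) | c x. True} \<union>
       {mon (Br (Gen (HG x)) (Gen (HG y))) | x y. True} \<union>
       {mon (Br (Gen (HG x)) (Gen (EG j))) - pscale (\<alpha> j x) (mon (Gen (EG j))) | x j. j \<in> S} \<union>
       {mon (Br (Gen (HG x)) (Gen (FG j))) + pscale (\<alpha> j x) (mon (Gen (FG j))) | x j. j \<in> S} \<union>
       {mon (Br (Gen (EG i)) (Gen (FG j))) - (if i = j then mon (Gen (HG (h i))) else 0)
          | i j. i \<in> S \<and> j \<in> S}"
  by (simp add: chevalley_relators_def Let_def gvar_def bilinear_ext_simps)

lemma Rel_M: "Rel \<subseteq> mspan M"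
proof -
  have "lie_relators L \<subseteq> mspan M"
    unfolding lie_relators_L anti_rel_def jac_rel_def
    by (auto intro!: mspan_add mspan_diff
        mspan_scale fbr_mspan dest: Pt_M Pt_M[of _ True, simplified])
  moreover have "chevalley_relators S par sH h \<alpha> \<subseteq> mspan M"
    unfolding chevalley_relators_L
    by (auto intro!: mspan_add mspan_diff)
  ultimately show ?thesis by simp
qed

lemma ideal_T: "ideal L T"
proof -
  have M: "ideal L (mspan M)" by (auto simp: ideal_free_iff fbr_mspan)
  have *: "T = \<Inter>{J. ideal L J \<and> Rel \<subseteq> J}" by (auto simp: tilde_ideal_def hull_def)
  have sub: "pm.subspace T" unfolding * by (rule pm.subspace_Inter) (auto simp: ideal_free_iff)
  have "T \<subseteq> mspan M" unfolding * using M Rel_M by auto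
  moreover have "fbr x y \<in> T \<and> fbr y x \<in> T" if "x \<in> mspan M" "y \<in> T" for x y
    using that unfolding * by (auto simp: ideal_free_iff)
  ultimately show ?thesis using sub unfolding ideal_free_iff by blast
qed

lemma Rel_T: "Rel \<subseteq> T"
  unfolding tilde_ideal_def by (rule hull_subset)

lemma T_minimal: "ideal L J \<Longrightarrow> Rel \<subseteq> J \<Longrightarrow> T \<subseteq> J"
  unfolding tilde_ideal_def by (rule hull_minimal)

lemma subspace_T [simp]: "pm.subspace T" and T_M: "T \<subseteq> mspan M"
  and T_closed: "x \<in> mspan M \<Longrightarrow> y \<in> T \<Longrightarrow> fbr x y \<in> T" "x \<in> mspan M \<Longrightarrow> y \<in> T \<Longrightarrow> fbr y x \<in> T"
  using ideal_T by (auto simp: ideal_free_iff)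

lemma mon_Pt: "u \<in> M \<Longrightarrow> mon u \<in> Pt (mono_par par u)"
  by simp

lemma relator_intros:
  "x \<in> Pt a \<Longrightarrow> y \<in> Pt b \<Longrightarrow> anti_rel a b x y \<in> lie_relators L"
  "x \<in> Pt a \<Longrightarrow> y \<in> Pt b \<Longrightarrow> z \<in> Pt c \<Longrightarrow> jac_rel a b x y z \<in> lie_relators L"
  "x \<in> Pt True \<Longrightarrow> fbr x (fbr x x) \<in> lie_relators L"
proof -
  show "x \<in> Pt a \<Longrightarrow> y \<in> Pt b \<Longrightarrow> anti_rel a b x y \<in> lie_relators L"
    unfolding lie_relators_L by (rule UnI1, rule UnI1) blast
  show "x \<in> Pt a \<Longrightarrow> y \<in> Pt b \<Longrightarrow> z \<in> Pt c \<Longrightarrow> jac_rel a b x y z \<in> lie_relators L"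
    unfolding lie_relators_L by (rule UnI1, rule UnI2) blast
  show "x \<in> Pt True \<Longrightarrow> fbr x (fbr x x) \<in> lie_relators L"
    unfolding lie_relators_L by (rule UnI2) blast
qed

lemma lie_ideal_if:
  assumes "ideal L J" "T \<subseteq> J"
  shows "lie_ideal par (generators S) J"
proof
  have *: "r \<in> J" if "r \<in> lie_relators L" for r using that Rel_T assms(2) by blast
  show "anti_rel (mono_par par u) (mono_par par v) (mon u) (mon v) \<in> J" if "u \<in> M" "v \<in> M" for u v
    by (rule *[OF relator_intros(1)[OF mon_Pt[OF that(1)] mon_Pt[OF that(2)]]])
  show "jac_rel (mono_par par u) (mono_par par v) (mon u) (mon v) (mon w) \<in> J"
    if "u \<in> M" "v \<in> M" "w \<in> M" for u v w
    by (rule *[OF relator_intros(2)[OF mon_Pt[OF that(1)] mon_Pt[OF that(2)] mon_Pt[OF that(3)]]])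
qed (use assms in \<open>auto simp: ideal_free_iff\<close>)

sublocale T: lie_ideal par "generators S" T
  by (rule lie_ideal_if[OF ideal_T order_refl])

lemma chev:
  "mon (Gen (HG (x + y))) - mon (Gen (HG x)) - mon (Gen (HG y)) \<in> T"
  "mon (Gen (HG (sH c x))) - pscale c (mon (Gen (HG x))) \<in> T"
  "mon (Br (Gen (HG x)) (Gen (HG y))) \<in> T"
  "j \<in> S \<Longrightarrow> mon (Br (Gen (HG x)) (Gen (EG j))) - pscale (\<alpha> j x) (mon (Gen (EG j))) \<in> T"
  "j \<in> S \<Longrightarrow> mon (Br (Gen (HG x)) (Gen (FG j))) + pscale (\<alpha> j x) (mon (Gen (FG j))) \<in> T"
  "i \<in> S \<Longrightarrow> j \<in> S \<Longrightarrow> mon (Br (Gen (EG i)) (Gen (FG j))) - (if i = j then mon (Gen (HG (h i))) else 0) \<in> T"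
proof -
  have *: "r \<in> T" if "r \<in> chevalley_relators S par sH h \<alpha>" for r
    using that Rel_T by blast
  show "mon (Gen (HG (x + y))) - mon (Gen (HG x)) - mon (Gen (HG y)) \<in> T"
    by (intro *, unfold chevalley_relators_L, rule UnI1, rule UnI1, rule UnI1, rule UnI1, rule UnI1) blast
  show "mon (Gen (HG (sH c x))) - pscale c (mon (Gen (HG x))) \<in> T"
    by (intro *, unfold chevalley_relators_L, rule UnI1, rule UnI1, rule UnI1, rule UnI1, rule UnI2) blast
  show "mon (Br (Gen (HG x)) (Gen (HG y))) \<in> T"
    by (intro *, unfold chevalley_relators_L, rule UnI1, rule UnI1, rule UnI1, rule UnI2) blast
  show "mon (Br (Gen (HG x)) (Gen (EG j))) - pscale (\<alpha> j x) (mon (Gen (EG j))) \<in> T" if "j \<in> S"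
    by (intro *, unfold chevalley_relators_L, rule UnI1, rule UnI1, rule UnI2) (use that in blast)
  show "mon (Br (Gen (HG x)) (Gen (FG j))) + pscale (\<alpha> j x) (mon (Gen (FG j))) \<in> T" if "j \<in> S"
    by (intro *, unfold chevalley_relators_L, rule UnI1, rule UnI2) (use that in blast)
  show "mon (Br (Gen (EG i)) (Gen (FG j))) - (if i = j then mon (Gen (HG (h i))) else 0) \<in> T" if "i \<in> S" "j \<in> S"
    by (intro *, unfold chevalley_relators_L, rule UnI2) (use that in blast)
qed

text \<open>The cubes of odd elements are the only relators that are not multilinear; their
  polarizations are consequences of antisymmetry and the Jacobi identity.\<close>

lemma cube_add:
  assumes J: "lie_ideal par (generators S) J" and x: "x \<in> Pt True" and y: "y \<in> Pt True"
    and "fbr x (fbr x x) \<in> J" "fbr y (fbr y y) \<in> J"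
  shows "fbr (x + y) (fbr (x + y) (x + y)) \<in> J"
proof -
  interpret J: lie_ideal par "generators S" J by fact
  have cross: "fbr x (fbr x y) + fbr x (fbr y x) + fbr y (fbr x x) \<in> J"
    if x: "x \<in> Pt True" and y: "y \<in> Pt True" for x y
  proof -
    have xx: "fbr x x \<in> Pt False"
      by (rule fbr_in_subspace[OF _ _ x x]) auto
    have 1: "jac_rel True True x x y \<in> J" using J.jac[OF x x Pt_M[OF y]] .
    have 2: "fbr x (anti_rel True True y x) \<in> J"
      using J.ideal_W J.anti[OF y x] Pt_M[OF x] by blast
    have 3: "anti_rel True False y (fbr x x) \<in> J" using J.anti[OF y xx] .
    \<comment> \<open>The three relators are 2x(xy) - (xx)y, x(yx) - x(xy) and y(xx) + (xx)y; they
      add up to the desired mixed term.\<close>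
    have "jac_rel True True x x y + fbr x (anti_rel True True y x) + anti_rel True False y (fbr x x) \<in> J"
      using 1 2 3 by (auto intro!: pm.subspace_add[OF J.subspace_W])
    then show ?thesis by (simp add: jac_rel_def anti_rel_def koszul_def bilinear_ext_simps algebra_simps)
  qed
  have "fbr x (fbr x x) + fbr y (fbr y y) + (fbr x (fbr x y) + fbr x (fbr y x) + fbr y (fbr x x))
      + (fbr y (fbr y x) + fbr y (fbr x y) + fbr x (fbr y y)) \<in> J"
    by (intro pm.subspace_add[OF J.subspace_W] assms(4,5) cross[OF x y] cross[OF y x])
  then show ?thesis by (simp add: bilinear_ext_simps algebra_simps)
qed

text \<open>The elements of T whose weight components all lie in T form an ideal T'. By minimality
  of T it suffices that T' contains the relators, and these are generated by homogeneous ones: by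
  multilinearity, and for the cubes by polarization.\<close>

lemma T_graded: "w \<in> T \<Longrightarrow> wpres \<gamma> w \<in> T"
proof -
  define T' where "T' = {p \<in> mspan M. \<forall>\<gamma>. wpres \<gamma> p \<in> T}"
  have sub: "pm.subspace T'"
    unfolding T'_def
    by (rule pm.subspaceI)
      (auto intro: pm.subspace_add[OF subspace_T] pm.subspace_scale[OF subspace_T] pm.subspace_0[OF subspace_T]
         mspan_add mspan_scale mspan_0)
  have id: "fbr x y \<in> T' \<and> fbr y x \<in> T'" if x: "x \<in> mspan M" and y: "y \<in> T'" for x y
  proof -
    have *: "fbr (mon u) y \<in> T'" "fbr y (mon u) \<in> T'" if u: "u \<in> M" for u
    proof -
      have u': "mon u \<in> mspan {v. mono_weight v = mono_weight u}" by simp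
      show "fbr (mon u) y \<in> T'"
        using y u unfolding T'_def by (auto simp: pres_fbr[OF _ u'] intro!: fbr_mspan T_closed(1))
      show "fbr y (mon u) \<in> T'"
        using y u unfolding T'_def by (auto simp: pres_fbr[OF _ u'] intro!: fbr_mspan T_closed(2))
    qed
    have "fbr x y \<in> T'"
      by (rule plin_mspan[of "\<lambda>x. fbr x y", OF _ sub *(1) x]) (auto simp: plin_def bilinear_ext_simps)
    moreover have "fbr y x \<in> T'"
      by (rule plin_mspan[of "\<lambda>x. fbr y x", OF _ sub *(2) x]) (auto simp: plin_def bilinear_ext_simps)
    ultimately show ?thesis ..
  qed
  have idl: "ideal L T'" unfolding ideal_free_iff using sub id by (auto simp: T'_def)
  have hom: "p \<in> T'" if "p \<in> T" "p \<in> mspan {u. mono_weight u = \<delta>}" for p \<delta>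
  proof -
    have "wpres \<gamma> p \<in> T" for \<gamma>
    proof (cases "\<gamma> = \<delta>")
      case True then show ?thesis using that by (simp add: pres_id)
    next
      case False
      then have "p \<in> mspan {u. mono_weight u \<noteq> \<gamma>}" by (intro mspan_mono[OF _ that(2)]) auto
      then show ?thesis by (simp add: pres_eq_0 pm.subspace_0)
    qed
    then show ?thesis using that T_M by (auto simp: T'_def)
  qed
  note hI = mspan_add mspan_diff
        mspan_scale mspan_0
  have lie: "lie_ideal par (generators S) T'"
  proof
    show "anti_rel (mono_par par u) (mono_par par v) (mon u) (mon v) \<in> T'" if "u \<in> M" "v \<in> M" for u v
      by (rule hom[OF T.anti_mon[OF that], of "mono_weight u + mono_weight v"])
        (auto simp: anti_rel_def bilinear_ext_simps intro!: hI)
    show "jac_rel (mono_par par u) (mono_par par v) (mon u) (mon v) (mon w) \<in> T'"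
      if "u \<in> M" "v \<in> M" "w \<in> M" for u v w
      by (rule hom[OF T.jac_mon[OF that], of "mono_weight u + mono_weight v + mono_weight w"])
        (auto simp: jac_rel_def bilinear_ext_simps intro!: hI)
  qed (use sub id in auto)
  interpret T': lie_ideal par "generators S" T' by fact
  \<comment> \<open>The cube is not linear in x, so the induction uses that it scales by the third
    power of a coefficient and that \<open>cube_add\<close> handles sums.\<close>
  have cube: "fbr x (fbr x x) \<in> T'" if "x \<in> Pt True" for x
    using that
  proof (induction rule: mspan_induct)
    case zero
    then show ?case using sub by (simp add: bilinear_ext_simps pm.subspace_0)
  next
    case (single c u)
    have "fbr (mon u) (fbr (mon u) (mon u)) \<in> T"
      using relator_intros(3)[of "mon u"] single Rel_T by auto
    then have "fbr (mon u) (fbr (mon u) (mon u)) \<in> T'"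
      by (rule hom[of _ "mono_weight u + (mono_weight u + mono_weight u)"]) (simp add: bilinear_ext_simps)
    then have "pscale (c * c * c) (fbr (mon u) (fbr (mon u) (mon u))) \<in> T'"
      using sub by (rule pm.subspace_scale[rotated])
    then show ?case by (simp add: bilinear_ext_simps mult.assoc)
  next
    case (add p q)
    then show ?case using cube_add[OF lie] by blast
  qed
  have "lie_relators L \<subseteq> T'"
    unfolding lie_relators_L
  proof (intro Un_least subsetI)
    fix r assume "r \<in> {anti_rel a b x y | a b x y. x \<in> Pt a \<and> y \<in> Pt b}"
    then obtain a b x y where "r = anti_rel a b x y" "x \<in> Pt a" "y \<in> Pt b" by blast
    then show "r \<in> T'" using T'.anti by blast
  next
    fix r assume "r \<in> {jac_rel a b x y z | a b c x y z. x \<in> Pt a \<and> y \<in> Pt b \<and> z \<in> Pt c}"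
    then obtain a b c x y z where "r = jac_rel a b x y z" "x \<in> Pt a" "y \<in> Pt b" "z \<in> Pt c" by blast
    then show "r \<in> T'" using T'.jac[OF _ _ Pt_M] by blast
  next
    fix r assume "r \<in> {fbr x (fbr x x) | x. x \<in> Pt True}"
    then show "r \<in> T'" using cube by blast
  qed
  moreover have "chevalley_relators S par sH h \<alpha> \<subseteq> T'"
  proof -
    have a: "mon (Gen (HG (x + y))) - mon (Gen (HG x)) - mon (Gen (HG y)) \<in> T'" for x y
      by (rule hom[where \<delta> = 0, OF chev(1)]) (auto intro!: hI)
    have b: "mon (Gen (HG (sH c x))) - pscale c (mon (Gen (HG x))) \<in> T'" for c x
      by (rule hom[where \<delta> = 0, OF chev(2)]) (auto intro!: hI)
    have c: "mon (Br (Gen (HG x)) (Gen (HG y))) \<in> T'" for x y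
      by (rule hom[where \<delta> = 0, OF chev(3)]) (auto intro!: hI)
    have d: "mon (Br (Gen (HG x)) (Gen (EG j))) - pscale (\<alpha> j x) (mon (Gen (EG j))) \<in> T'" if "j \<in> S" for x j
      by (rule hom[where \<delta> = "frag_of j", OF chev(4)[OF that]]) (auto intro!: hI)
    have e: "mon (Br (Gen (HG x)) (Gen (FG j))) + pscale (\<alpha> j x) (mon (Gen (FG j))) \<in> T'" if "j \<in> S" for x j
      by (rule hom[where \<delta> = "- frag_of j", OF chev(5)[OF that]]) (auto intro!: hI)
    have f: "mon (Br (Gen (EG i)) (Gen (FG j))) - (if i = j then mon (Gen (HG (h i))) else 0) \<in> T'"
      if "i \<in> S" "j \<in> S" for i j
      by (rule hom[where \<delta> = "frag_of i - frag_of j", OF chev(6)[OF that]]) (auto intro!: hI)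
    show ?thesis unfolding chevalley_relators_L
      by (intro Un_least subsetI; elim CollectE exE conjE; hypsubst; (rule a b c d e f); assumption?)
  qed
  ultimately have "T \<subseteq> T'" using idl by (intro T_minimal) auto
  then show "w \<in> T \<Longrightarrow> wpres \<gamma> w \<in> T" by (auto simp: T'_def)
qed

abbreviation HM :: "('i, 'h) gen mono set" where "HM \<equiv> range (\<lambda>x. Gen (HG x))"

lemma in_T_mod: "pm.subspace X \<Longrightarrow> x \<in> X \<Longrightarrow> y - x \<in> T \<Longrightarrow> y \<in> X \<oplus> T"
  using plus_sets_cong_mod[OF subspace_T _ plus_sets_left[OF subspace_T]] by blast

text \<open>The classical triangular decomposition of g~(A), with the Cartan generators themselves
  as Cartan monomials.\<close>

sublocale T: triangular par "generators S" T S HM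
proof
  show "mon (Br u (Gen (EG i))) \<in> mspan (words (EG ` S)) \<oplus> T" if ui: "u \<in> HM" "i \<in> S" for u i
  proof -
    obtain x where "u = Gen (HG x)" using ui by auto
    then show ?thesis using ui chev(4)[of i x]
      by (intro in_T_mod[of _ "pscale (\<alpha> i x) (mon (Gen (EG i)))"]) auto
  qed
  show "mon (Br u (Gen (FG i))) \<in> mspan (words (FG ` S)) \<oplus> T" if ui: "u \<in> HM" "i \<in> S" for u i
  proof -
    obtain x where "u = Gen (HG x)" using ui by auto
    then show ?thesis using ui chev(5)[of i x]
      by (intro in_T_mod[of _ "- pscale (\<alpha> i x) (mon (Gen (FG i)))"]) (auto intro: mspan_neg)
  qed
  show "mon (Br (Gen (EG i)) (Gen (FG j))) \<in> mspan HM \<oplus> T" if "i \<in> S" "j \<in> S" for i j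
    using chev(6)[OF that]
    by (intro in_T_mod[of _ "if i = j then mon (Gen (HG (h i))) else 0"]) (auto intro: pm.subspace_0)
  show "mon (Br u v) \<in> mspan HM \<oplus> T" if "u \<in> HM" "v \<in> HM" for u v
    using chev(3) that by (auto intro!: plus_sets_right)
qed (use T_M in \<open>auto simp: generators_def\<close>)

lemma mspan_HM: "p \<in> mspan HM \<Longrightarrow> \<exists>x. p - mon (Gen (HG x)) \<in> T"
proof (induction rule: mspan_induct)
  case zero
  \<comment> \<open>The additivity relator at 0 and 0 collapses to minus the generator
    \<open>HG 0\<close>.\<close>
  have "- (- mon (Gen (HG (0::'h)))) \<in> T" 
    using pm.subspace_neg[OF subspace_T chev(1)[of 0 0]] by (simp only: add_0 diff_self diff_0)
  then have "0 - mon (Gen (HG (0::'h))) \<in> T" using pm.subspace_neg[OF subspace_T] by fastforce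
  then show ?case by blast
next
  case (single c u)
  then obtain x where "u = Gen (HG x)" by auto
  then show ?case using pm.subspace_neg[OF subspace_T chev(2)[of c x]] by auto
next
  case (add p q)
  then obtain x y where xy: "p - mon (Gen (HG x)) \<in> T" "q - mon (Gen (HG y)) \<in> T" by auto
  have "(p - mon (Gen (HG x))) + (q - mon (Gen (HG y)))
      - (mon (Gen (HG (x + y))) - mon (Gen (HG x)) - mon (Gen (HG y))) \<in> T"
    by (rule pm.subspace_diff[OF subspace_T pm.subspace_add[OF subspace_T xy] chev(1)])
  then have "p + q - mon (Gen (HG (x + y))) \<in> T" by (simp add: algebra_simps)
  then show ?case by blast
qed

lemma weight_zero_HG:
  assumes "p \<in> mspan M" "p \<in> mspan {u. mono_weight u = 0}"
  shows "\<exists>x. p - mon (Gen (HG x)) \<in> T"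
proof -
  obtain r w where rw: "r \<in> mspan HM" "w \<in> T" "p = r + w"
    using T.weight_zero[OF assms] T_graded by (auto elim: plus_setsE)
  obtain x where "r - mon (Gen (HG x)) \<in> T" using mspan_HM rw by blast
  then have "(r - mon (Gen (HG x))) + w \<in> T" using rw by (intro pm.subspace_add[OF subspace_T])
  then show ?thesis using rw by (intro exI[of _ x]) (simp add: algebra_simps)
qed

lemma Q_graded_iff:
  assumes J: "ideal L J"
  shows "Q_graded S par J \<longleftrightarrow> (\<forall>p\<in>J. \<forall>\<gamma>. wpres \<gamma> p \<in> J)"
proof
  have sub: "pm.subspace J" using J by (simp add: ideal_free_iff)
  assume Q: "Q_graded S par J"
  have "wpres \<gamma> p \<in> J" if "p \<in> pm.span (\<Union>\<beta>. J \<inter> weight_space S par \<beta>)" for p \<gamma>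
    using that
  proof (induction rule: pm.span_induct_alt)
    case base
    show "wpres \<gamma> 0 \<in> J" using sub by (simp add: pm.subspace_0)
  next
    case (step c x y)
    then obtain \<beta> where b: "x \<in> J" "x \<in> weight_space S par \<beta>" by auto
    then have "x \<in> mspan {u. mono_weight u = \<beta>}" by (auto simp: weight_space_def mspan_def)
    then have "wpres \<gamma> x = (if \<gamma> = \<beta> then x else 0)"
      by (auto simp: mspan_iff lookup_pres intro!: poly_mapping_eqI)
    then show ?case using b step sub by (auto intro!: pm.subspace_add pm.subspace_scale simp: pm.subspace_0)
  qed
  then show "\<forall>p\<in>J. \<forall>\<gamma>. wpres \<gamma> p \<in> J" using Q unfolding Q_graded_def by blast
next
  have sub: "pm.subspace J" using J by (simp add: ideal_free_iff)
  assume *: "\<forall>p\<in>J. \<forall>\<gamma>. wpres \<gamma> p \<in> J"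
  have "p \<in> pm.span (\<Union>\<beta>. J \<inter> weight_space S par \<beta>)" if p: "p \<in> J" for p
  proof -
    have "p \<in> mspan M" using p J by (auto simp: ideal_free_iff)
    then have "wpres \<gamma> p \<in> J \<inter> weight_space S par \<gamma>" for \<gamma>
      using * p pres_mspan'[of p M] by (auto simp: weight_space_def carrier_free in_keys_iff lookup_pres split: if_splits)
    then have "(\<Sum>\<gamma>\<in>mono_weight ` keys p. wpres \<gamma> p) \<in> pm.span (\<Union>\<beta>. J \<inter> weight_space S par \<beta>)"
      by (intro pm.span_sum pm.span_base) blast
    then show ?thesis by (subst (asm) sum_pres) auto
  qed
  moreover have "pm.span (\<Union>\<beta>. J \<inter> weight_space S par \<beta>) \<subseteq> J"
    using sub by (intro pm.span_minimal) auto
  ultimately show "Q_graded S par J" unfolding Q_graded_def by blast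
qed

text \<open>The ideals among which \<open>C\<close> is the greatest, with \<open>Q\<close>-gradedness spelled out.\<close>

definition admitted :: "(('i, 'h) gen mono \<Rightarrow>\<^sub>0 'k) set \<Rightarrow> bool" where
  "admitted J \<longleftrightarrow> ideal L J \<and> T \<subseteq> J \<and> (\<forall>p\<in>J. \<forall>\<gamma>. wpres \<gamma> p \<in> J) \<and>
     (\<forall>x. mon (Gen (HG x)) \<in> J \<longrightarrow> mon (Gen (HG x)) \<in> T)"

lemma admitted_T: "admitted T"
  using ideal_T T_graded by (auto simp: admitted_def)

lemma admitted_weight_zero:
  assumes J: "admitted J" and p: "p \<in> J"
  shows "wpres 0 p \<in> T"
proof -
  have "wpres 0 p \<in> J" "p \<in> mspan M" using J p by (auto simp: admitted_def ideal_free_iff)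
  then have w: "wpres 0 p \<in> J" "wpres 0 p \<in> mspan M" "wpres 0 p \<in> mspan {u. mono_weight u = 0}"
    by (auto simp: mspan_iff lookup_pres)
  obtain x where x: "wpres 0 p - mon (Gen (HG x)) \<in> T" using weight_zero_HG[OF w(2,3)] by blast
  have "wpres 0 p - (wpres 0 p - mon (Gen (HG x))) \<in> J"
    by (rule pm.subspace_diff) (use J w x in \<open>auto simp: admitted_def ideal_free_iff\<close>)
  then have "mon (Gen (HG x)) \<in> T" using J by (auto simp: admitted_def)
  then have "(wpres 0 p - mon (Gen (HG x))) + mon (Gen (HG x)) \<in> T"
    using x by (intro pm.subspace_add[OF subspace_T])
  then show ?thesis by simp
qed

lemma admitted_C: "admitted C" and admitted_max: "admitted J \<Longrightarrow> J \<subseteq> C"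
proof -
  define C0 where "C0 = pm.span (\<Union>{J. admitted J})"
  have le: "J \<subseteq> C0" if "admitted J" for J
    unfolding C0_def using that by (auto intro!: pm.span_base)
  have sub: "pm.subspace C0" by (simp add: C0_def)
  have lin: "f p \<in> X" if "p \<in> C0" "plin f" "pm.subspace X" "\<And>J q. admitted J \<Longrightarrow> q \<in> J \<Longrightarrow> f q \<in> X"
    for f p and X :: "(('i, 'h) gen mono \<Rightarrow>\<^sub>0 'k) set"
  proof -
    have f0: "f 0 = 0" using that(2) unfolding plin_def by (metis add_cancel_left_left)
    show ?thesis using that(1) unfolding C0_def
    proof (induction rule: pm.span_induct_alt)
      case base show "f 0 \<in> X" using that(3) f0 by (simp add: pm.subspace_0)
    next
      case (step c x y)
      then obtain J where "admitted J" "x \<in> J" by auto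
      then have "pscale c (f x) + f y \<in> X" using step that(3,4)
        by (blast intro: pm.subspace_add pm.subspace_scale)
      then show ?case using that(2) by (simp add: plin_def)
    qed
  qed
  have cl: "fbr x q \<in> C0 \<and> fbr q x \<in> C0" if "x \<in> mspan M" "admitted J" "q \<in> J" for x q J
    using le[OF that(2)] that by (auto simp: admitted_def ideal_free_iff)
  have "ideal L C0"
    unfolding ideal_free_iff
  proof (intro conjI ballI)
    show "C0 \<subseteq> mspan M"
    proof
      show "x \<in> mspan M" if "x \<in> C0" for x
        by (rule lin[of _ "\<lambda>x. x", OF that _ subspace_mspan]) (auto simp: plin_def admitted_def ideal_free_iff)
    qed
    fix x y :: "('i, 'h) gen mono \<Rightarrow>\<^sub>0 'k" assume x: "x \<in> mspan M" and y: "y \<in> C0"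
    show "fbr x y \<in> C0"
      by (rule lin[of _ "fbr x", OF y _ sub]) (use x cl in \<open>auto simp: plin_def bilinear_ext_simps\<close>)
    show "fbr y x \<in> C0"
      by (rule lin[of _ "\<lambda>y. fbr y x", OF y _ sub]) (use x cl in \<open>auto simp: plin_def bilinear_ext_simps\<close>)
  qed (fact sub)
  moreover have "T \<subseteq> C0" using le admitted_T by blast
  moreover have "wpres \<gamma> p \<in> C0" if "p \<in> C0" for p \<gamma>
  proof (rule lin[OF that plin_pres sub])
    show "wpres \<gamma> q \<in> C0" if "admitted J" "q \<in> J" for J q
      using le[OF that(1)] that by (auto simp: admitted_def)
  qed
  moreover have "mon (Gen (HG x)) \<in> T" if "mon (Gen (HG x)) \<in> C0" for x
  proof -
    have "wpres 0 (mon (Gen (HG x))) \<in> T"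
      by (rule lin[OF that plin_pres subspace_T]) (rule admitted_weight_zero)
    then show ?thesis by (simp add: pres_single)
  qed
  ultimately have ad: "admitted C0" by (auto simp: admitted_def)
  have iff: "admitted J \<longleftrightarrow> ideal L J \<and> T \<subseteq> J \<and> Q_graded S par J \<and>
      (\<forall>x. gvar (HG x) \<in> J \<longrightarrow> gvar (HG x) \<in> T)" for J
    using Q_graded_iff[of J] by (auto simp: admitted_def gvar_def)
  have "C = C0"
    unfolding contragredient_ideal_def
    by (rule Greatest_equality) (use ad le in \<open>auto simp flip: iff\<close>)
  then show "admitted C" "admitted J \<Longrightarrow> J \<subseteq> C" using ad le by auto
qed

lemma T_C: "T \<subseteq> C" and C_graded: "p \<in> C \<Longrightarrow> wpres \<gamma> p \<in> C"
  and C_HG: "mon (Gen (HG z)) \<in> C \<Longrightarrow> mon (Gen (HG z)) \<in> T"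
  and C_M: "C \<subseteq> mspan M" and subspace_C [simp]: "pm.subspace C"
  and C_closed: "x \<in> mspan M \<Longrightarrow> y \<in> C \<Longrightarrow> fbr x y \<in> C" "x \<in> mspan M \<Longrightarrow> y \<in> C \<Longrightarrow> fbr y x \<in> C"
  using admitted_C by (auto simp: admitted_def ideal_free_iff)

text \<open>Stability under unions of weight spaces is what permits coarsening the grading of g(A)
  to Q modulo the \<alpha>'s of I.\<close>

lemma C_pres_weight:
  assumes "p \<in> C" shows "pres (\<lambda>u. P (mono_weight u)) p \<in> C"
proof -
  let ?Z = "mono_weight ` keys p"
  have "pres (\<lambda>u. P (mono_weight u)) (wpres \<gamma> p) = (if P \<gamma> then wpres \<gamma> p else 0)" for \<gamma>
    by (rule poly_mapping_eqI) (auto simp: lookup_pres)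
  then have "pres (\<lambda>u. P (mono_weight u)) (\<Sum>\<gamma>\<in>?Z. wpres \<gamma> p) \<in> C"
    unfolding pres_sum using assms
    by (auto intro!: pm.subspace_sum[OF subspace_C] C_graded simp: pm.subspace_0)
  then show ?thesis by (subst (asm) sum_pres) auto
qed

text \<open>The value at x of the functional attached to \<beta>. It lies in the field of
  coefficients, so in positive characteristic different weights can share all values; gradings are
  therefore kept by Q and not by eigenvalues.\<close>

definition wval :: "'h \<Rightarrow> ('i \<Rightarrow>\<^sub>0 int) \<Rightarrow> 'k" where
  "wval x \<beta> = (\<Sum>i\<in>keys \<beta>. of_int (lookup \<beta> i) * \<alpha> i x)"

lemma wval_superset:
  "finite U \<Longrightarrow> keys \<beta> \<subseteq> U \<Longrightarrow>
    wval x \<beta> = (\<Sum>i\<in>U. of_int (lookup \<beta> i) * \<alpha> i x)"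
  unfolding wval_def by (intro sum.mono_neutral_left) (auto simp: in_keys_iff)

lemma wval_add: "wval x (\<beta> + \<gamma>) = wval x \<beta> + wval x \<gamma>"
  by (subst (1 2 3) wval_superset[of "keys \<beta> \<union> keys \<gamma>"])
    (auto simp: lookup_add ring_distribs sum.distrib dest: keys_add[THEN subsetD])

lemma wval_simps: "wval x 0 = 0" "wval x (frag_of i) = \<alpha> i x" "wval x (- frag_of i) = - \<alpha> i x"
  by (simp_all add: wval_def)

lemma HG_action_mon:
  assumes "u \<in> M"
  shows "mon (Br (Gen (HG x)) u) - pscale (wval x (mono_weight u)) (mon u) \<in> T"
  using assms
proof (induction u)
  case (Gen g)
  then show ?case
    using chev(3)[of x] chev(4)[of _ x] chev(5)[of _ x]
    by (auto simp: generators_def wval_simps pm.subspace_0 single_uminus)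
next
  case (Br u v)
  let ?H = "mon (Gen (HG x)) :: ('i, 'h) gen mono \<Rightarrow>\<^sub>0 'k"
  let ?a = "wval x (mono_weight u)" and ?b = "wval x (mono_weight v)"
  have uv: "u \<in> M" "v \<in> M" using Br by auto
  have 1: "jac_rel False (mono_par par u) ?H (mon u) (mon v) \<in> T"
    using T.jac_mon[of "Gen (HG x)" u v] uv by simp
  have 2: "fbr (mon (Br (Gen (HG x)) u) - pscale ?a (mon u)) (mon v) \<in> T"
    using Br uv by (intro T_closed) auto
  have 3: "fbr (mon u) (mon (Br (Gen (HG x)) v) - pscale ?b (mon v)) \<in> T"
    using Br uv by (intro T_closed) auto
  have "jac_rel False (mono_par par u) ?H (mon u) (mon v) + fbr (mon (Br (Gen (HG x)) u) - pscale ?a (mon u)) (mon v)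
      + fbr (mon u) (mon (Br (Gen (HG x)) v) - pscale ?b (mon v)) \<in> T"
    by (intro pm.subspace_add[OF subspace_T] 1 2 3)
  then show ?case
    by (simp add: jac_rel_def koszul_def bilinear_ext_simps wval_add single_add single_diff algebra_simps)
qed

lemma HG_action:
  assumes "p \<in> mspan M" "p \<in> mspan {u. mono_weight u = \<gamma>}"
  shows "fbr (mon (Gen (HG x))) p - pscale (wval x \<gamma>) p \<in> T"
proof (rule plin_mspan[where M = "{u \<in> M. mono_weight u = \<gamma>}"
      and f = "\<lambda>p. fbr (mon (Gen (HG x))) p - pscale (wval x \<gamma>) p" and p = p])
  show "plin (\<lambda>p. fbr (mon (Gen (HG x))) p - pscale (wval x \<gamma>) p)"
    by (auto simp: plin_def bilinear_ext_simps algebra_simps)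
  show "p \<in> mspan {u \<in> M. mono_weight u = \<gamma>}" using assms by (auto simp: mspan_iff)
  show "fbr (mon (Gen (HG x))) (mon u) - pscale (wval x \<gamma>) (mon u) \<in> T" if "u \<in> {u \<in> M. mono_weight u = \<gamma>}" for u
    using that HG_action_mon[of u x] by (auto simp: bilinear_ext_simps)
qed simp

abbreviation EF :: "('i, 'h) gen mono set" where "EF \<equiv> words (EG ` S \<union> FG ` S)"

lemma EF_M: "EF \<subseteq> M"
  by (rule words_mono) (auto simp: generators_def)

text \<open>A Cartan generator only rescales e,f-words and commutes with other Cartan generators, so
  after one bracket no free-standing Cartan generator survives.\<close>

lemma fbr_EF_HM:
  assumes "p \<in> mspan (EF \<union> HM) \<oplus> T" "q \<in> mspan (EF \<union> HM) \<oplus> T"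
  shows "fbr p q \<in> mspan EF \<oplus> T"
proof (rule T.fbr_plus_sets[OF subspace_mspan assms _ _ _ T_M])
  show sub: "EF \<union> HM \<subseteq> M" "EF \<union> HM \<subseteq> M" using EF_M by auto
  have HE: "mon (Br (Gen (HG x)) w) \<in> mspan EF \<oplus> T" if "w \<in> EF" for x w
    using that EF_M HG_action_mon[of w x] by (intro in_T_mod[of _ "pscale (wval x (mono_weight w)) (mon w)"]) auto
  show "mon (Br u v) \<in> mspan EF \<oplus> T" if uv: "u \<in> EF \<union> HM" "v \<in> EF \<union> HM" for u v
  proof -
    consider "u \<in> EF" "v \<in> EF" | x where "u = Gen (HG x)" "v \<in> EF" | x where "u \<in> EF" "v = Gen (HG x)"
      | x y where "u = Gen (HG x)" "v = Gen (HG y)" using uv by auto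
    then show ?thesis
    proof cases
      case 1 then show ?thesis by (auto intro: plus_sets_left)
    next
      case 2 then show ?thesis using HE by auto
    next
      case 3 then show ?thesis using HE[of u x] EF_M by (intro T.swap_step[of _ v u]) auto
    next
      case 4 then show ?thesis using chev(3) by (auto intro: plus_sets_right)
    qed
  qed
qed

lemma mon_EF_HM: "u \<in> M \<Longrightarrow> mon u \<in> mspan (EF \<union> HM) \<oplus> T"
proof (induction u)
  case (Gen g)
  then show ?case by (auto simp: generators_def intro!: plus_sets_left)
next
  case (Br u v)
  then have "fbr (mon u) (mon v) \<in> mspan EF \<oplus> T" by (intro fbr_EF_HM) auto
  then have "mon (Br u v) \<in> mspan EF \<oplus> T" by (simp add: bilinear_ext_simps)
  then show ?case by (rule T.mspan_W_mono[rotated]) auto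
qed

lemma Br_EF: "u \<in> M \<Longrightarrow> v \<in> M \<Longrightarrow> mon (Br u v) \<in> mspan EF \<oplus> T"
  using fbr_EF_HM[OF mon_EF_HM mon_EF_HM, of u v] by (simp add: bilinear_ext_simps)

end


section \<open>Contragredient superalgebras\<close>

lemma superalgebraD:
  assumes "superalgebra L"
  shows "vector_space (smul L)" "module.subspace (smul L) (part L a)"
    "part L False \<inter> part L True = {0}"
    "x \<in> part L a \<Longrightarrow> y \<in> part L b \<Longrightarrow> brk L x y \<in> part L (a \<noteq> b)"
    "x \<in> carrier L \<Longrightarrow> y \<in> carrier L \<Longrightarrow> z \<in> carrier L \<Longrightarrow> brk L (x + y) z = brk L x z + brk L y z"
    "x \<in> carrier L \<Longrightarrow> y \<in> carrier L \<Longrightarrow> z \<in> carrier L \<Longrightarrow> brk L z (x + y) = brk L z x + brk L z y"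
    "x \<in> carrier L \<Longrightarrow> y \<in> carrier L \<Longrightarrow> brk L (smul L c x) y = smul L c (brk L x y)"
    "x \<in> carrier L \<Longrightarrow> y \<in> carrier L \<Longrightarrow> brk L x (smul L c y) = smul L c (brk L x y)"
  using assms by (auto simp: superalgebra_def part_def)

lemma part_subset_carrier:
  assumes "superalgebra L" shows "part L a \<subseteq> carrier L"
proof
  interpret v: vector_space "smul L" using assms by (rule superalgebraD)
  fix x assume x: "x \<in> part L a"
  have 0: "0 \<in> part L False" "0 \<in> part L True"
    using superalgebraD(2)[OF assms] v.subspace_0 by auto
  show "x \<in> carrier L"
  proof (cases a)
    case True
    then have "x \<in> part L True" using x by simp
    then have "0 + x \<in> carrier L" unfolding carrier_parts using 0 by blast
    then show ?thesis by simp
  next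
    case False
    then have "x \<in> part L False" using x by simp
    then have "x + 0 \<in> carrier L" unfolding carrier_parts using 0 by blast
    then show ?thesis by simp
  qed
qed

lemma carrier_subspace:
  assumes "superalgebra L" shows "module.subspace (smul L) (carrier L)"
proof -
  interpret v: vector_space "smul L" using assms by (rule superalgebraD)
  show ?thesis unfolding carrier_parts
    using v.subspace_sums superalgebraD(2)[OF assms] by blast
qed

locale contragredient_alg = chevalley_data S par sH h \<alpha>
  for S :: "'i set" and par :: "'i \<Rightarrow> bool" and sH :: "'k::field \<Rightarrow> 'h::ab_group_add \<Rightarrow> 'h"
    and h :: "'i \<Rightarrow> 'h" and \<alpha> :: "'i \<Rightarrow> 'h \<Rightarrow> 'k" +
  fixes A :: "'i \<Rightarrow> 'i \<Rightarrow> int" and G :: "('k, 'g::ab_group_add) superalg"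
    and \<pi> :: "(('i, 'h) gen mono \<Rightarrow>\<^sub>0 'k) \<Rightarrow> 'g"
  assumes contragredient: "contragredient S par A sH h \<alpha> G \<pi>" and finite_S: "finite S"
begin

lemma realization: "realization S A sH h \<alpha>" and quotient: "is_quotient L C G \<pi>"
  using contragredient by (auto simp: contragredient_def)

lemma superalgebra_G: "superalgebra G"
  using quotient by (simp add: is_quotient_def)

sublocale g: vector_space "smul G"
  using superalgebra_G by (rule superalgebraD)

lemma pi_add: "p \<in> mspan M \<Longrightarrow> q \<in> mspan M \<Longrightarrow> \<pi> (p + q) = \<pi> p + \<pi> q"
  and pi_scale: "p \<in> mspan M \<Longrightarrow> \<pi> (pscale c p) = smul G c (\<pi> p)"
  and pi_brk: "p \<in> mspan M \<Longrightarrow> q \<in> mspan M \<Longrightarrow> \<pi> (fbr p q) = brk G (\<pi> p) (\<pi> q)"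
  and carrier_G: "carrier G = \<pi> ` mspan M"
  and pi_eq_0_iff: "p \<in> mspan M \<Longrightarrow> \<pi> p = 0 \<longleftrightarrow> p \<in> C"
  using quotient by (auto simp: is_quotient_def superalg_hom_def carrier_free)

lemma pi_0 [simp]: "\<pi> 0 = 0"
  using pi_eq_0_iff[of 0] by (simp add: pm.subspace_0)

lemma pi_uminus: "p \<in> mspan M \<Longrightarrow> \<pi> (- p) = - \<pi> p"
  using pi_scale[of p "- 1"] by simp

lemma pi_diff: "p \<in> mspan M \<Longrightarrow> q \<in> mspan M \<Longrightarrow> \<pi> (p - q) = \<pi> p - \<pi> q"
  using pi_add[of p "- q"] pi_uminus[of q] mspan_neg[of q M] by simp

lemma pi_sum: "(\<And>i. i \<in> B \<Longrightarrow> f i \<in> mspan M) \<Longrightarrow> \<pi> (\<Sum>i\<in>B. f i) = (\<Sum>i\<in>B. \<pi> (f i))"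
proof (induction B rule: infinite_finite_induct)
  case (insert x F)
  then show ?case by (simp add: pi_add mspan_sum)
qed auto

lemma pi_single: "u \<in> M \<Longrightarrow> \<pi> (single u c) = smul G c (\<pi> (mon u))"
  using pi_scale[of "mon u" c] by simp

lemma pi_eqI: "p \<in> mspan M \<Longrightarrow> q \<in> mspan M \<Longrightarrow> p - q \<in> C \<Longrightarrow> \<pi> p = \<pi> q"
  using pi_diff[of p q] pi_eq_0_iff[of "p - q"] C_M by auto

lemma pi_T: "p \<in> T \<Longrightarrow> \<pi> p = 0"
  using T_C C_M pi_eq_0_iff by blast

lemma pi_image_subspace:
  assumes "pm.subspace X" "X \<subseteq> mspan M" shows "g.subspace (\<pi> ` X)"
proof (rule g.subspaceI)
  show "0 \<in> \<pi> ` X" using assms pi_0 pm.subspace_0 by (metis image_eqI)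
  show "x + y \<in> \<pi> ` X" if xy: "x \<in> \<pi> ` X" "y \<in> \<pi> ` X" for x y
  proof -
    obtain p q where "p \<in> X" "q \<in> X" "x = \<pi> p" "y = \<pi> q" using xy by auto
    then show ?thesis using assms pi_add[of p q] pm.subspace_add[OF assms(1)] by (metis image_eqI subsetD)
  qed
  show "smul G c x \<in> \<pi> ` X" if x: "x \<in> \<pi> ` X" for c x
  proof -
    obtain p where "p \<in> X" "x = \<pi> p" using x by auto
    then show ?thesis using assms pi_scale[of p c] pm.subspace_scale[OF assms(1)] by (metis image_eqI subsetD)
  qed
qed

lemma pi_Pt: "p \<in> Pt a \<Longrightarrow> \<pi> p \<in> part G a"
proof -
  have "\<pi> ` part L a \<subseteq> part G a"
    using quotient by (cases a) (auto simp: is_quotient_def superalg_hom_def part_def)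
  then show "p \<in> Pt a \<Longrightarrow> \<pi> p \<in> part G a" unfolding part_free by blast
qed

text \<open>The component of p of the other parity is mapped into both parity parts of G, whose
  intersection is zero.\<close>

lemma pres_part:
  assumes p: "p \<in> mspan M" and a: "\<pi> p \<in> part G a"
  shows "\<pi> p = \<pi> (pres (\<lambda>u. mono_par par u = a) p)" "pres (\<lambda>u. mono_par par u = a) p \<in> Pt a"
proof -
  let ?q = "pres (\<lambda>u. mono_par par u = a) p" and ?r = "pres (\<lambda>u. mono_par par u = (\<not> a)) p"
  show q: "?q \<in> Pt a" using pres_mspan[OF p] by blast
  have r: "?r \<in> Pt (\<not> a)" using pres_mspan[OF p] by blast
  have pqr: "p = ?q + ?r" by (rule poly_mapping_eqI) (simp add: lookup_add lookup_pres)
  have qM: "?q \<in> mspan M" "?r \<in> mspan M" using p by (auto intro: pres_mspan')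
  have "\<pi> p = \<pi> ?q + \<pi> ?r" by (subst pqr) (rule pi_add[OF qM])
  then have e: "\<pi> p - \<pi> ?q = \<pi> ?r" by simp
  moreover have "\<pi> p - \<pi> ?q \<in> part G a"
    using a pi_Pt[OF q] superalgebraD(2)[OF superalgebra_G] by (intro g.subspace_diff)
  ultimately have "\<pi> ?r \<in> part G a \<inter> part G (\<not> a)" using pi_Pt[OF r] by simp
  then have "\<pi> ?r = 0" using superalgebraD(3)[OF superalgebra_G] by (cases a) auto
  then show "\<pi> p = \<pi> ?q" using e by simp
qed

lemma part_carrier: "part G a \<subseteq> carrier G"
  using superalgebra_G by (rule part_subset_carrier)

lemma part_G: "part G a = \<pi> ` Pt a"
proof
  show "part G a \<subseteq> \<pi> ` Pt a"
  proof
    fix x assume x: "x \<in> part G a"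
    then obtain p where "p \<in> mspan M" "x = \<pi> p" using part_carrier carrier_G by blast
    then show "x \<in> \<pi> ` Pt a" using pres_part[of p a] x by blast
  qed
qed (use pi_Pt in blast)

lemma pi_anti_rel: "p \<in> mspan M \<Longrightarrow> q \<in> mspan M \<Longrightarrow>
    \<pi> (anti_rel a b p q) = brk G (\<pi> p) (\<pi> q) + smul G (koszul a b) (brk G (\<pi> q) (\<pi> p))"
  by (simp add: anti_rel_def pi_add pi_scale pi_brk fbr_mspan mspan_scale)

lemma pi_jac_rel: "p \<in> mspan M \<Longrightarrow> q \<in> mspan M \<Longrightarrow> r \<in> mspan M \<Longrightarrow>
    \<pi> (jac_rel a b p q r) = brk G (\<pi> p) (brk G (\<pi> q) (\<pi> r)) - brk G (brk G (\<pi> p) (\<pi> q)) (\<pi> r)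
      - smul G (koszul a b) (brk G (\<pi> q) (brk G (\<pi> p) (\<pi> r)))"
  by (simp add: jac_rel_def pi_diff pi_scale pi_brk fbr_mspan mspan_scale
      mspan_diff)

lemma lie_G: "lie_superalgebra G"
proof -
  have T0: "\<pi> r = 0" if "r \<in> lie_relators L" for r
    using that Rel_T by (intro pi_T) auto
  have "r = 0" if "r \<in> lie_relators G" for r
    using that unfolding lie_relators_def
  proof (elim UnE)
    assume "r \<in> {brk G x y + smul G (koszul a b) (brk G y x) | a b x y. x \<in> part G a \<and> y \<in> part G b}"
    then obtain a b x y where *: "r = brk G x y + smul G (koszul a b) (brk G y x)" "x \<in> part G a" "y \<in> part G b"
      by blast
    then obtain p q where pq: "p \<in> Pt a" "x = \<pi> p" "q \<in> Pt b" "y = \<pi> q" unfolding part_G by blast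
    then show "r = 0" using * T0[OF relator_intros(1)[OF pq(1,3)]] pi_anti_rel[OF Pt_M[OF pq(1)] Pt_M[OF pq(3)]]
      by simp
  next
    assume "r \<in> {brk G x (brk G y z) - brk G (brk G x y) z - smul G (koszul a b) (brk G y (brk G x z))
        | a b c x y z. x \<in> part G a \<and> y \<in> part G b \<and> z \<in> part G c}"
    then obtain a b c x y z where *: "r = brk G x (brk G y z) - brk G (brk G x y) z - smul G (koszul a b) (brk G y (brk G x z))"
      "x \<in> part G a" "y \<in> part G b" "z \<in> part G c"
      by blast
    then obtain p q s where pq: "p \<in> Pt a" "x = \<pi> p" "q \<in> Pt b" "y = \<pi> q" "s \<in> Pt c" "z = \<pi> s"
      unfolding part_G by blast
    then show "r = 0" using * T0[OF relator_intros(2)[OF pq(1,3,5)]]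
        pi_jac_rel[OF Pt_M[OF pq(1)] Pt_M[OF pq(3)] Pt_M[OF pq(5)]]
      by simp
  next
    assume "r \<in> {brk G x (brk G x x) | x. x \<in> odd_part G}"
    then obtain x where *: "r = brk G x (brk G x x)" "x \<in> part G True" by (auto simp: part_def)
    then obtain p where p: "p \<in> Pt True" "x = \<pi> p" unfolding part_G by blast
    have "\<pi> (fbr p (fbr p p)) = brk G (\<pi> p) (brk G (\<pi> p) (\<pi> p))"
      using Pt_M[OF p(1)] by (simp add: pi_brk fbr_mspan)
    then show "r = 0" using * p T0[OF relator_intros(3)[OF p(1)]] by simp
  qed
  then show ?thesis using superalgebra_G by (auto simp: lie_superalgebra_def)
qed

lemma pi_HG_add: "\<pi> (mon (Gen (HG (x + y)))) = \<pi> (mon (Gen (HG x))) + \<pi> (mon (Gen (HG y)))"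
proof -
  have "\<pi> (mon (Gen (HG (x + y))) - mon (Gen (HG x)) - mon (Gen (HG y)))
      = \<pi> (mon (Gen (HG (x + y)))) - \<pi> (mon (Gen (HG x))) - \<pi> (mon (Gen (HG y)))"
    by (simp only: pi_diff mspan_diff single_in_mspan gens_M Gen_in_words)
  then show ?thesis using pi_T[OF chev(1)[of x y]] by (simp add: algebra_simps)
qed

lemma pi_HG_diff: "\<pi> (mon (Gen (HG (x - y)))) = \<pi> (mon (Gen (HG x))) - \<pi> (mon (Gen (HG y)))"
  using pi_HG_add[of "x - y" y] by simp

lemma brk_HH: "brk G (\<pi> (mon (Gen (HG x)))) (\<pi> (mon (Gen (HG y)))) = 0"
  using pi_T[OF chev(3)[of x y]] pi_brk[of "mon (Gen (HG x))" "mon (Gen (HG y))"]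
  by (simp add: bilinear_ext_simps)

lemma pi_brk_mon: "u \<in> M \<Longrightarrow> v \<in> M \<Longrightarrow> brk G (\<pi> (mon u)) (\<pi> (mon v)) = \<pi> (mon (Br u v))"
  using pi_brk[of "mon u" "mon v"] by (simp add: bilinear_ext_simps)

lemma brk_HE:
  assumes "j \<in> S"
  shows "brk G (\<pi> (mon (Gen (HG x)))) (gE \<pi> j) = smul G (\<alpha> j x) (gE \<pi> j)"
proof -
  have "brk G (\<pi> (mon (Gen (HG x)))) (gE \<pi> j) = \<pi> (mon (Br (Gen (HG x)) (Gen (EG j))))"
    using assms by (simp add: pi_brk_mon gE_def gvar_def)
  also have "\<dots> = \<pi> (pscale (\<alpha> j x) (mon (Gen (EG j))))"
    by (rule pi_eqI) (use assms chev(4)[of j x] T_C in auto)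
  also have "\<dots> = smul G (\<alpha> j x) (gE \<pi> j)"
    unfolding gE_def gvar_def by (rule pi_scale) (use assms in auto)
  finally show ?thesis .
qed

lemma brk_HF:
  assumes "j \<in> S"
  shows "brk G (\<pi> (mon (Gen (HG x)))) (gF \<pi> j) = - smul G (\<alpha> j x) (gF \<pi> j)"
proof -
  have "brk G (\<pi> (mon (Gen (HG x)))) (gF \<pi> j) = \<pi> (mon (Br (Gen (HG x)) (Gen (FG j))))"
    using assms by (simp add: pi_brk_mon gF_def gvar_def)
  also have "\<dots> = \<pi> (pscale (- \<alpha> j x) (mon (Gen (FG j))))"
    by (rule pi_eqI) (use assms chev(5)[of j x] T_C in \<open>auto simp: single_uminus intro: mspan_neg\<close>)
  also have "\<dots> = smul G (- \<alpha> j x) (gF \<pi> j)"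
    unfolding gF_def gvar_def by (rule pi_scale) (use assms in auto)
  finally show ?thesis by simp
qed

lemma brk_EF: "i \<in> S \<Longrightarrow> j \<in> S \<Longrightarrow> brk G (gE \<pi> i) (gF \<pi> j) = (if i = j then gH \<pi> h i else 0)"
  using pi_T[OF chev(6)[of i j]] pi_brk[of "mon (Gen (EG i))" "mon (Gen (FG j))"]
  by (auto simp: bilinear_ext_simps pi_diff gE_def gF_def gH_def gvar_def split: if_splits)

lemma alpha_h: "i \<in> S \<Longrightarrow> j \<in> S \<Longrightarrow> \<alpha> j (h i) = of_int (A i j)"
  using realization by (auto simp: realization_def)

text \<open>The reason for the extended Cartan subalgebra: column j of the reduced matrix may
  vanish, yet independence of the \<alpha>'s still provides an x that acts nontrivially on e_j and
  f_j.\<close>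

lemma alpha_nonzero: "j \<in> S \<Longrightarrow> \<exists>x. \<alpha> j x \<noteq> 0"
proof (rule ccontr)
  assume j: "j \<in> S" and "\<not> (\<exists>x. \<alpha> j x \<noteq> 0)"
  then have "\<alpha> j x = 0" for x by blast
  then have "(\<Sum>i\<in>S. (if i = j then 1 else 0) * \<alpha> i x) = 0" for x by (intro sum.neutral) auto
  then have "\<forall>i\<in>S. (if i = j then 1 else (0::'k)) = 0"
    using realization unfolding realization_def by (elim conjE) (erule allE, erule mp, blast)
  then show False using j by auto
qed

section \<open>The derived superalgebra\<close>

abbreviation BrM :: "('i, 'h) gen mono set" where "BrM \<equiv> {Br u v | u v. u \<in> M \<and> v \<in> M}"

lemma BrM_M: "BrM \<subseteq> M"
  by auto

lemma derived_span:
  "g.span {brk G x y | x y. x \<in> carrier G \<and> y \<in> carrier G} = \<pi> ` mspan BrM"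
proof
  have sM: "mspan BrM \<subseteq> mspan M" using mspan_mono[OF BrM_M] by blast
  show "g.span {brk G x y | x y. x \<in> carrier G \<and> y \<in> carrier G} \<subseteq> \<pi> ` mspan BrM"
  proof (rule g.span_minimal)
    show "{brk G x y | x y. x \<in> carrier G \<and> y \<in> carrier G} \<subseteq> \<pi> ` mspan BrM"
    proof clarify
      fix x y assume "x \<in> carrier G" "y \<in> carrier G"
      then obtain p q where pq: "p \<in> mspan M" "q \<in> mspan M" "x = \<pi> p" "y = \<pi> q"
        unfolding carrier_G by blast
      have "fbr p q \<in> mspan BrM"
        by (rule fbr_in_subspace[OF _ _ pq(1,2)]) auto
      then have "\<pi> (fbr p q) \<in> \<pi> ` mspan BrM" by (rule imageI)
      then show "brk G x y \<in> \<pi> ` mspan BrM" using pi_brk[OF pq(1,2)] pq(3,4) by simp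
    qed
  qed (rule pi_image_subspace[OF subspace_mspan sM])
  show "\<pi> ` mspan BrM \<subseteq> g.span {brk G x y | x y. x \<in> carrier G \<and> y \<in> carrier G}"
  proof clarify
    fix p :: "('i, 'h) gen mono \<Rightarrow>\<^sub>0 'k" assume "p \<in> mspan BrM"
    then show "\<pi> p \<in> g.span {brk G x y | x y. x \<in> carrier G \<and> y \<in> carrier G}"
    proof (induction rule: mspan_induct)
      case zero
      then show ?case by (simp add: g.span_zero)
    next
      case (single c u)
      then obtain v w where vw: "u = Br v w" "v \<in> M" "w \<in> M" by blast
      then have "\<pi> (mon u) = brk G (\<pi> (mon v)) (\<pi> (mon w))"
        using pi_brk[of "mon v" "mon w"] by (simp add: bilinear_ext_simps)
      moreover have "\<pi> (mon v) \<in> carrier G" "\<pi> (mon w) \<in> carrier G" using vw by (auto simp: carrier_G)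
      ultimately have "\<pi> (mon u) \<in> g.span {brk G x y | x y. x \<in> carrier G \<and> y \<in> carrier G}"
        by (intro g.span_base) blast
      then show ?case using vw pi_single[of u c] by (simp add: g.span_scale)
    next
      case (add p q)
      then have "p \<in> mspan M" "q \<in> mspan M" using sM by blast+
      then show ?case using add pi_add[of p q] by (simp add: g.span_add)
    qed
  qed
qed

lemma derived_simps [simp]: "smul (derived G) = smul G" "brk (derived G) = brk G"
  by (simp_all add: derived_def restrict_to_def)

lemma part_derived: "part (derived G) a = part G a \<inter> \<pi> ` mspan BrM"
  unfolding derived_def restrict_to_def derived_span by (simp add: part_def)

lemma carrier_derived: "carrier (derived G) = \<pi> ` mspan BrM"
proof
  have sM: "mspan BrM \<subseteq> mspan M" using mspan_mono[OF BrM_M] by blast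
  note sub = pi_image_subspace[OF subspace_mspan sM]
  show "carrier (derived G) \<subseteq> \<pi> ` mspan BrM"
    unfolding carrier_parts part_derived using g.subspace_add[OF sub] by auto
  show "\<pi> ` mspan BrM \<subseteq> carrier (derived G)"
  proof
    fix x assume "x \<in> \<pi> ` mspan BrM"
    then obtain p where p: "p \<in> mspan BrM" "x = \<pi> p" by blast
    let ?q = "pres (\<lambda>u. \<not> mono_par par u) p" and ?r = "pres (\<lambda>u. mono_par par u) p"
    have qr: "?q \<in> mspan BrM" "?r \<in> mspan BrM" using p by (auto intro: pres_mspan')
    have pM: "p \<in> mspan M" using p sM by blast
    have "?q \<in> Pt False" "?r \<in> Pt True" using pres_mspan[OF pM] by auto
    then have "\<pi> ?q \<in> part G False" "\<pi> ?r \<in> part G True" by (auto simp del: not_False_eq_True intro: pi_Pt)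
    moreover have "\<pi> p = \<pi> ?q + \<pi> ?r"
      by (subst pres_parity_sum[of p par]) (use qr sM in \<open>auto intro: pi_add\<close>)
    ultimately show "x \<in> carrier (derived G)"
      unfolding carrier_parts part_derived using p qr by blast
  qed
qed

lemma part_derived': "part (derived G) a = part G a \<inter> carrier (derived G)"
  using part_derived carrier_derived by simp

lemma carrier_derived_sub: "carrier (derived G) \<subseteq> carrier G"
  unfolding carrier_derived carrier_G using mspan_mono[OF BrM_M] by blast

lemma subspace_derived: "g.subspace (carrier (derived G))"
  unfolding carrier_derived using mspan_mono[OF BrM_M] by (intro pi_image_subspace) auto

lemma brk_derived: "x \<in> carrier G \<Longrightarrow> y \<in> carrier G \<Longrightarrow> brk G x y \<in> carrier (derived G)"
  unfolding carrier_derived derived_span[symmetric] by (rule g.span_base) blast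

lemma lie_derived: "lie_superalgebra (derived G)"
proof -
  have ev: "even_part (derived G) = part G False \<inter> carrier (derived G)"
    "odd_part (derived G) = part G True \<inter> carrier (derived G)"
    using part_derived'[of False] part_derived'[of True] by (auto simp: part_def)
  have sub: "x \<in> carrier G" if "x \<in> carrier (derived G)" for x
    using that carrier_derived_sub by blast
  have "superalgebra (derived G)"
    unfolding superalgebra_def part_derived' ev derived_simps
  proof (intro conjI allI ballI)
    show "g.subspace (part G False \<inter> carrier (derived G))" "g.subspace (part G True \<inter> carrier (derived G))"
      using superalgebraD(2)[OF superalgebra_G] subspace_derived by (auto intro: g.subspace_inter)
    show "part G False \<inter> carrier (derived G) \<inter> (part G True \<inter> carrier (derived G)) = {0}"
      using superalgebraD(3)[OF superalgebra_G] g.subspace_0[OF subspace_derived] by auto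
    show "brk G x y \<in> part G (a \<noteq> b) \<inter> carrier (derived G)"
      if "x \<in> part G a \<inter> carrier (derived G)" "y \<in> part G b \<inter> carrier (derived G)" for a b x y
      using that superalgebraD(4)[OF superalgebra_G, of x a y b] brk_derived[of x y] part_carrier by auto
  qed (auto simp: sub superalgebraD(5-8)[OF superalgebra_G] intro: g.vector_space_axioms)
  moreover have "lie_relators (derived G) \<subseteq> lie_relators G"
    unfolding lie_relators_def derived_simps part_derived' ev part_def[of G True, simplified]
    by (intro Un_mono) blast+
  ultimately show ?thesis using lie_G by (auto simp: lie_superalgebra_def)
qed

text \<open>One inclusion is \<open>Br_EF\<close>; for the other, e_i and f_i are recovered as
  multiples of [x,e_i] and [x,f_i] for an x with \<alpha>_i(x) nonzero.\<close>

lemma carrier_derived_EF: "carrier (derived G) = \<pi> ` mspan EF"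
proof
  have EM: "mspan EF \<subseteq> mspan M" using mspan_mono[OF EF_M] by blast
  show "carrier (derived G) \<subseteq> \<pi> ` mspan EF"
    unfolding carrier_derived
  proof clarify
    fix p :: "('i, 'h) gen mono \<Rightarrow>\<^sub>0 'k" assume "p \<in> mspan BrM"
    then have "p \<in> mspan EF \<oplus> T"
      by (rule mspan_subset[rotated 2]) (use Br_EF in auto)
    then obtain q t where q: "q \<in> mspan EF" "t \<in> T" "p = q + t" by (rule plus_setsE)
    have "\<pi> p = \<pi> q" using q EM T_M pi_T pi_add[of q t] by auto
    then show "\<pi> p \<in> \<pi> ` mspan EF" using q by auto
  qed
  have gens: "\<pi> (mon u) \<in> carrier (derived G)" if "u \<in> EF" for u
    using that
  proof (induction u)
    case (Gen g)
    then consider i where "i \<in> S" "g = EG i" | i where "i \<in> S" "g = FG i" by auto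
    then show ?case
    proof cases
      case (1 i)
      then obtain x where x: "\<alpha> i x \<noteq> 0" using alpha_nonzero by blast
      have "\<pi> (mon (Gen (HG x))) \<in> carrier G" "gE \<pi> i \<in> carrier G"
        using 1 by (auto simp: carrier_G gE_def gvar_def)
      then have "smul G (\<alpha> i x) (gE \<pi> i) \<in> carrier (derived G)"
        using brk_derived brk_HE[OF 1(1), of x] by metis
      then have "smul G (inverse (\<alpha> i x)) (smul G (\<alpha> i x) (gE \<pi> i)) \<in> carrier (derived G)"
        by (rule g.subspace_scale[OF subspace_derived])
      then show ?thesis using 1 x by (simp add: gE_def gvar_def)
    next
      case (2 i)
      then obtain x where x: "\<alpha> i x \<noteq> 0" using alpha_nonzero by blast
      have "\<pi> (mon (Gen (HG x))) \<in> carrier G" "gF \<pi> i \<in> carrier G"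
        using 2 by (auto simp: carrier_G gF_def gvar_def)
      then have "- smul G (\<alpha> i x) (gF \<pi> i) \<in> carrier (derived G)"
        using brk_derived brk_HF[OF 2(1), of x] by metis
      then have "- (- smul G (\<alpha> i x) (gF \<pi> i)) \<in> carrier (derived G)"
        by (rule g.subspace_neg[OF subspace_derived])
      then have "smul G (inverse (\<alpha> i x)) (smul G (\<alpha> i x) (gF \<pi> i)) \<in> carrier (derived G)"
        unfolding minus_minus by (rule g.subspace_scale[OF subspace_derived])
      then show ?thesis using 2 x by (simp add: gF_def gvar_def)
    qed
  next
    case (Br u v)
    then have "\<pi> (mon u) \<in> carrier G" "\<pi> (mon v) \<in> carrier G" using carrier_derived_sub by auto
    moreover have uv: "u \<in> M" "v \<in> M" using Br.prems EF_M by auto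
    ultimately show ?case using brk_derived pi_brk_mon[OF uv] by metis
  qed
  show "\<pi> ` mspan EF \<subseteq> carrier (derived G)"
  proof clarify
    fix p :: "('i, 'h) gen mono \<Rightarrow>\<^sub>0 'k" assume "p \<in> mspan EF"
    then show "\<pi> p \<in> carrier (derived G)"
    proof (induction rule: mspan_induct)
      case zero
      then show ?case using g.subspace_0[OF subspace_derived] by simp
    next
      case (single c u)
      then show ?case using gens[of u] EF_M pi_single[of u c] g.subspace_scale[OF subspace_derived] by auto
    next
      case (add p q)
      then have "p \<in> mspan M" "q \<in> mspan M" using EM by blast+
      then show ?case using add pi_add[of p q] g.subspace_add[OF subspace_derived] by simp
    qed
  qed
qed

lemma part_derived_EF: "part (derived G) a = \<pi> ` mspan {u \<in> EF. mono_par par u = a}"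
proof
  show "part (derived G) a \<subseteq> \<pi> ` mspan {u \<in> EF. mono_par par u = a}"
  proof
    fix x assume "x \<in> part (derived G) a"
    then have x: "x \<in> part G a" "x \<in> carrier (derived G)" by (auto simp: part_derived')
    then obtain p where p: "p \<in> mspan EF" "x = \<pi> p" unfolding carrier_derived_EF by blast
    then show "x \<in> \<pi> ` mspan {u \<in> EF. mono_par par u = a}"
      using pres_part(1)[of p a] x pres_mspan[OF p(1)] mspan_mono[OF EF_M p(1)] by auto
  qed
  show "\<pi> ` mspan {u \<in> EF. mono_par par u = a} \<subseteq> part (derived G) a"
  proof clarify
    fix p :: "('i, 'h) gen mono \<Rightarrow>\<^sub>0 'k" assume p: "p \<in> mspan {u \<in> EF. mono_par par u = a}"
    have "p \<in> Pt a" by (rule mspan_mono[OF _ p]) (use EF_M in auto)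
    moreover have "p \<in> mspan EF" by (rule mspan_mono[OF _ p]) auto
    ultimately show "\<pi> p \<in> part (derived G) a" by (auto simp: part_derived' carrier_derived_EF pi_Pt)
  qed
qed

end

section \<open>The Cartan subalgebra embeds\<close>

lemma vector_space_mult: "vector_space ((*) :: 'k::field \<Rightarrow> 'k \<Rightarrow> 'k)"
  by unfold_locales (auto simp: algebra_simps)

context chevalley_data
begin

text \<open>\<open>g~(A)\<close> acts on the dual of the tensor algebra with basis the words in \<open>S\<close>: this is minus
  the transpose of the Verma-type module on which \<open>FG i\<close> prepends the letter \<open>i\<close>.\<close>

definition act_weight :: "('h \<Rightarrow> 'k) \<Rightarrow> 'h \<Rightarrow> 'i list \<Rightarrow> 'k" where
  "act_weight \<mu> x w = \<mu> x - (\<Sum>k\<leftarrow>w. if k \<in> S then \<alpha> k x else 0)"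

text \<open>The value of \<phi> at e_i applied to the word w in the module of highest weight \<mu>:
  e_i kills the empty word, and e_i f_j w = f_j e_i w, plus h_i w when i = j.\<close>

primrec raise :: "('h \<Rightarrow> 'k) \<Rightarrow> 'i \<Rightarrow> 'i list \<Rightarrow> ('i list \<Rightarrow> 'k) \<Rightarrow> 'k" where
  "raise \<mu> i [] \<phi> = 0"
| "raise \<mu> i (j # w) \<phi> = raise \<mu> i w (\<lambda>v. \<phi> (j # v)) + (if i = j then act_weight \<mu> (h i) w * \<phi> w else 0)"

primrec act_gen :: "('h \<Rightarrow> 'k) \<Rightarrow> ('i, 'h) gen \<Rightarrow> ('i list \<Rightarrow> 'k) \<Rightarrow> 'i list \<Rightarrow> 'k" where
  "act_gen \<mu> (HG x) \<phi> = (\<lambda>w. - (act_weight \<mu> x w * \<phi> w))"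
| "act_gen \<mu> (EG i) \<phi> = (\<lambda>w. - raise \<mu> i w \<phi>)"
| "act_gen \<mu> (FG i) \<phi> = (\<lambda>w. - \<phi> (i # w))"

primrec act_mono :: "('h \<Rightarrow> 'k) \<Rightarrow> ('i, 'h) gen mono \<Rightarrow> ('i list \<Rightarrow> 'k) \<Rightarrow> 'i list \<Rightarrow> 'k" where
  "act_mono \<mu> (Gen g) \<phi> = act_gen \<mu> g \<phi>"
| "act_mono \<mu> (Br u v) \<phi> = (\<lambda>w. act_mono \<mu> u (act_mono \<mu> v \<phi>) w - act_mono \<mu> v (act_mono \<mu> u \<phi>) w)"

definition act :: "('h \<Rightarrow> 'k) \<Rightarrow> (('i, 'h) gen mono \<Rightarrow>\<^sub>0 'k) \<Rightarrow> ('i list \<Rightarrow> 'k) \<Rightarrow> 'i list \<Rightarrow> 'k" where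
  "act \<mu> p \<phi> w = lext (*) (\<lambda>u. act_mono \<mu> u \<phi> w) p"

lemma raise_linear: "raise \<mu> i w (\<lambda>v. a * \<phi> v + b * \<psi> v) = a * raise \<mu> i w \<phi> + b * raise \<mu> i w \<psi>"
proof (induction w arbitrary: \<phi> \<psi>)
  case (Cons j w)
  show ?case
    unfolding raise.simps Cons.IH[of "\<lambda>v. \<phi> (j # v)" "\<lambda>v. \<psi> (j # v)"] by (simp add: algebra_simps)
qed simp

lemma act_mono_linear:
  "act_mono \<mu> u (\<lambda>v. a * \<phi> v + b * \<psi> v) = (\<lambda>w. a * act_mono \<mu> u \<phi> w + b * act_mono \<mu> u \<psi> w)"
proof (induction u arbitrary: \<phi> \<psi>)
  case (Gen g)
  then show ?case by (cases g) (auto simp: raise_linear algebra_simps)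
next
  case (Br u v)
  then show ?case by (simp add: algebra_simps)
qed

text \<open>The transposed form of [x,e_i] = \<alpha>_i(x) e_i. A free constant c replaces
  \<open>\<mu> x\<close> because the induction shifts it by the weight of the removed first
  letter.\<close>

lemma raise_weight:
  assumes "i \<in> S"
  shows "raise \<mu> i w (\<lambda>v. (c - (\<Sum>k\<leftarrow>v. if k \<in> S then \<alpha> k x else 0)) * \<phi> v)
    = (c - (\<Sum>k\<leftarrow>w. if k \<in> S then \<alpha> k x else 0) + \<alpha> i x) * raise \<mu> i w \<phi>"
proof (induction w arbitrary: c \<phi>)
  case Nil
  then show ?case by simp
next
  case (Cons j w)
  let ?\<alpha> = "\<lambda>k. if k \<in> S then \<alpha> k x else 0"
  have e: "c - (\<Sum>k\<leftarrow>j # v. ?\<alpha> k) = (c - ?\<alpha> j) - (\<Sum>k\<leftarrow>v. ?\<alpha> k)" for v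
    by (simp add: algebra_simps)
  have "raise \<mu> i w (\<lambda>v. (c - (\<Sum>k\<leftarrow>j # v. ?\<alpha> k)) * \<phi> (j # v))
      = (c - ?\<alpha> j - (\<Sum>k\<leftarrow>w. ?\<alpha> k) + \<alpha> i x) * raise \<mu> i w (\<lambda>v. \<phi> (j # v))"
    unfolding e by (rule Cons.IH)
  then show ?case using assms by (auto simp: algebra_simps)
qed

lemma act_lin [simp]:
  "act \<mu> (p + q) \<phi> w = act \<mu> p \<phi> w + act \<mu> q \<phi> w" "act \<mu> (p - q) \<phi> w = act \<mu> p \<phi> w - act \<mu> q \<phi> w"
  "act \<mu> (pscale c p) \<phi> w = c * act \<mu> p \<phi> w" "act \<mu> 0 \<phi> w = 0"
  "act \<mu> (single u c) \<phi> w = c * act_mono \<mu> u \<phi> w"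
  unfolding act_def
  by (simp_all add: vector_space.lext_add[OF vector_space_mult] vector_space.lext_diff[OF vector_space_mult]
     vector_space.lext_scale[OF vector_space_mult] vector_space.lext_zero[OF vector_space_mult]
     vector_space.lext_single[OF vector_space_mult])

lemma act_linear: "act \<mu> p (\<lambda>v. a * \<phi> v + b * \<psi> v) w = a * act \<mu> p \<phi> w + b * act \<mu> p \<psi> w"
proof -
  have "p \<in> mspan UNIV" by simp
  then show ?thesis
    by (induction rule: mspan_induct) (auto simp: act_mono_linear algebra_simps)
qed

lemma act_mono_sum: "act_mono \<mu> u (\<lambda>v. \<phi> v + \<psi> v) = (\<lambda>w. act_mono \<mu> u \<phi> w + act_mono \<mu> u \<psi> w)"
  "act_mono \<mu> u (\<lambda>v. c * \<phi> v) = (\<lambda>w. c * act_mono \<mu> u \<phi> w)"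
  "act_mono \<mu> u (\<lambda>v. 0) = (\<lambda>w. 0)"
  using act_mono_linear[of \<mu> u 1 \<phi> 1 \<psi>] act_mono_linear[of \<mu> u c \<phi> 0 \<psi>] act_mono_linear[of \<mu> u 0 \<phi> 0 \<psi>] by simp_all

lemma act_sum: "act \<mu> p (\<lambda>v. \<phi> v + \<psi> v) w = act \<mu> p \<phi> w + act \<mu> p \<psi> w"
  "act \<mu> p (\<lambda>v. \<phi> v - \<psi> v) w = act \<mu> p \<phi> w - act \<mu> p \<psi> w"
  "act \<mu> p (\<lambda>v. c * \<phi> v) w = c * act \<mu> p \<phi> w"
  "act \<mu> p (\<lambda>v. 0) w = 0"
  using act_linear[of \<mu> p 1 \<phi> 1 \<psi>] act_linear[of \<mu> p 1 \<phi> "- 1" \<psi>] act_linear[of \<mu> p c \<phi> 0 \<psi>]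
    act_linear[of \<mu> p 0 \<phi> 0 \<psi>] by simp_all

lemma act_fbr: "act \<mu> (fbr p q) \<phi> w = act \<mu> p (act \<mu> q \<phi>) w - act \<mu> q (act \<mu> p \<phi>) w"
proof -
  have 1: "act \<mu> (fbr (mon u) q) \<phi> w = act \<mu> (mon u) (act \<mu> q \<phi>) w - act \<mu> q (act \<mu> (mon u) \<phi>) w" for u q \<phi> w
  proof -
    have [simp]: "act \<mu> (p + q) \<phi> = (\<lambda>w. act \<mu> p \<phi> w + act \<mu> q \<phi> w)"
      "act \<mu> (single u c) \<phi> = (\<lambda>w. c * act_mono \<mu> u \<phi> w)" "act \<mu> 0 \<phi> = (\<lambda>w. 0)" for p q u c \<phi>
      by (auto simp: fun_eq_iff)
    have "q \<in> mspan UNIV" by simp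
    then show ?thesis
      by (induction arbitrary: \<phi> w rule: mspan_induct)
        (auto simp: bilinear_ext_simps act_mono_sum act_sum algebra_simps)
  qed
  have [simp]: "act \<mu> (p + q) \<phi> = (\<lambda>w. act \<mu> p \<phi> w + act \<mu> q \<phi> w)"
    "act \<mu> (single u c) \<phi> = (\<lambda>w. c * act_mono \<mu> u \<phi> w)" "act \<mu> 0 \<phi> = (\<lambda>w. 0)" for p q u c \<phi>
    by (auto simp: fun_eq_iff)
  have "p \<in> mspan UNIV" by simp
  then show ?thesis
  proof (induction arbitrary: \<phi> w rule: mspan_induct)
    case (single c u)
    have "fbr (single u c) q = pscale c (fbr (mon u) q)"
      using bilinear_ext_scale_left[of _ c "mon u" q] by simp
    then show ?case by (simp add: 1 act_sum algebra_simps)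
  qed (auto simp: bilinear_ext_simps act_sum algebra_simps)
qed

text \<open>If x were nonzero, some functional \<mu> would have value 1 at x, and x would act
  nontrivially on the module with parameter \<mu>, although T acts by zero. With all parities even,
  plain commutators verify the Lie relators and the odd part contains only 0.\<close>

lemma HG_injective:
  assumes even: "\<And>i. \<not> par i" and V: "vector_space sH"
    and lin: "\<And>j. j \<in> S \<Longrightarrow> Vector_Spaces.linear sH (*) (\<alpha> j)"
    and x: "mon (Gen (HG x)) \<in> C"
  shows "x = 0"
proof (rule ccontr)
  assume "x \<noteq> 0"
  interpret H: vector_space sH by fact
  have HK: "vector_space_pair sH ((*) :: 'k \<Rightarrow> 'k \<Rightarrow> 'k)"
    by (intro vector_space_pair.intro V vector_space_mult)
  have "\<exists>g. Vector_Spaces.linear sH (*) g \<and> (\<forall>z\<in>{x}. g z = (1::'k))"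
    by (rule vector_space_pair.linear_independent_extend[OF HK]) (use \<open>x \<noteq> 0\<close> in simp)
  then obtain \<mu> where \<mu>: "Vector_Spaces.linear sH (*) \<mu>" "\<mu> x = (1::'k)" by auto
  have lin_add: "f (x + y) = f x + f y" and lin_scale: "f (sH c x) = c * f x"
    if "Vector_Spaces.linear sH (*) f" for f :: "'h \<Rightarrow> 'k" and x y c
    using that by (auto simp: Vector_Spaces.linear_def module_hom_def module_hom_axioms_def)
  \<comment> \<open>Linearity of \<open>\<alpha> j\<close> is given only for j in S; letters outside
    S contribute nothing to \<open>act_weight\<close>, so it is linear on all words.\<close>
  have w_add: "act_weight \<mu> (x + y) w = act_weight \<mu> x w + act_weight \<mu> y w"
    and w_scale: "act_weight \<mu> (sH c x) w = c * act_weight \<mu> x w" for x y w c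
    using lin by (induction w) (auto simp: act_weight_def lin_add[OF \<mu>(1)] lin_scale[OF \<mu>(1)] lin_add lin_scale algebra_simps)
  define J where "J = {p \<in> mspan M. \<forall>\<phi> w. act \<mu> p \<phi> w = 0}"
  have J0: "act \<mu> p \<phi> = (\<lambda>w. 0)" if "p \<in> J" for p \<phi> using that by (auto simp: J_def)
  have par_even: "\<not> mono_par par u" for u :: "('i, 'h) gen mono"
  proof (induction u)
    case (Gen g) then show ?case using even by (cases g) auto
  qed auto
  then have odd0: "p = 0" if "p \<in> Pt True" for p
    using that by (intro poly_mapping_eqI) (auto simp: mspan_iff)
  have ideal: "ideal L J"
    unfolding ideal_free_iff
  proof (intro conjI ballI)
    show "pm.subspace J"
      by (rule pm.subspaceI) (auto simp: J_def pm.subspace_0 intro: mspan_add mspan_scale)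
    show "fbr p q \<in> J" "fbr q p \<in> J" if "p \<in> mspan M" "q \<in> J" for p q
      using that J0[OF that(2)] fbr_mspan[of p "generators S" q] fbr_mspan[of q "generators S" p]
      by (auto simp: J_def act_fbr act_sum)
  qed (auto simp: J_def)
  have "r \<in> J" if r: "r \<in> lie_relators L" for r
  proof -
    have "act \<mu> r \<phi> w = 0" for \<phi> w
      using r unfolding lie_relators_L
    proof (elim UnE)
      assume "r \<in> {anti_rel a b x y | a b x y. x \<in> Pt a \<and> y \<in> Pt b}"
      then obtain a b p q where *: "r = anti_rel a b p q" "p \<in> Pt a" "q \<in> Pt b" by blast
      show ?thesis
      proof (cases "a \<and> b")
        case True
        then have "p = 0" using *(2) by (intro odd0) simp
        then show ?thesis using * by (simp add: anti_rel_def bilinear_ext_simps)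
      next
        case False
        then show ?thesis using * by (auto simp: anti_rel_def koszul_def act_fbr)
      qed
    next
      assume "r \<in> {jac_rel a b x y z | a b c x y z. x \<in> Pt a \<and> y \<in> Pt b \<and> z \<in> Pt c}"
      then obtain a b c p q s where *: "r = jac_rel a b p q s" "p \<in> Pt a" "q \<in> Pt b" by blast
      show ?thesis
      proof (cases "a \<and> b")
        case True
        then have "p = 0" using *(2) by (intro odd0) simp
        then show ?thesis using * by (simp add: jac_rel_def bilinear_ext_simps)
      next
        case False
        have f: "act \<mu> (fbr p q) \<phi> = (\<lambda>w. act \<mu> p (act \<mu> q \<phi>) w - act \<mu> q (act \<mu> p \<phi>) w)" for p q \<phi>
          by (auto simp: act_fbr)
        from False show ?thesis using * by (auto simp: jac_rel_def koszul_def act_fbr f act_sum)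
      qed
    next
      assume "r \<in> {fbr x (fbr x x) | x. x \<in> Pt True}"
      then obtain p where "r = fbr p (fbr p p)" "p \<in> Pt True" by blast
      then show ?thesis using odd0[of p] by (simp add: bilinear_ext_simps)
    qed
    then show ?thesis using r Rel_M by (auto simp: J_def)
  qed
  moreover have "r \<in> J" if r: "r \<in> chevalley_relators S par sH h \<alpha>" for r
  proof -
    have a_raise: "raise \<mu> i w (\<lambda>v. - (act_weight \<mu> x v * \<phi> v)) = - ((act_weight \<mu> x w + \<alpha> i x) * raise \<mu> i w \<phi>)"
      if "i \<in> S" for i w x \<phi>
      using raise_linear[of \<mu> i w "- 1" "\<lambda>v. act_weight \<mu> x v * \<phi> v" 0 "\<lambda>_. 0"] raise_weight[OF that, of \<mu> w "\<mu> x" x \<phi>]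
      by (simp add: act_weight_def)
    have b_raise: "raise \<mu> i w (\<lambda>v. - \<phi> v) = - raise \<mu> i w \<phi>" for i w \<phi>
      using raise_linear[of \<mu> i w "- 1" \<phi> 0 "\<lambda>_. 0"] by simp
    have aw_Cons: "act_weight \<mu> x (j # w) = act_weight \<mu> x w - \<alpha> j x" if "j \<in> S" for x j w
      using that by (simp add: act_weight_def)
    have a: "act \<mu> (mon (Gen (HG (x + y))) - mon (Gen (HG x)) - mon (Gen (HG y))) \<phi> w = 0" for x y \<phi> w
      by (simp add: w_add algebra_simps)
    have b: "act \<mu> (mon (Gen (HG (sH c x))) - pscale c (mon (Gen (HG x)))) \<phi> w = 0" for c x \<phi> w
      by (simp add: w_scale algebra_simps)
    have c: "act \<mu> (mon (Br (Gen (HG x)) (Gen (HG y)))) \<phi> w = 0" for x y \<phi> w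
      by (simp add: algebra_simps)
    have d: "act \<mu> (mon (Br (Gen (HG x)) (Gen (EG j))) - pscale (\<alpha> j x) (mon (Gen (EG j)))) \<phi> w = 0"
      if j: "j \<in> S" for x j \<phi> w
      by (simp add: a_raise[OF j]) (simp add: algebra_simps)
    have e: "act \<mu> (mon (Br (Gen (HG x)) (Gen (FG j))) + pscale (\<alpha> j x) (mon (Gen (FG j)))) \<phi> w = 0"
      if j: "j \<in> S" for x j \<phi> w
      by (simp add: aw_Cons[OF j] algebra_simps)
    have f: "act \<mu> (mon (Br (Gen (EG i)) (Gen (FG j))) - (if i = j then mon (Gen (HG (h i))) else 0)) \<phi> w = 0"
      if "i \<in> S" "j \<in> S" for i j \<phi> w
      by (simp add: b_raise)
    have "chevalley_relators S par sH h \<alpha> \<subseteq> {r. \<forall>\<phi> w. act \<mu> r \<phi> w = 0}"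
      unfolding chevalley_relators_L
      by (intro Un_least subsetI CollectI allI; elim CollectE exE conjE; hypsubst; (rule a b c d e f); assumption?)
    then have "act \<mu> r \<phi> w = 0" for \<phi> w using r by blast
    then show ?thesis using r Rel_M by (auto simp: J_def)
  qed
  ultimately have "T \<subseteq> J" using ideal by (intro T_minimal) auto
  then have "mon (Gen (HG x)) \<in> J" using C_HG[OF x] by (rule subsetD)
  \<comment> \<open>At the empty word, x sends the constant function 1 to -\<mu>(x) = -1.\<close>
  then have "act \<mu> (mon (Gen (HG x))) (\<lambda>_. 1) [] = 0" unfolding J_def by blast
  then show False using \<mu> by (simp add: act_weight_def)
qed

end


section \<open>Semisimplification\<close>

definition block_length :: "bool \<Rightarrow> nat" where
  "block_length a = (if a then 2 else 1)"

lemma block_length_simps [simp]: "block_length True = 2" "block_length False = 1"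
  by (simp_all add: block_length_def)

text \<open>A Lie algebra in Rep \<alpha>_3: brackets obey the identities without signs, t is a
  derivation, and the vanishing of its cube is contained in the bound 3 on the block
  lengths.\<close>

locale jordan_lie =
  fixes L :: "('k::field, 'v::ab_group_add) superalg" and t :: "'v \<Rightarrow> 'v" and B :: "'v list set"
  assumes superalgebra_L: "superalgebra L"
    and antisym: "\<And>x y. x \<in> carrier L \<Longrightarrow> y \<in> carrier L \<Longrightarrow> brk L y x = - brk L x y"
    and closed: "\<And>x y. x \<in> carrier L \<Longrightarrow> y \<in> carrier L \<Longrightarrow> brk L x y \<in> carrier L"
    and jacobi: "\<And>x y z. x \<in> carrier L \<Longrightarrow> y \<in> carrier L \<Longrightarrow> z \<in> carrier L \<Longrightarrow>
      brk L (brk L x y) z = brk L x (brk L y z) - brk L y (brk L x z)"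
    and t_closed: "\<And>x. x \<in> carrier L \<Longrightarrow> t x \<in> carrier L"
    and t_add: "\<And>x y. x \<in> carrier L \<Longrightarrow> y \<in> carrier L \<Longrightarrow> t (x + y) = t x + t y"
    and t_scale: "\<And>c x. x \<in> carrier L \<Longrightarrow> t (smul L c x) = smul L c (t x)"
    and t_brk: "\<And>x y. x \<in> carrier L \<Longrightarrow> y \<in> carrier L \<Longrightarrow> t (brk L x y) = brk L (t x) y + brk L x (t y)"
    and jordan: "jordan_decomposition L t B"
    and finite_B: "finite B"
    and char_3: "(3::'k) = 0"
begin

sublocale v: vector_space "smul L"
  using superalgebra_L by (rule superalgebraD)

abbreviation D :: "'v set" where "D \<equiv> carrier L"
abbreviation lie :: "'v \<Rightarrow> 'v \<Rightarrow> 'v" where "lie \<equiv> brk L"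
abbreviation Bs :: "'v set" where "Bs \<equiv> \<Union>b\<in>B. set b"
abbreviation coef :: "'v \<Rightarrow> 'v \<Rightarrow> 'k" where "coef \<equiv> v.representation Bs"

lemma subspace_D: "v.subspace D"
  using superalgebra_L by (rule carrier_subspace)

lemmas D_intros [simp] = closed t_closed v.subspace_add[OF subspace_D] v.subspace_diff[OF subspace_D]
  v.subspace_neg[OF subspace_D] v.subspace_scale[OF subspace_D] v.subspace_0[OF subspace_D]

lemma lie_add: "x \<in> D \<Longrightarrow> y \<in> D \<Longrightarrow> z \<in> D \<Longrightarrow> lie (x + y) z = lie x z + lie y z"
    "x \<in> D \<Longrightarrow> y \<in> D \<Longrightarrow> z \<in> D \<Longrightarrow> lie z (x + y) = lie z x + lie z y"
  and lie_scale: "x \<in> D \<Longrightarrow> y \<in> D \<Longrightarrow> lie (smul L c x) y = smul L c (lie x y)"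
    "x \<in> D \<Longrightarrow> y \<in> D \<Longrightarrow> lie x (smul L c y) = smul L c (lie x y)"
  using superalgebraD(5-8)[OF superalgebra_L] by auto

lemma lie_neg: "x \<in> D \<Longrightarrow> y \<in> D \<Longrightarrow> lie (- x) y = - lie x y" "x \<in> D \<Longrightarrow> y \<in> D \<Longrightarrow> lie x (- y) = - lie x y"
  using lie_scale(1)[of x y "- 1"] lie_scale(2)[of x y "- 1"] by simp_all

lemma lie_diff: "x \<in> D \<Longrightarrow> y \<in> D \<Longrightarrow> z \<in> D \<Longrightarrow> lie (x - y) z = lie x z - lie y z"
    "x \<in> D \<Longrightarrow> y \<in> D \<Longrightarrow> z \<in> D \<Longrightarrow> lie z (x - y) = lie z x - lie z y"
  using lie_add(1)[of x "- y" z] lie_add(2)[of x "- y" z] lie_neg by simp_all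

lemma lie_0: "x \<in> D \<Longrightarrow> lie 0 x = 0" "x \<in> D \<Longrightarrow> lie x 0 = 0"
  using lie_scale(1)[of 0 x 0] lie_scale(2)[of x 0 0] by simp_all

lemma t_0 [simp]: "t 0 = 0"
  using t_scale[of 0 0] by simp

lemma t_neg: "x \<in> D \<Longrightarrow> t (- x) = - t x"
  using t_scale[of x "- 1"] by simp

lemma t_diff: "x \<in> D \<Longrightarrow> y \<in> D \<Longrightarrow> t (x - y) = t x - t y"
  using t_add[of x "- y"] t_neg[of y] by simp

lemma t_sum: "(\<And>i. i \<in> I \<Longrightarrow> f i \<in> D) \<Longrightarrow> t (\<Sum>i\<in>I. f i) = (\<Sum>i\<in>I. t (f i))"
proof (induction I rule: infinite_finite_induct)
  case (insert x F)
  then show ?case by (simp add: t_add v.subspace_sum[OF subspace_D])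
qed auto

lemmas lin = lie_add lie_diff lie_neg lie_scale lie_0 t_add t_diff t_neg t_scale t_brk

lemma three: "x + x + x = (0::'v)"
proof -
  have "x + x + x = smul L 1 x + smul L 1 x + smul L 1 x" by simp
  also have "\<dots> = smul L (1 + 1 + 1) x" by (simp only: v.scale_left_distrib)
  also have "(1 + 1 + 1 :: 'k) = 0" using char_3 by simp
  finally show ?thesis by simp
qed

lemma block_length_cases: "b \<in> B \<Longrightarrow> length b = 1 \<or> length b = 2 \<or> length b = 3"
  using jordan by (auto simp: jordan_decomposition_def)

lemma basis_in_D [simp]: "b \<in> B \<Longrightarrow> m < length b \<Longrightarrow> b ! m \<in> D"
  using jordan v.span_base[of "b ! m" Bs] nth_mem by (auto simp: jordan_decomposition_def)

lemma independent: "v.independent Bs" and span_Bs: "v.span Bs = D"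
  using jordan by (auto simp: jordan_decomposition_def)

lemma t_basis: "b \<in> B \<Longrightarrow> m < length b \<Longrightarrow> t (b ! m) = (if Suc m < length b then b ! Suc m else 0)"
proof -
  assume b: "b \<in> B" "m < length b"
  show ?thesis
  proof (cases "Suc m < length b")
    case True then show ?thesis using jordan b by (auto simp: jordan_decomposition_def)
  next
    case False
    then have "b ! m = last b" using b last_conv_nth[of b] by (metis Suc_lessI diff_Suc_1 length_0_conv not_less0)
    then show ?thesis using False jordan b by (auto simp: jordan_decomposition_def)
  qed
qed

lemma basis_inj:
  assumes "b \<in> B" "c \<in> B" "m < length b" "k < length c" "b ! m = c ! k"
  shows "b = c \<and> m = k"
proof -
  have "inj_on (\<lambda>(b, m). b ! m) (SIGMA b:B. {..<length b})"
    using jordan by (simp add: jordan_decomposition_def)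
  from inj_onD[OF this, of "(b, m)" "(c, k)"] assms show ?thesis by auto
qed

lemma coef_add: "x \<in> D \<Longrightarrow> y \<in> D \<Longrightarrow> coef (x + y) v = coef x v + coef y v"
  and coef_scale: "x \<in> D \<Longrightarrow> coef (smul L c x) v = c * coef x v"
  and coef_diff: "x \<in> D \<Longrightarrow> y \<in> D \<Longrightarrow> coef (x - y) v = coef x v - coef y v"
  and coef_neg: "x \<in> D \<Longrightarrow> coef (- x) v = - coef x v"
  and coef_0: "coef 0 v = 0"
  using v.representation_add[OF independent, of y x] v.representation_scale[OF independent, of x c]
    v.representation_diff[OF independent, of y x] v.representation_neg[OF independent, of x]
    v.representation_zero[of Bs]
  by (auto simp: span_Bs)

lemma coef_basis:
  assumes "b \<in> B" "c \<in> B" "m < length b" "k < length c"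
  shows "coef (b ! m) (c ! k) = (if b = c \<and> m = k then 1 else 0)"
proof -
  have "b ! m \<in> Bs" using assms nth_mem by blast
  then have "coef (b ! m) (c ! k) = (if c ! k = b ! m then 1 else 0)"
    by (simp add: v.representation_basis[OF independent])
  then show ?thesis using basis_inj[OF assms] by auto
qed

lemma D_induct [consumes 1, case_names zero step]:
  assumes "x \<in> D" "P 0"
    "\<And>c b m y. b \<in> B \<Longrightarrow> m < length b \<Longrightarrow> y \<in> D \<Longrightarrow> P y \<Longrightarrow> P (smul L c (b ! m) + y)"
  shows "P x"
proof -
  have "x \<in> v.span Bs" using assms(1) span_Bs by simp
  then have "x \<in> D \<and> P x"
  proof (induction rule: v.span_induct_alt)
    case base
    then show ?case using assms(2) by simp
  next
    case (step c x y)
    then obtain b m where "b \<in> B" "m < length b" "x = b ! m" by (auto simp: in_set_conv_nth)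
    then show ?case using step assms(3) by simp
  qed
  then show ?thesis ..
qed

text \<open>t moves every basis vector one place down its block, so no block head occurs in the
  image of t.\<close>

lemma coef_t_0: "x \<in> D \<Longrightarrow> c \<in> B \<Longrightarrow> coef (t x) (c ! 0) = 0"
proof (induction rule: D_induct)
  case (step a b m y)
  have "0 < length c" using block_length_cases[OF \<open>c \<in> B\<close>] by auto
  then have "coef (t (b ! m)) (c ! 0) = 0"
    using step by (auto simp: t_basis coef_basis coef_0)
  then show ?case using step by (simp add: lin coef_add coef_scale)
qed (simp add: coef_0)

lemma coef_t_Suc: "x \<in> D \<Longrightarrow> c \<in> B \<Longrightarrow> Suc k < length c \<Longrightarrow> coef (t x) (c ! Suc k) = coef x (c ! k)"
proof (induction rule: D_induct)
  case (step a b m y)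
  have "coef (t (b ! m)) (c ! Suc k) = coef (b ! m) (c ! k)"
    using step by (auto simp: t_basis coef_basis coef_0)
  then show ?case using step by (simp add: lin coef_add coef_scale)
qed (simp add: coef_0)

lemma expansion: "x \<in> D \<Longrightarrow> x = (\<Sum>b\<in>B. \<Sum>m<length b. smul L (coef x (b ! m)) (b ! m))"
proof (induction rule: D_induct)
  case zero
  show ?case by (simp add: coef_0)
next
  case (step a b m y)
  have "(\<Sum>c\<in>B. \<Sum>k<length c. smul L (coef (b ! m) (c ! k)) (c ! k))
      = (\<Sum>c\<in>B. \<Sum>k<length c. if c = b \<and> k = m then b ! m else 0)"
    using step by (intro sum.cong refl) (auto simp: coef_basis)
  also have "\<dots> = (\<Sum>c\<in>B. if c = b then (\<Sum>k<length b. if k = m then b ! m else 0) else 0)"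
    by (intro sum.cong refl) auto
  also have "\<dots> = b ! m" using step finite_B by simp
  finally have "(\<Sum>c\<in>B. \<Sum>k<length c. smul L (coef (b ! m) (c ! k)) (c ! k)) = b ! m" .
  then have "smul L a (b ! m) = (\<Sum>c\<in>B. \<Sum>k<length c. smul L (coef (smul L a (b ! m)) (c ! k)) (c ! k))"
    using step(1,2) by (simp add: coef_scale flip: v.scale_scale v.scale_sum_right del: v.scale_scale)
  then have "smul L a (b ! m) + y
    = (\<Sum>c\<in>B. \<Sum>k<length c. smul L (coef (smul L a (b ! m)) (c ! k)) (c ! k))
      + (\<Sum>c\<in>B. \<Sum>k<length c. smul L (coef y (c ! k)) (c ! k))"
    using step.IH by (rule arg_cong2)
  then show ?case
    using step by (simp add: coef_add v.scale_left_distrib sum.distrib)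
qed

abbreviation blocks :: "bool \<Rightarrow> 'v list set" where "blocks a \<equiv> {b \<in> B. length b = block_length a}"

text \<open>\<open>pr a\<close> induces an isomorphism of \<open>K a\<close> modulo \<open>im t\<close> (and modulo \<open>ker t\<close> for odd \<open>a\<close>) onto the
  part of parity \<open>a\<close> of the semisimplification, and \<open>Bk\<close> induces its bracket. This describes the
  semisimplification independently of the chosen Jordan blocks.\<close>

definition pr :: "bool \<Rightarrow> 'v \<Rightarrow> ('v list \<Rightarrow>\<^sub>0 'k)" where
  "pr a x = (\<Sum>c\<in>blocks a. single c (coef x (c ! 0)))"

text \<open>A linear section of \<open>pr\<close>, choosing the head of each block as
  representative.\<close>

definition lift :: "('v list \<Rightarrow>\<^sub>0 'k) \<Rightarrow> 'v" where
  "lift = lext (smul L) (\<lambda>b. b ! 0)"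

definition K :: "bool \<Rightarrow> 'v set" where
  "K a = {x \<in> D. (if a then t (t x) else t x) = 0}"

definition Bk :: "bool \<Rightarrow> bool \<Rightarrow> 'v \<Rightarrow> 'v \<Rightarrow> 'v" where
  "Bk a b x y = (if a \<and> b then - lie x (t y) + lie (t x) y else lie x y)"

abbreviation bar :: "('k, 'v list \<Rightarrow>\<^sub>0 'k) superalg" where "bar \<equiv> semisimplification L B"

lemma bar_simps [simp]: "smul bar = pscale"
  by (simp add: semisimplification_def)

lemma part_bar: "part bar a = mspan (blocks a)"
  by (auto simp: part_def semisimplification_def mspan_def)

lemma pr_in_part: "pr a x \<in> part bar a"
  unfolding part_bar pr_def by (intro mspan_sum) auto

lemma pr_add: "x \<in> D \<Longrightarrow> y \<in> D \<Longrightarrow> pr a (x + y) = pr a x + pr a y"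
  and pr_diff: "x \<in> D \<Longrightarrow> y \<in> D \<Longrightarrow> pr a (x - y) = pr a x - pr a y"
  and pr_neg: "x \<in> D \<Longrightarrow> pr a (- x) = - pr a x"
  and pr_scale: "x \<in> D \<Longrightarrow> pr a (smul L c x) = pscale c (pr a x)"
  and pr_0 [simp]: "pr a 0 = 0"
  by (simp_all add: pr_def coef_add coef_diff coef_neg coef_scale coef_0 single_add single_diff
      single_uminus sum.distrib sum_subtractf sum_negf pm.scale_sum_right)

lemma pr_t: "x \<in> D \<Longrightarrow> pr a (t x) = 0"
  by (simp add: pr_def coef_t_0)

text \<open>The coefficient of x at the head of a block of length 2 reappears as the coefficient of
  t x at its second vector.\<close>

lemma pr_True_kernel: "x \<in> K False \<Longrightarrow> pr True x = 0"
  unfolding pr_def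
proof (intro sum.neutral ballI)
  fix c assume x: "x \<in> K False" and c: "c \<in> blocks True"
  then have "coef (t x) (c ! Suc 0) = coef x (c ! 0)" by (intro coef_t_Suc) (auto simp: K_def)
  moreover have "t x = 0" using x by (simp add: K_def)
  ultimately show "single c (coef x (c ! 0)) = 0" by (simp add: coef_0)
qed

lemma pr_basis: "b \<in> blocks a \<Longrightarrow> pr a (b ! 0) = mon b"
proof -
  assume b: "b \<in> blocks a"
  have "pr a (b ! 0) = (\<Sum>c\<in>blocks a. if c = b then mon b else 0)"
    unfolding pr_def using b by (intro sum.cong refl) (auto simp: coef_basis block_length_def split: if_splits)
  then show ?thesis using b finite_B by simp
qed

lemma lift_simps [simp]: "lift (p + q) = lift p + lift q" "lift (pscale c p) = smul L c (lift p)"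
  "lift (single b c) = smul L c (b ! 0)" "lift 0 = 0"
  by (simp_all add: lift_def)

lemma subspace_K: "v.subspace (K a)"
  by (rule v.subspaceI) (auto simp: K_def lin split: if_splits)

lemma K_D: "x \<in> K a \<Longrightarrow> x \<in> D"
  by (simp add: K_def)

lemma basis_K: "b \<in> blocks a \<Longrightarrow> b ! 0 \<in> K a"
  by (auto simp: K_def t_basis block_length_def split: if_splits)

lemma lift_K: "p \<in> part bar a \<Longrightarrow> lift p \<in> K a"
  unfolding part_bar lift_def by (rule v.lext_in_subspace[OF subspace_K basis_K])

lemma pr_lift: "p \<in> part bar a \<Longrightarrow> pr a (lift p) = p"
  unfolding part_bar
proof (induction rule: mspan_induct)
  case (single c b)
  then have "b ! 0 \<in> D" using basis_K K_D by blast
  then show ?case using single by (simp add: pr_scale pr_basis)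
next
  case (add p q)
  then have "lift p \<in> D" "lift q \<in> D" using lift_K[of _ a] K_D unfolding part_bar by blast+
  then show ?case using add by (simp add: pr_add)
qed simp

lemma lift_pr: "lift (pr a x) = (\<Sum>b\<in>B. if length b = block_length a then smul L (coef x (b ! 0)) (b ! 0) else 0)"
proof -
  have "lift (pr a x) = (\<Sum>b\<in>blocks a. smul L (coef x (b ! 0)) (b ! 0))"
    by (simp add: lift_def pr_def v.lext_sum)
  also have "\<dots> = (\<Sum>b\<in>B. if length b = block_length a then smul L (coef x (b ! 0)) (b ! 0) else 0)"
    using finite_B by (simp add: sum.inter_filter)
  finally show ?thesis .
qed

text \<open>An element of ker t is supported on the last vectors of the blocks. In a block of length
  at least 2 the last vector is t of its predecessor, and \<open>w\<close> collects these
  predecessors.\<close>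

lemma kernel_decomposition:
  assumes x: "x \<in> K False"
  shows "\<exists>v\<in>D. x = lift (pr False x) + t v"
proof -
  define w where "w b = (if length b = 1 then 0 else smul L (coef x (b ! (length b - 1))) (b ! (length b - 2)))" for b
  have xD: "x \<in> D" "t x = 0" using x by (auto simp: K_def)
  have wD: "w b \<in> D" if "b \<in> B" for b
    using block_length_cases[OF that] basis_in_D[OF that] by (auto simp: w_def)
  have c0: "coef x (b ! m) = 0" if "b \<in> B" "Suc m < length b" for b m
    using coef_t_Suc[OF xD(1) that] xD(2) by (simp add: coef_0)
  have "(\<Sum>m<length b. smul L (coef x (b ! m)) (b ! m))
     = (if length b = block_length False then smul L (coef x (b ! 0)) (b ! 0) else 0) + t (w b)" if b: "b \<in> B" for b
    using block_length_cases[OF b]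
    by (elim disjE) (simp_all add: w_def lin t_basis b c0 numeral_2_eq_2 numeral_3_eq_3 del: sum.lessThan_Suc add: lessThan_Suc)
  then have "x = (\<Sum>b\<in>B. (if length b = block_length False then smul L (coef x (b ! 0)) (b ! 0) else 0) + t (w b))"
    using expansion[OF xD(1)] by simp
  then have "x = lift (pr False x) + t (\<Sum>b\<in>B. w b)"
    using wD by (simp add: sum.distrib lift_pr t_sum)
  moreover have "(\<Sum>b\<in>B. w b) \<in> D" using wD by (rule v.subspace_sum[OF subspace_D])
  ultimately show ?thesis by blast
qed

text \<open>The condition t(t x) = 0 excludes exactly the heads of blocks of length 3. Blocks of
  length 1 contribute to k, heads of length 2 to the lift, and all remaining vectors are in the
  image of t.\<close>

lemma kernel_decomposition_odd:
  assumes x: "x \<in> K True"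
  shows "\<exists>k\<in>K False. \<exists>v\<in>D. x = lift (pr True x) + k + t v"
proof -
  define w where "w b = (if length b = 1 then 0 else if length b = 2 then smul L (coef x (b ! 1)) (b ! 0)
      else smul L (coef x (b ! 1)) (b ! 0) + smul L (coef x (b ! 2)) (b ! 1))" for b
  define k where "k b = (if length b = 1 then smul L (coef x (b ! 0)) (b ! 0) else 0)" for b
  have xD: "x \<in> D" "t (t x) = 0" using x by (auto simp: K_def)
  have wD: "w b \<in> D" if "b \<in> B" for b
    using block_length_cases[OF that] basis_in_D[OF that] by (auto simp: w_def)
  have kK: "k b \<in> K False" if "b \<in> B" for b
    using basis_K[of b False] that v.subspace_scale[OF subspace_K] v.subspace_0[OF subspace_K] by (auto simp: k_def)
  have c0: "coef x (b ! 0) = 0" if b: "b \<in> B" and l: "length b = 3" for b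
  proof -
    have "coef x (b ! 0) = coef (t x) (b ! Suc 0)" using coef_t_Suc[OF xD(1) b, of 0] l by simp
    also have "\<dots> = coef (t (t x)) (b ! Suc (Suc 0))" using coef_t_Suc[of "t x" b "Suc 0"] xD b l by simp
    finally show ?thesis using xD(2) by (simp add: coef_0)
  qed
  have "(\<Sum>m<length b. smul L (coef x (b ! m)) (b ! m))
     = (if length b = block_length True then smul L (coef x (b ! 0)) (b ! 0) else 0) + k b + t (w b)" if b: "b \<in> B" for b
    using block_length_cases[OF b]
  proof (elim disjE)
    assume l: "length b = 1"
    then show ?thesis by (simp add: w_def k_def)
  next
    assume l: "length b = 2"
    then show ?thesis by (simp add: w_def k_def lin t_basis b lessThan_Suc numeral_2_eq_2 add.commute)
  next
    assume l: "length b = 3"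
    then have "{..<length b} = {0, 1, 2}" by auto
    then show ?thesis using l c0[OF b l] by (simp add: w_def k_def lin t_basis b numeral_2_eq_2)
  qed
  then have "x = (\<Sum>b\<in>B. (if length b = block_length True then smul L (coef x (b ! 0)) (b ! 0) else 0) + k b + t (w b))"
    using expansion[OF xD(1)] by simp
  then have "x = lift (pr True x) + (\<Sum>b\<in>B. k b) + t (\<Sum>b\<in>B. w b)"
    using wD by (simp add: sum.distrib lift_pr t_sum)
  moreover have "(\<Sum>b\<in>B. w b) \<in> D" using wD by (rule v.subspace_sum[OF subspace_D])
  moreover have "(\<Sum>b\<in>B. k b) \<in> K False" using kK by (rule v.subspace_sum[OF subspace_K])
  ultimately show ?thesis by blast
qed

lemma Bk_D: "x \<in> D \<Longrightarrow> y \<in> D \<Longrightarrow> Bk a b x y \<in> D"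
  by (simp add: Bk_def)

lemma Bk_lin:
  "x \<in> D \<Longrightarrow> x' \<in> D \<Longrightarrow> y \<in> D \<Longrightarrow> Bk a b (x + x') y = Bk a b x y + Bk a b x' y"
  "x \<in> D \<Longrightarrow> y \<in> D \<Longrightarrow> y' \<in> D \<Longrightarrow> Bk a b x (y + y') = Bk a b x y + Bk a b x y'"
  "x \<in> D \<Longrightarrow> y \<in> D \<Longrightarrow> Bk a b (smul L c x) y = smul L c (Bk a b x y)"
  "x \<in> D \<Longrightarrow> y \<in> D \<Longrightarrow> Bk a b x (smul L c y) = smul L c (Bk a b x y)"
  "x \<in> D \<Longrightarrow> Bk a b 0 x = 0" "x \<in> D \<Longrightarrow> Bk a b x 0 = 0"
  by (simp_all add: Bk_def lin v.scale_right_distrib v.scale_right_diff_distrib)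

lemma Bk_swap: "x \<in> D \<Longrightarrow> y \<in> D \<Longrightarrow> Bk b a y x = (if a \<and> b then Bk a b x y else - Bk a b x y)"
  using antisym[of x y] antisym[of "t x" y] antisym[of x "t y"] by (auto simp: Bk_def)

text \<open>For two odd arguments the copies of [t x, t y] cancel under t, which explains the sign
  in \<open>Bk\<close>.\<close>

lemma Bk_K:
  assumes "x \<in> K a" "y \<in> K b" shows "Bk a b x y \<in> K (a \<noteq> b)"
  using assms by (cases a; cases b) (auto simp: K_def Bk_def lin)

lemma brk_bar_blocks:
  assumes a: "b \<in> blocks \<beta>" and b: "c \<in> blocks \<gamma>"
  shows "(\<Sum>d\<in>B. single d (structure_constant L B b c d)) = pr (\<beta> \<noteq> \<gamma>) (Bk \<beta> \<gamma> (b ! 0) (c ! 0))"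
proof -
  have t1: "b ! 1 = t (b ! 0)" if "\<beta>" using a that t_basis[of b 0] by simp
  have t2: "c ! 1 = t (c ! 0)" if "\<gamma>" using b that t_basis[of c 0] by simp
  have "structure_constant L B b c d = (if length d = block_length (\<beta> \<noteq> \<gamma>) then coef (Bk \<beta> \<gamma> (b ! 0) (c ! 0)) (d ! 0) else 0)"
    for d
    using a b t1 t2 by (cases \<beta>; cases \<gamma>) (auto simp: structure_constant_def Bk_def Let_def)
  then have "(\<Sum>d\<in>B. single d (structure_constant L B b c d))
     = (\<Sum>d\<in>B. if length d = block_length (\<beta> \<noteq> \<gamma>) then single d (coef (Bk \<beta> \<gamma> (b ! 0) (c ! 0)) (d ! 0)) else 0)"
    by (intro sum.cong) auto
  then show ?thesis unfolding pr_def using finite_B by (simp add: sum.inter_filter)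
qed

lemma brk_bar:
  assumes p: "p \<in> part bar a" and q: "q \<in> part bar b"
  shows "brk bar p q = pr (a \<noteq> b) (Bk a b (lift p) (lift q))"
proof -
  have brk: "brk bar = bilinear_ext (\<lambda>a b. \<Sum>c\<in>B. single c (structure_constant L B a b c))"
    by (simp add: semisimplification_def)
  have lD: "lift p \<in> D" if "p \<in> mspan (blocks a)" for p a
    using lift_K[of p a] that K_D unfolding part_bar by blast
  have 1: "brk bar (mon u) q = pr (a \<noteq> b) (Bk a b (u ! 0) (lift q))" if u: "u \<in> blocks a" for u
    using q unfolding part_bar
  proof (induction rule: mspan_induct)
    case zero
    then show ?case using basis_K[OF u] K_D by (simp add: brk bilinear_ext_simps Bk_lin)
  next
    case (single c w)
    have D: "u ! 0 \<in> D" "w ! 0 \<in> D" using basis_K[OF u] basis_K[OF single] K_D by blast+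
    then show ?case using brk_bar_blocks[OF u single]
      by (simp add: brk bilinear_ext_simps Bk_lin pr_scale Bk_D)
  next
    case (add q r)
    have "u ! 0 \<in> D" using basis_K[OF u] K_D by blast
    then show ?case using add lD[of q b] lD[of r b] by (simp add: brk bilinear_ext_simps Bk_lin pr_add Bk_D)
  qed
  have lq: "lift q \<in> D" using lD q part_bar by blast
  show ?thesis using p unfolding part_bar
  proof (induction rule: mspan_induct)
    case zero
    then show ?case using lq by (simp add: brk bilinear_ext_simps Bk_lin)
  next
    case (single c u)
    have "brk bar (single u c) q = pscale c (brk bar (mon u) q)"
      using bilinear_ext_scale_left[of _ c "mon u" q] by (simp add: brk)
    moreover have "u ! 0 \<in> D" using basis_K[OF single] K_D by blast
    ultimately show ?case using 1[OF single] lq by (simp add: Bk_lin pr_scale Bk_D)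
  next
    case (add q r)
    then show ?case using lq lD[of q a] lD[of r a] by (simp add: brk bilinear_ext_simps Bk_lin pr_add Bk_D)
  qed
qed

text \<open>In characteristic \<open>3\<close>, an element \<open>[t v, y]\<close> with \<open>t\<^sup>2 v = t\<^sup>2 y = 0\<close> lies in \<open>im t + ker t\<close>.\<close>

lemma pr_Bk_null:
  assumes n: "n \<in> K a" and y: "y \<in> K b" and k: "k \<in> K False" "a \<or> k = 0" and v: "v \<in> D" and e: "n = k + t v"
  shows "pr (a \<noteq> b) (Bk a b n y) = 0"
proof -
  have D: "n \<in> D" "y \<in> D" "k \<in> D" "v \<in> D" using n y k v K_D by auto
  show ?thesis
  proof (cases a; cases b)
    assume ab: "\<not> a" "\<not> b"
    then have "t y = 0" using y by (simp add: K_def)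
    then have "Bk a b n y = t (lie v y)" using ab k e D by (simp add: Bk_def lin)
    then show ?thesis using D by (simp add: pr_t)
  next
    assume ab: "\<not> a" "b"
    then have yv: "t (t y) = 0" "t (t v) = 0" "n = t v" using y n e k D by (auto simp: K_def)
    \<comment> \<open>Since -2 = 1, [t v, y] equals -t[v,y] minus the element [t v, y] - [v, t y];
      the latter is killed by t.\<close>
    have "lie (t v) y + lie (t v) y + lie (t v) y = 0" by (rule three)
    then have *: "lie (t v) y = - t (lie v y) - (lie (t v) y - lie v (t y))"
      using D by (simp add: lin algebra_simps add_eq_0_iff2)
    have "lie (t v) y - lie v (t y) \<in> K False" using D yv by (simp add: K_def lin)
    then have "pr True (lie (t v) y - lie v (t y)) = 0" by (rule pr_True_kernel)
    then have "pr True (lie (t v) y) = 0"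
      by (subst *) (use D in \<open>simp add: pr_diff pr_neg pr_t\<close>)
    then show ?thesis using ab yv by (simp add: Bk_def)
  next
    assume ab: "a" "\<not> b"
    then have "t y = 0" "t k = 0" using y k by (auto simp: K_def)
    then have 1: "lie k y \<in> K False" "t (lie v y) = lie (t v) y" using D by (auto simp: K_def lin)
    have "pr True (lie (t v) y) = 0" unfolding 1(2)[symmetric] using D by (simp add: pr_t)
    then show ?thesis using ab D 1(1) by (simp add: Bk_def e lie_add pr_add pr_True_kernel)
  next
    assume ab: "a" "b"
    then have yk: "t (t y) = 0" "t k = 0" using y k by (auto simp: K_def)
    \<comment> \<open>The second power of t on [v,y] produces 2[t v, t y], and 2 = -1 turns it into
      the odd bracket of t v with y.\<close>
    have "t (t (lie v y)) - (- lie (t v) (t y) + lie (t (t v)) y) = lie (t v) (t y) + lie (t v) (t y) + lie (t v) (t y)"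
      using D yk by (simp add: lin algebra_simps)
    then have 1: "- lie (t v) (t y) + lie (t (t v)) y = t (t (lie v y))" by (simp add: three)
    have "Bk a b n y = - t (lie k y) + (- lie (t v) (t y) + lie (t (t v)) y)"
      using ab D yk by (simp add: Bk_def e lin algebra_simps)
    also have "\<dots> = - t (lie k y) + t (t (lie v y))" by (simp only: 1)
    finally show ?thesis using D ab by (simp add: pr_add pr_diff pr_neg pr_t)
  qed
qed

lemma K_decomposition:
  assumes "x \<in> K a"
  shows "\<exists>k v. k \<in> K False \<and> (a \<or> k = 0) \<and> v \<in> D \<and> x = lift (pr a x) + (k + t v)"
proof (cases a)
  case True
  then show ?thesis using kernel_decomposition_odd assms by (auto simp: add.assoc) blast
next
  case False
  then obtain v where "v \<in> D" "x = lift (pr a x) + t v" using kernel_decomposition assms by auto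
  then show ?thesis using v.subspace_0[OF subspace_K] by (intro exI[of _ 0] exI[of _ v]) simp
qed

text \<open>Replacing x and y by the lifts of their classes changes \<open>Bk\<close> only by terms
  that \<open>pr_Bk_null\<close> annihilates, the second argument being reached through
  \<open>Bk_swap\<close>. Hence brackets may be computed on any representatives in K, without
  reference to the blocks.\<close>

lemma pr_Bk:
  assumes x: "x \<in> K a" and y: "y \<in> K b"
  shows "brk bar (pr a x) (pr b y) = pr (a \<noteq> b) (Bk a b x y)"
proof -
  let ?x = "lift (pr a x)" and ?y = "lift (pr b y)"
  have lK: "?x \<in> K a" "?y \<in> K b" by (rule lift_K[OF pr_in_part])+
  obtain k v where k: "k \<in> K False" "a \<or> k = 0" "v \<in> D" "x = ?x + (k + t v)"
    using K_decomposition[OF x] by blast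
  obtain k' v' where k': "k' \<in> K False" "b \<or> k' = 0" "v' \<in> D" "y = ?y + (k' + t v')"
    using K_decomposition[OF y] by blast
  have n: "x - ?x \<in> K a" "y - ?y \<in> K b" using x y lK by (auto intro: v.subspace_diff[OF subspace_K])
  have D: "?x \<in> D" "?y \<in> D" "x \<in> D" "y \<in> D" "x - ?x \<in> D" "y - ?y \<in> D"
    using lK x y n K_D by blast+
  have e: "x - ?x = k + t v" "y - ?y = k' + t v'" using k(4) k'(4) by (metis add_diff_cancel_left')+
  have 1: "pr (a \<noteq> b) (Bk a b (x - ?x) y) = 0"
    by (rule pr_Bk_null[OF n(1) y k(1-3) e(1)])
  have "pr (b \<noteq> a) (Bk b a (y - ?y) ?x) = 0"
    by (rule pr_Bk_null[OF n(2) lK(1) k'(1-3) e(2)])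
  then have 2: "pr (a \<noteq> b) (Bk a b ?x (y - ?y)) = 0"
    using Bk_swap[OF D(1) D(6), of b a] D by (auto simp: pr_neg Bk_D split: if_splits)
  have "Bk a b (?x + (x - ?x)) y = Bk a b ?x y + Bk a b (x - ?x) y"
    by (rule Bk_lin(1)[OF D(1,5,4)])
  moreover have "Bk a b ?x (?y + (y - ?y)) = Bk a b ?x ?y + Bk a b ?x (y - ?y)"
    by (rule Bk_lin(2)[OF D(1,2,6)])
  ultimately have "Bk a b x y = Bk a b ?x ?y + Bk a b ?x (y - ?y) + Bk a b (x - ?x) y" by simp
  then have "pr (a \<noteq> b) (Bk a b x y) = pr (a \<noteq> b) (Bk a b ?x ?y)"
    using D 1 2 by (simp add: pr_add Bk_D)
  then show ?thesis using brk_bar[OF pr_in_part pr_in_part] by simp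
qed

section \<open>Super antisymmetry and super Jacobi in the semisimplification\<close>

lemma carrier_bar: "carrier bar = mspan (blocks False \<union> blocks True)"
proof
  show "carrier bar \<subseteq> mspan (blocks False \<union> blocks True)"
    unfolding carrier_parts part_bar
    by (auto intro!: mspan_add elim: mspan_mono[rotated])
  show "mspan (blocks False \<union> blocks True) \<subseteq> carrier bar"
  proof
    fix p :: "'v list \<Rightarrow>\<^sub>0 'k" assume p: "p \<in> mspan (blocks False \<union> blocks True)"
    have "pres (\<lambda>b. length b = 1) p \<in> part bar False" "pres (\<lambda>b. length b \<noteq> 1) p \<in> part bar True"
      using p by (auto simp: part_bar mspan_iff lookup_pres split: if_splits)
    moreover have "p = pres (\<lambda>b. length b = 1) p + pres (\<lambda>b. length b \<noteq> 1) p"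
      by (rule poly_mapping_eqI) (simp add: lookup_add lookup_pres)
    ultimately show "p \<in> carrier bar" unfolding carrier_parts by blast
  qed
qed

lemma superalgebra_bar: "superalgebra bar"
  unfolding superalgebra_def
proof (intro conjI allI ballI)
  show "even_part bar \<inter> odd_part bar = {0}"
    using part_bar[of False] part_bar[of True]
    by (auto simp: part_def mspan_iff pm.subspace_0 intro!: poly_mapping_eqI)
  show "module.subspace (smul bar) (even_part bar)" "module.subspace (smul bar) (odd_part bar)"
    using part_bar[of False] part_bar[of True] by (auto simp: part_def)
  show "brk bar p q \<in> part bar (a \<noteq> b)" if "p \<in> part bar a" "q \<in> part bar b" for a b p q
    using brk_bar[OF that] pr_in_part by simp
qed (simp_all add: vector_space_pscale semisimplification_def bilinear_ext_simps)

lemma bar_antisym: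
  assumes p: "p \<in> part bar a" and q: "q \<in> part bar b"
  shows "brk bar p q + pscale (koszul a b) (brk bar q p) = 0"
proof -
  have D: "lift p \<in> D" "lift q \<in> D" using lift_K p q K_D by blast+
  have "pr (b \<noteq> a) (Bk b a (lift q) (lift p)) = (if a \<and> b then pr (a \<noteq> b) (Bk a b (lift p) (lift q)) else - pr (a \<noteq> b) (Bk a b (lift p) (lift q)))"
    using Bk_swap[OF D, of b a] D by (auto simp: pr_neg Bk_D)
  then show ?thesis using brk_bar[OF p q] brk_bar[OF q p] by (simp add: koszul_def)
qed

text \<open>On representatives the Jacobi defect is zero unless all three are odd. In that case it
  is t of [x,[y,z]] + [[x,y],z] up to multiples of 3, hence invisible to \<open>pr\<close>.\<close>

lemma bar_jacobi:
  assumes p: "p \<in> part bar a" and q: "q \<in> part bar b" and r: "r \<in> part bar c"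
  shows "brk bar p (brk bar q r) - brk bar (brk bar p q) r - pscale (koszul a b) (brk bar q (brk bar p r)) = 0"
proof -
  define x y z where xyz: "x = lift p" "y = lift q" "z = lift r"
  have K: "x \<in> K a" "y \<in> K b" "z \<in> K c" using lift_K p q r xyz by auto
  have e: "p = pr a x" "q = pr b y" "r = pr c z" using pr_lift p q r xyz by auto
  have D: "x \<in> D" "y \<in> D" "z \<in> D" using K K_D by auto
  let ?P = "pr (a \<noteq> (b \<noteq> c))"
  let ?J = "Bk a (b \<noteq> c) x (Bk b c y z) - Bk (a \<noteq> b) c (Bk a b x y) z - smul L (koszul a b) (Bk b (a \<noteq> c) y (Bk a c x z))"
  have s: "((a \<noteq> b) \<noteq> c) = (a \<noteq> (b \<noteq> c))" "(b \<noteq> (a \<noteq> c)) = (a \<noteq> (b \<noteq> c))" by auto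
  have "brk bar p (brk bar q r) - brk bar (brk bar p q) r - pscale (koszul a b) (brk bar q (brk bar p r))
    = ?P (Bk a (b \<noteq> c) x (Bk b c y z)) - ?P (Bk (a \<noteq> b) c (Bk a b x y) z) - pscale (koszul a b) (?P (Bk b (a \<noteq> c) y (Bk a c x z)))"
    unfolding e by (simp only: pr_Bk K Bk_K s)
  also have "\<dots> = ?P ?J" using D by (simp add: pr_diff pr_scale Bk_D)
  also have "?P ?J = 0"
  proof (cases "a \<and> b \<and> c")
    case False
    have "?J = 0"
      using False D K by (cases a; cases b; cases c) (auto simp: Bk_def koszul_def K_def lin jacobi)
    then show ?thesis by simp
  next
    case True
    let ?u = "lie x (lie y (t z))" and ?v = "lie (t x) (lie y z)" and ?w = "lie y (lie (t x) z)"
    have "?J = t (lie x (lie y z) + lie (lie x y) z) - (?u + ?u + ?u) - (?v + ?v + ?v) + (?w + ?w + ?w)"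
      using True D by (simp add: Bk_def koszul_def lin jacobi algebra_simps)
    then have "?J = t (lie x (lie y z) + lie (lie x y) z)" by (simp only: three diff_0_right add_0_right)
    then show ?thesis using D by (simp add: pr_t)
  qed
  finally show ?thesis .
qed

end


section \<open>Comparison of the two superalgebras\<close>

lemma lie_superalgebraD:
  assumes "lie_superalgebra L"
  shows "superalgebra L"
    "x \<in> part L a \<Longrightarrow> y \<in> part L b \<Longrightarrow> brk L x y + smul L (koszul a b) (brk L y x) = 0"
    "x \<in> part L a \<Longrightarrow> y \<in> part L b \<Longrightarrow> z \<in> part L c \<Longrightarrow>
      brk L x (brk L y z) - brk L (brk L x y) z - smul L (koszul a b) (brk L y (brk L x z)) = 0"
proof -
  show "superalgebra L" using assms by (simp add: lie_superalgebra_def)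
  have r: "r = 0" if "r \<in> lie_relators L" for r using that assms by (auto simp: lie_superalgebra_def)
  show "brk L x y + smul L (koszul a b) (brk L y x) = 0" if "x \<in> part L a" "y \<in> part L b"
    by (rule r) (unfold lie_relators_def, rule UnI1, rule UnI1, use that in blast)
  show "brk L x (brk L y z) - brk L (brk L x y) z - smul L (koszul a b) (brk L y (brk L x z)) = 0"
    if "x \<in> part L a" "y \<in> part L b" "z \<in> part L c"
    by (rule r) (unfold lie_relators_def, rule UnI1, rule UnI2, use that in blast)
qed

text \<open>The realizations of A and of A~ enter independently of each other; the two sides are
  matched only through the Chevalley generators indexed by S - I.\<close>

locale semisimplification_setup =
  G: contragredient_alg S "\<lambda>_. False" sH h \<alpha> A G \<pi> +
  H: contragredient_alg "S - I" "\<lambda>k. k \<in> nb ` I" sH' h' \<alpha>' "tilde_matrix A (nb ` I)" G' \<pi>'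
  for S :: "'i set" and I :: "'i set" and nb :: "'i \<Rightarrow> 'i" and A :: "'i \<Rightarrow> 'i \<Rightarrow> int"
    and sH :: "'k::field \<Rightarrow> 'h::ab_group_add \<Rightarrow> 'h" and h \<alpha>
    and G :: "('k, 'g::ab_group_add) superalg" and \<pi>
    and sH' :: "'k \<Rightarrow> 'h2::ab_group_add \<Rightarrow> 'h2" and h' \<alpha>'
    and G' :: "('k, 'g2::ab_group_add) superalg" and \<pi>' +
  fixes B :: "'g list set"
  assumes char_3: "(3::'k) = 0"
    and cartan: "cartan_matrix S (\<lambda>_. False) A"
    and fin: "finite_dimensional (smul G) (carrier G)"
    and adm: "admissible S A I nb"
    and decomp: "adapted_decomposition S h G \<pi> I nb B"
begin

lemma G_even: "carrier G = part G False"
proof -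
  have "\<not> mono_par (\<lambda>_. False) u" for u :: "('i, 'h) gen mono"
  proof (induction u)
    case (Gen g) then show ?case by (cases g) auto
  qed auto
  then show ?thesis by (simp add: G.part_G G.carrier_G)
qed

lemma D_G: "x \<in> carrier (derived G) \<Longrightarrow> x \<in> carrier G"
  using G.carrier_derived_sub by blast

lemma finite_I: "finite I" and I_S: "I \<subseteq> S"
  using adm G.finite_S finite_subset by (auto simp: admissible_def)

lemma antisym_G: "x \<in> carrier G \<Longrightarrow> y \<in> carrier G \<Longrightarrow> brk G y x = - brk G x y"
  using lie_superalgebraD(2)[OF G.lie_G, of x False y False]
  by (simp add: G_even koszul_def eq_neg_iff_add_eq_0 add.commute)

lemma jacobi_G: "x \<in> carrier G \<Longrightarrow> y \<in> carrier G \<Longrightarrow> z \<in> carrier G \<Longrightarrow>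
    brk G (brk G x y) z = brk G x (brk G y z) - brk G y (brk G x z)"
  using lie_superalgebraD(3)[OF G.lie_G, of x False y False z False]
  by (simp add: G_even koszul_def algebra_simps)

abbreviation "ee \<equiv> \<Sum>i\<in>I. gE \<pi> i"
abbreviation "ff \<equiv> \<Sum>i\<in>I. gF \<pi> i"

lemma gens_D: "k \<in> S \<Longrightarrow> gE \<pi> k \<in> carrier (derived G)" "k \<in> S \<Longrightarrow> gF \<pi> k \<in> carrier (derived G)"
  unfolding G.carrier_derived_EF gE_def gF_def gvar_def by (auto intro!: imageI)

lemma sums_D: "ee \<in> carrier (derived G)" "ff \<in> carrier (derived G)"
  using I_S gens_D by (auto intro!: G.g.subspace_sum[OF G.subspace_derived])

lemma jd: "jordan_decomposition (derived G) (ad_e G \<pi> I) B"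
  using decomp by (simp add: adapted_decomposition_def)

lemma finite_B: "finite B"
proof -
  let ?Bs = "\<Union>b\<in>B. set b"
  have i: "\<not> G.g.dependent ?Bs" and s: "G.g.span ?Bs = carrier (derived G)"
    using jd by (auto simp: jordan_decomposition_def)
  obtain X where X: "finite X" "carrier G \<subseteq> G.g.span X" using fin by (auto simp: finite_dimensional_def)
  have "?Bs \<subseteq> G.g.span X" using s G.g.span_superset[of ?Bs] D_G X(2) by blast
  then have "finite ?Bs" using G.g.independent_span_bound[OF X(1) i] by blast
  moreover have l: "0 < length b" if "b \<in> B" for b
    using jd that by (auto simp: jordan_decomposition_def)
  then have "(\<lambda>b. b ! 0) ` B \<subseteq> ?Bs" using nth_mem by fastforce
  moreover have "inj_on (\<lambda>b. b ! 0) B"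
  proof (rule inj_onI)
    fix b c assume bc: "b \<in> B" "c \<in> B" "b ! 0 = c ! 0"
    have "inj_on (\<lambda>(b, m). b ! m) (SIGMA b:B. {..<length b})"
      using jd by (simp add: jordan_decomposition_def)
    from inj_onD[OF this, of "(b, 0)" "(c, 0)"] bc l show "b = c" by auto
  qed
  ultimately show ?thesis using finite_subset finite_imageD by blast
qed

sublocale J: jordan_lie "derived G" "ad_e G \<pi> I" B
  rewrites "smul (derived G) = smul G" and "brk (derived G) = brk G"
proof -
  note l = superalgebraD[OF G.superalgebra_G]
  have e: "ee \<in> carrier G" using sums_D D_G by blast
  show "jordan_lie (derived G) (ad_e G \<pi> I) B"
  proof
    show "superalgebra (derived G)" using G.lie_derived by (rule lie_superalgebraD)
    show "ad_e G \<pi> I (brk (derived G) x y) = brk (derived G) (ad_e G \<pi> I x) y + brk (derived G) x (ad_e G \<pi> I y)"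
      if "x \<in> carrier (derived G)" "y \<in> carrier (derived G)" for x y
      using jacobi_G[OF e D_G[OF that(1)] D_G[OF that(2)]] by (simp add: ad_e_def)
    show "brk (derived G) y x = - brk (derived G) x y"
      if "x \<in> carrier (derived G)" "y \<in> carrier (derived G)" for x y
      using antisym_G[OF D_G[OF that(1)] D_G[OF that(2)]] by simp
    show "brk (derived G) (brk (derived G) x y) z = brk (derived G) x (brk (derived G) y z) - brk (derived G) y (brk (derived G) x z)"
      if "x \<in> carrier (derived G)" "y \<in> carrier (derived G)" "z \<in> carrier (derived G)" for x y z
      using jacobi_G[OF D_G[OF that(1)] D_G[OF that(2)] D_G[OF that(3)]] by simp
    show "jordan_decomposition (derived G) (ad_e G \<pi> I) B" by (rule jd)
  qed (simp_all add: D_G G.brk_derived ad_e_def e l(6,8) finite_B char_3)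
qed simp_all

abbreviation "D \<equiv> carrier (derived G)"
abbreviation "lie \<equiv> brk G"
abbreviation "t \<equiv> ad_e G \<pi> I"
abbreviation "bar \<equiv> semisimplification (derived G) B"
abbreviation "NJ \<equiv> nb ` I"
abbreviation par :: "('i, 'h2) gen mono \<Rightarrow> bool" where "par \<equiv> mono_par (\<lambda>k. k \<in> NJ)"

lemma lie_sum: "x \<in> D \<Longrightarrow> (\<And>i. i \<in> X \<Longrightarrow> f i \<in> D) \<Longrightarrow> lie x (\<Sum>i\<in>X. f i) = (\<Sum>i\<in>X. lie x (f i))"
  "x \<in> D \<Longrightarrow> (\<And>i. i \<in> X \<Longrightarrow> f i \<in> D) \<Longrightarrow> lie (\<Sum>i\<in>X. f i) x = (\<Sum>i\<in>X. lie (f i) x)"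
proof (induction X rule: infinite_finite_induct)
  case (insert a F)
  { case 1 then show ?case using insert by (simp add: J.lin G.g.subspace_sum[OF G.subspace_derived]) }
  { case 2 then show ?case using insert by (simp add: J.lin G.g.subspace_sum[OF G.subspace_derived]) }
qed (auto simp: J.lin)

section \<open>Chevalley relations of A~ on representatives\<close>

lemma nb_facts:
  assumes "i \<in> I"
  shows "nb i \<in> S" "nb i \<noteq> i" "nb i \<notin> I" "A i (nb i) = - 1" "A (nb i) i = - 1" "A i i = 2" "A (nb i) (nb i) = 2"
    "\<And>l. l \<in> S \<Longrightarrow> l \<noteq> i \<Longrightarrow> l \<noteq> nb i \<Longrightarrow> A i l = 0 \<and> A l i = 0"
proof -
  have *: "{j \<in> S. adjacent A i j} = {nb i}" "A i (nb i) = - 1" "A (nb i) i = - 1" "A i i = 2" "A (nb i) (nb i) = 2"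
    using adm assms by (auto simp: admissible_def)
  then show "A i (nb i) = - 1" "A (nb i) i = - 1" "A i i = 2" "A (nb i) (nb i) = 2" by auto
  have "nb i \<in> {j \<in> S. adjacent A i j}" using *(1) by simp
  then have n: "nb i \<in> S" "adjacent A i (nb i)" by auto
  then show "nb i \<in> S" "nb i \<noteq> i" by (auto simp: adjacent_def)
  show "nb i \<notin> I"
  proof
    assume "nb i \<in> I"
    then have "\<not> adjacent A i (nb i)" using adm assms by (simp add: admissible_def)
    then show False using n by simp
  qed
  fix l assume l: "l \<in> S" "l \<noteq> i" "l \<noteq> nb i"
  then have "l \<notin> {j \<in> S. adjacent A i j}" using *(1) by simp
  then have "A i l = 0" using l by (auto simp: adjacent_def)
  moreover have "i \<in> S" using assms I_S by blast
  ultimately show "A i l = 0 \<and> A l i = 0" using cartan l by (auto simp: cartan_matrix_def)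
qed

lemma nb_inj: "i \<in> I \<Longrightarrow> i' \<in> I \<Longrightarrow> nb i = nb i' \<Longrightarrow> i = i'"
  using adm by (auto simp: admissible_def dest: inj_onD)

lemma A_nb: "i \<in> I \<Longrightarrow> i' \<in> I \<Longrightarrow> A (nb i) i' = (if i = i' then - 1 else 0)"
  "i \<in> I \<Longrightarrow> i' \<in> I \<Longrightarrow> A i' (nb i) = (if i = i' then - 1 else 0)"
  "i \<in> I \<Longrightarrow> i' \<in> I \<Longrightarrow> A i i' = (if i = i' then 2 else 0)"
proof -
  assume i: "i \<in> I" "i' \<in> I"
  have "A i' (nb i) = 0 \<and> A (nb i) i' = 0" if "i \<noteq> i'"
    by (rule nb_facts(8)[OF i(2)]) (use nb_facts(1,3)[OF i(1)] nb_inj[OF i] i that in auto)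
  then show "A (nb i) i' = (if i = i' then - 1 else 0)" "A i' (nb i) = (if i = i' then - 1 else 0)"
    using nb_facts(4,5)[OF i(1)] by auto
  have "A i i' = 0 \<and> A i' i = 0" if "i \<noteq> i'"
    by (rule nb_facts(8)[OF i(1)]) (use nb_facts(3)[OF i(1)] i that I_S in auto)
  then show "A i i' = (if i = i' then 2 else 0)" using nb_facts(6)[OF i(1)] by auto
qed

lemma A_other: "l \<in> S - I \<Longrightarrow> l \<notin> NJ \<Longrightarrow> i \<in> I \<Longrightarrow> A i l = 0 \<and> A l i = 0"
  using nb_facts(8)[of i l] by auto

text \<open>For k = nb i, with i recovered by \<open>inv_into\<close>, both h_k and h_i are sent to
  e_i by t, so their difference lies in ker t.\<close>

definition hv :: "'i \<Rightarrow> 'h" where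
  "hv k = (if k \<in> NJ then h k - h (inv_into I nb k) else h k)"

definition Hg :: "'i \<Rightarrow> 'g" where
  "Hg k = \<pi> (mon (Gen (HG (hv k))))"

lemma Hg_nb: "i \<in> I \<Longrightarrow> Hg (nb i) = gH \<pi> h (nb i) - gH \<pi> h i"
  and Hg_other: "k \<notin> NJ \<Longrightarrow> Hg k = gH \<pi> h k"
  and hv_nb: "i \<in> I \<Longrightarrow> hv (nb i) = h (nb i) - h i"
proof -
  have inj: "inj_on nb I" using adm by (simp add: admissible_def)
  show *: "hv (nb i) = h (nb i) - h i" if "i \<in> I" for i using that inj by (simp add: hv_def)
  then show "i \<in> I \<Longrightarrow> Hg (nb i) = gH \<pi> h (nb i) - gH \<pi> h i"
    by (simp add: Hg_def gH_def gvar_def G.pi_HG_diff)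
  show "k \<notin> NJ \<Longrightarrow> Hg k = gH \<pi> h k" by (simp add: Hg_def hv_def gH_def gvar_def)
qed

lemma alpha_diff: "l \<in> S \<Longrightarrow> \<alpha> l (x - y) = \<alpha> l x - \<alpha> l y"
proof -
  assume "l \<in> S"
  then have "Vector_Spaces.linear sH (*) (\<alpha> l)" using G.realization by (simp add: realization_def)
  then have "\<alpha> l ((x - y) + y) = \<alpha> l (x - y) + \<alpha> l y"
    unfolding Vector_Spaces.linear_def module_hom_def module_hom_axioms_def by blast
  then show ?thesis by simp
qed

text \<open>The entries of row nb i minus row i in the columns i and nb i. The first makes the new
  Cartan element commute with e_i and f_i; the second yields the zero diagonal entry of A~.\<close>

lemma of_int_char_3: "of_int (- 1 - 2) = (0::'k)" "of_int (2 - - 1) = (0::'k)"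
  using char_3 by simp_all

lemma alpha_hv_I: "k \<in> S - I \<Longrightarrow> l \<in> I \<Longrightarrow> \<alpha> l (hv k) = 0"
proof (cases "k \<in> NJ")
  case True
  assume "k \<in> S - I" and l: "l \<in> I"
  obtain i where i: "i \<in> I" "k = nb i" using True by blast
  have "\<alpha> l (hv k) = of_int (A k l - A i l)"
    using i l I_S nb_facts(1)[OF i(1)] by (simp add: hv_nb alpha_diff subsetD G.alpha_h)
  also have "A k l - A i l = (if i = l then - 1 - 2 else 0)" using A_nb(1,3)[OF i(1) l] i by simp
  finally show ?thesis using of_int_char_3 by auto
next
  case False
  assume "k \<in> S - I" and l: "l \<in> I"
  then show ?thesis using False A_other[of k l] I_S by (auto simp: hv_def G.alpha_h)
qed

lemma alpha_hv: "k \<in> S - I \<Longrightarrow> l \<in> S - I \<Longrightarrow> \<alpha> l (hv k) = of_int (tilde_matrix A NJ k l)"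
proof (cases "k \<in> NJ")
  case True
  assume "k \<in> S - I" and l: "l \<in> S - I"
  obtain i where i: "i \<in> I" "k = nb i" using True by blast
  have e: "\<alpha> l (hv k) = of_int (A k l - A i l)"
    using i l I_S nb_facts(1)[OF i(1)] by (simp add: hv_nb alpha_diff subsetD G.alpha_h)
  show ?thesis
  proof (cases "k = l")
    case True
    then have "A k l - A i l = 2 - - 1" using i nb_facts[OF i(1)] by simp
    then have "\<alpha> l (hv k) = 0" using e of_int_char_3(2) by simp
    moreover have "k \<in> NJ" using i by blast
    ultimately show ?thesis using True by (simp add: tilde_matrix_def)
  next
    case False
    then have "A i l = 0" using i l nb_facts(8)[OF i(1), of l] by auto
    then show ?thesis using e False by (simp add: tilde_matrix_def)
  qed
next
  case False
  assume "k \<in> S - I" and l: "l \<in> S - I"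
  then show ?thesis using False by (simp add: hv_def G.alpha_h tilde_matrix_def)
qed

lemma gH_D: "k \<in> S \<Longrightarrow> gH \<pi> h k \<in> D"
  using G.brk_EF[of k k] gens_D[of k] by (metis J.closed)

lemma Hg_D:
  assumes "k \<in> S - I" shows "Hg k \<in> D"
proof (cases "k \<in> NJ")
  case True
  then obtain i where i: "i \<in> I" "k = nb i" by blast
  then have "gH \<pi> h (nb i) \<in> D" "gH \<pi> h i \<in> D" using nb_facts(1) I_S gH_D by blast+
  then show ?thesis using i by (simp add: Hg_nb)
next
  case False
  then show ?thesis using assms by (simp add: Hg_other gH_D)
qed

lemma Hg_gE: "l \<in> S \<Longrightarrow> lie (Hg k) (gE \<pi> l) = smul G (\<alpha> l (hv k)) (gE \<pi> l)"
  and Hg_gF: "l \<in> S \<Longrightarrow> lie (Hg k) (gF \<pi> l) = - smul G (\<alpha> l (hv k)) (gF \<pi> l)"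
  and Hg_Hg: "lie (Hg k) (Hg m) = 0"
  by (simp_all add: Hg_def G.brk_HE G.brk_HF G.brk_HH)

lemma gH_gE: "k \<in> S \<Longrightarrow> l \<in> S \<Longrightarrow> lie (gH \<pi> h k) (gE \<pi> l) = smul G (of_int (A k l)) (gE \<pi> l)"
  by (simp add: gH_def gvar_def G.brk_HE G.alpha_h)

lemma Hg_ff: "k \<in> S - I \<Longrightarrow> lie (Hg k) ff = 0"
  using I_S Hg_D gens_D by (subst lie_sum) (auto intro!: sum.neutral simp: Hg_gF alpha_hv_I subsetD)

text \<open>Heads of the blocks of the generators: for k in NJ the vector f_k is the tail of its
  block, whose head is [f,f_k]. The value at \<open>HG\<close> is a dummy, as only e,f-words are
  evaluated.\<close>

primrec XG :: "('i, 'h2) gen \<Rightarrow> 'g" where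
  "XG (HG x) = 0"
| "XG (EG k) = gE \<pi> k"
| "XG (FG k) = (if k \<in> NJ then lie ff (gF \<pi> k) else gF \<pi> k)"

primrec X :: "('i, 'h2) gen mono \<Rightarrow> 'g" where
  "X (Gen g) = XG g"
| "X (Br u v) = J.Bk (par u) (par v) (X u) (X v)"

definition EB :: "'i \<Rightarrow> 'g list" where
  "EB k = (if k \<in> NJ then [gE \<pi> k, t (gE \<pi> k)] else [gE \<pi> k])"

definition FB :: "'i \<Rightarrow> 'g list" where
  "FB k = (if k \<in> NJ then [lie ff (gF \<pi> k), gF \<pi> k] else [gF \<pi> k])"

lemma in_blocks:
  assumes "k \<in> S - I"
  shows "EB k \<in> J.blocks (k \<in> NJ)" "FB k \<in> J.blocks (k \<in> NJ)" "[Hg k] \<in> J.blocks False"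
proof -
  have "EB k \<in> J.blocks (k \<in> NJ) \<and> FB k \<in> J.blocks (k \<in> NJ) \<and> [Hg k] \<in> J.blocks False"
  proof (cases "k \<in> NJ")
    case True
    then obtain i where i: "i \<in> I" "k = nb i" by blast
    then show ?thesis using decomp by (auto simp: adapted_decomposition_def EB_def FB_def Hg_nb)
  next
    case False
    then show ?thesis using decomp assms by (auto simp: adapted_decomposition_def EB_def FB_def Hg_other)
  qed
  then show "EB k \<in> J.blocks (k \<in> NJ)" "FB k \<in> J.blocks (k \<in> NJ)" "[Hg k] \<in> J.blocks False" by auto
qed

lemma heads: "EB k ! 0 = XG (EG k)" "FB k ! 0 = XG (FG k)"
  by (simp_all add: EB_def FB_def)

lemma X_gen_K: "k \<in> S - I \<Longrightarrow> XG (EG k) \<in> J.K (k \<in> NJ)" "k \<in> S - I \<Longrightarrow> XG (FG k) \<in> J.K (k \<in> NJ)"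
  using J.basis_K[OF in_blocks(1)] J.basis_K[OF in_blocks(2)] heads by metis+

lemma pr_gens: "k \<in> S - I \<Longrightarrow> J.pr (k \<in> NJ) (XG (EG k)) = mon (EB k)"
  "k \<in> S - I \<Longrightarrow> J.pr (k \<in> NJ) (XG (FG k)) = mon (FB k)"
  "k \<in> S - I \<Longrightarrow> J.pr False (Hg k) = mon [Hg k]"
  using J.pr_basis[OF in_blocks(1)] J.pr_basis[OF in_blocks(2)] J.pr_basis[OF in_blocks(3)] heads
  by (metis nth_Cons_0)+

lemma X_K: "u \<in> H.EF \<Longrightarrow> X u \<in> J.K (par u)"
proof (induction u)
  case (Gen g)
  then show ?case using X_gen_K by auto
next
  case (Br u v)
  then have "J.Bk (par u) (par v) (X u) (X v) \<in> J.K (par u \<noteq> par v)" by (intro J.Bk_K) auto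
  then show ?case by simp
qed

lemma X_gen_D: "k \<in> S - I \<Longrightarrow> XG (EG k) \<in> D" "k \<in> S - I \<Longrightarrow> XG (FG k) \<in> D"
  using X_gen_K J.K_D by blast+

lemma Hg_XE: "k \<in> S - I \<Longrightarrow> l \<in> S - I \<Longrightarrow> lie (Hg k) (XG (EG l)) = smul G (of_int (tilde_matrix A NJ k l)) (XG (EG l))"
  by (simp add: Hg_gE alpha_hv)

lemma Hg_XF:
  assumes "k \<in> S - I" "l \<in> S - I"
  shows "lie (Hg k) (XG (FG l)) = - smul G (of_int (tilde_matrix A NJ k l)) (XG (FG l))"
proof (cases "l \<in> NJ")
  case True
  have D: "Hg k \<in> D" "gF \<pi> l \<in> D" "ff \<in> D" using Hg_D gens_D assms sums_D by auto
  have "lie (Hg k) (lie ff (gF \<pi> l)) = lie (lie (Hg k) ff) (gF \<pi> l) + lie ff (lie (Hg k) (gF \<pi> l))"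
    using D by (simp add: J.jacobi)
  also have "\<dots> = - smul G (of_int (tilde_matrix A NJ k l)) (lie ff (gF \<pi> l))"
    using D assms by (simp add: Hg_ff J.lin Hg_gF alpha_hv)
  finally show ?thesis using True by simp
next
  case False
  then show ?thesis using assms by (simp add: Hg_gF alpha_hv)
qed

lemma E_ff: "k \<in> S - I \<Longrightarrow> lie (gE \<pi> k) ff = 0"
  using I_S gens_D by (subst lie_sum) (auto intro!: sum.neutral simp: G.brk_EF subsetD)

lemma ee_F: "k \<in> S - I \<Longrightarrow> lie ee (gF \<pi> k) = 0"
  using I_S gens_D by (subst lie_sum(2)) (auto intro!: sum.neutral simp: G.brk_EF subsetD)

lemma Ei_ff: "i \<in> I \<Longrightarrow> lie (gE \<pi> i) ff = gH \<pi> h i"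
proof -
  assume i: "i \<in> I"
  have "lie (gE \<pi> i) ff = (\<Sum>j\<in>I. lie (gE \<pi> i) (gF \<pi> j))"
    using i I_S gens_D by (intro lie_sum) (auto simp: subsetD)
  also have "\<dots> = (\<Sum>j\<in>I. if j = i then gH \<pi> h i else 0)"
    using i I_S by (intro sum.cong) (auto simp: G.brk_EF subsetD)
  finally show ?thesis using i finite_I by simp
qed

text \<open>The substantial case is k = nb i with l in NJ, where the bracket is -[e_k, f_l] + [t
  e_k, [f,f_l]]. It is evaluated from [t e_k, f] = -e_k and from [t e_k, f_l], which is e_i for k =
  l and 0 otherwise.\<close>

lemma X_EF:
  assumes k: "k \<in> S - I" and l: "l \<in> S - I"
  shows "J.Bk (k \<in> NJ) (l \<in> NJ) (XG (EG k)) (XG (FG l)) = (if k = l then Hg k else 0)"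
proof -
  have D: "gE \<pi> k \<in> D" "gF \<pi> l \<in> D" "ff \<in> D" "ee \<in> D" using gens_D k l sums_D by auto
  consider "l \<notin> NJ" | "k \<notin> NJ" "l \<in> NJ" | i where "k = nb i" "i \<in> I" "l \<in> NJ" by blast
  then show ?thesis
  proof cases
    case 1
    then show ?thesis using k l by (auto simp: J.Bk_def G.brk_EF Hg_other)
  next
    case 2
    then have "lie (gE \<pi> k) (lie ff (gF \<pi> l)) = lie (lie (gE \<pi> k) ff) (gF \<pi> l) + lie ff (lie (gE \<pi> k) (gF \<pi> l))"
      using D by (simp add: J.jacobi)
    also have "\<dots> = 0" using 2 D k l by (auto simp: E_ff J.lin G.brk_EF)
    finally show ?thesis using 2 by (auto simp: J.Bk_def)
  next
    case 3
    have iS: "i \<in> S" using 3 I_S by blast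
    have iD: "gE \<pi> i \<in> D" "gH \<pi> h i \<in> D" "gH \<pi> h k \<in> D" "t (gE \<pi> k) \<in> D" using gens_D gH_D iS k D by auto
    \<comment> \<open>That t sends [f,f_l] to f_l is read off from the prescribed block instead of
      being computed.\<close>
    have "FB l \<in> J.blocks True" using in_blocks(2)[OF l] 3 by simp
    then have tF: "t (lie ff (gF \<pi> l)) = gF \<pi> l"
      using J.t_basis[of "FB l" 0] 3 by (simp add: FB_def)
    have eeff: "lie ee ff = (\<Sum>j\<in>I. gH \<pi> h j)"
    proof -
      have "lie ee ff = (\<Sum>j\<in>I. lie (gE \<pi> j) ff)"
        using I_S gens_D D by (intro lie_sum) (auto simp: subsetD)
      then show ?thesis by (simp add: Ei_ff)
    qed
    have hsum: "lie (\<Sum>j\<in>I. gH \<pi> h j) (gE \<pi> k) = - gE \<pi> k"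
    proof -
      have "lie (\<Sum>j\<in>I. gH \<pi> h j) (gE \<pi> k) = (\<Sum>j\<in>I. lie (gH \<pi> h j) (gE \<pi> k))"
        using I_S gH_D D by (intro lie_sum) (auto simp: subsetD)
      also have "\<dots> = (\<Sum>j\<in>I. if j = i then - gE \<pi> k else 0)"
        using 3 I_S k by (intro sum.cong) (auto simp: gH_gE subsetD A_nb(2))
      finally show ?thesis using 3 finite_I by simp
    qed
    have hD: "(\<Sum>j\<in>I. gH \<pi> h j) \<in> D" using I_S gH_D by (auto intro!: G.g.subspace_sum[OF G.subspace_derived])
    have teff: "lie (t (gE \<pi> k)) ff = - gE \<pi> k"
    proof -
      have "lie (t (gE \<pi> k)) ff = lie ee (lie (gE \<pi> k) ff) - lie (gE \<pi> k) (lie ee ff)"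
        using D by (simp add: ad_e_def J.jacobi)
      also have "\<dots> = lie (\<Sum>j\<in>I. gH \<pi> h j) (gE \<pi> k)"
        using D hD k J.antisym[OF hD D(1)] by (simp add: E_ff J.lin eeff)
      finally show ?thesis using hsum by simp
    qed
    have eh: "lie ee (gH \<pi> h k) = gE \<pi> i"
    proof -
      have "lie ee (gH \<pi> h k) = - lie (gH \<pi> h k) ee" by (rule J.antisym[OF iD(3) D(4)])
      also have "lie (gH \<pi> h k) ee = (\<Sum>j\<in>I. lie (gH \<pi> h k) (gE \<pi> j))"
        using I_S gens_D iD by (intro lie_sum) (auto simp: subsetD)
      also have "\<dots> = (\<Sum>j\<in>I. if j = i then - gE \<pi> i else 0)"
        using 3 I_S k by (intro sum.cong) (auto simp: gH_gE subsetD A_nb(1))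
      finally show ?thesis using 3 finite_I by simp
    qed
    have tef: "lie (t (gE \<pi> k)) (gF \<pi> l) = (if k = l then gE \<pi> i else 0)"
    proof -
      have "lie (t (gE \<pi> k)) (gF \<pi> l) = lie ee (lie (gE \<pi> k) (gF \<pi> l)) - lie (gE \<pi> k) (lie ee (gF \<pi> l))"
        using D by (simp add: ad_e_def J.jacobi)
      then show ?thesis using D k l eh by (auto simp: ee_F J.lin G.brk_EF)
    qed
    have ffe: "lie ff (gE \<pi> i) = - gH \<pi> h i" using J.antisym[OF iD(1) D(3)] Ei_ff 3 by simp
    have "lie (t (gE \<pi> k)) (lie ff (gF \<pi> l))
       = lie (lie (t (gE \<pi> k)) ff) (gF \<pi> l) + lie ff (lie (t (gE \<pi> k)) (gF \<pi> l))"
      using D iD by (simp add: J.jacobi)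
    also have "\<dots> = - lie (gE \<pi> k) (gF \<pi> l) + (if k = l then - gH \<pi> h i else 0)"
      using D iD by (simp add: teff tef ffe J.lin)
    also have "\<dots> = (if k = l then - gH \<pi> h k - gH \<pi> h i else 0)" using k l by (auto simp: G.brk_EF)
    finally have "J.Bk (k \<in> NJ) (l \<in> NJ) (XG (EG k)) (XG (FG l))
       = - lie (gE \<pi> k) (gF \<pi> l) + (if k = l then - gH \<pi> h k - gH \<pi> h i else 0)"
      using 3 by (simp add: J.Bk_def tF)
    also have "\<dots> = (if k = l then - gH \<pi> h k + (- gH \<pi> h k - gH \<pi> h i) else 0)" using k l by (auto simp: G.brk_EF)
    \<comment> \<open>For k = l the result is -2h_k - h_i, which in characteristic 3 is h_k -
      h_i.\<close>
    also have "- gH \<pi> h k + (- gH \<pi> h k - gH \<pi> h i) = gH \<pi> h k - gH \<pi> h i - (gH \<pi> h k + gH \<pi> h k + gH \<pi> h k)"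
      by (simp add: algebra_simps)
    also have "\<dots> = Hg k" using 3 by (simp add: J.three Hg_nb)
    finally show ?thesis .
  qed
qed

section \<open>The comparison map from the free algebra\<close>

definition \<psi> :: "(('i, 'h2) gen mono \<Rightarrow>\<^sub>0 'k) \<Rightarrow> ('g list \<Rightarrow>\<^sub>0 'k)" where
  "\<psi> = lext pscale (\<lambda>u. J.pr (par u) (X u))"

lemma psi_simps [simp]:
  "\<psi> (p + q) = \<psi> p + \<psi> q" "\<psi> (p - q) = \<psi> p - \<psi> q" "\<psi> (- p) = - \<psi> p" "\<psi> (pscale c p) = pscale c (\<psi> p)" "\<psi> 0 = 0"
  by (simp_all add: \<psi>_def)

lemma psi_mon: "\<psi> (single u c) = pscale c (J.pr (par u) (X u))"
  by (simp add: \<psi>_def)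

lemma plin_psi: "plin \<psi>"
  by (simp add: plin_def)

lemma bar_bilinear:
  "brk bar (p + q) r = brk bar p r + brk bar q r" "brk bar r (p + q) = brk bar r p + brk bar r q"
  "brk bar (pscale c p) r = pscale c (brk bar p r)" "brk bar r (pscale c p) = pscale c (brk bar r p)"
  "brk bar 0 r = 0" "brk bar r 0 = 0"
  by (simp_all add: semisimplification_def bilinear_ext_simps)

lemma psi_Br: "u \<in> H.EF \<Longrightarrow> v \<in> H.EF \<Longrightarrow> \<psi> (mon (Br u v)) = brk bar (\<psi> (mon u)) (\<psi> (mon v))"
  using J.pr_Bk[OF X_K X_K, of u v] by (simp add: psi_mon)

lemma psi_fbr:
  assumes p: "p \<in> mspan H.EF" and q: "q \<in> mspan H.EF"
  shows "\<psi> (fbr p q) = brk bar (\<psi> p) (\<psi> q)"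
proof -
  have 1: "\<psi> (fbr (mon u) q) = brk bar (\<psi> (mon u)) (\<psi> q)" if u: "u \<in> H.EF" for u
    by (rule plin_eq[OF _ _ _ q])
      (use u psi_Br in \<open>auto simp: plin_def bilinear_ext_simps bar_bilinear\<close>)
  show ?thesis
    by (rule plin_eq[where f = "\<lambda>p. \<psi> (fbr p q)" and g = "\<lambda>p. brk bar (\<psi> p) (\<psi> q)", OF _ _ _ p])
      (use 1 in \<open>auto simp: plin_def bilinear_ext_simps bar_bilinear\<close>)
qed

lemma psi_part: "p \<in> mspan {u \<in> H.EF. par u = a} \<Longrightarrow> \<psi> p \<in> part bar a"
  unfolding \<psi>_def J.part_bar
  by (rule pm.lext_in_subspace[where M = "{u \<in> H.EF. par u = a}"]) (use J.pr_in_part[of a] in \<open>auto simp: J.part_bar\<close>)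

lemma psi_gens: "k \<in> S - I \<Longrightarrow> \<psi> (mon (Gen (EG k))) = mon (EB k)" "k \<in> S - I \<Longrightarrow> \<psi> (mon (Gen (FG k))) = mon (FB k)"
  "k \<in> S - I \<Longrightarrow> \<psi> (mon (Br (Gen (EG k)) (Gen (FG k)))) = mon [Hg k]"
  using pr_gens[of k] X_EF[of k k] by (simp_all add: psi_mon del: XG.simps)

end


context semisimplification_setup
begin

subsection \<open>The grading of the semisimplification\<close>

text \<open>Only the grading by \<open>Q\<close> modulo the \<open>\<alpha>\<^sub>i\<close> with \<open>i \<in> I\<close> is preserved by \<open>ad e\<close>.\<close>

definition cw :: "('i \<Rightarrow>\<^sub>0 int) \<Rightarrow> ('i \<Rightarrow>\<^sub>0 int)" where
  "cw = frag_extend (\<lambda>i. if i \<in> I then 0 else frag_of i)"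

lemma cw_simps [simp]: "cw (\<beta> + \<gamma>) = cw \<beta> + cw \<gamma>" "cw 0 = 0" "cw (- \<beta>) = - cw \<beta>"
  "cw (frag_of i) = (if i \<in> I then 0 else frag_of i)"
  by (simp_all add: cw_def frag_extend_add frag_extend_minus frag_extend_of)

abbreviation cmw :: "('i, 'h) gen mono \<Rightarrow> ('i \<Rightarrow>\<^sub>0 int)" where
  "cmw w \<equiv> cw (mono_weight w)"

definition Gd :: "('i \<Rightarrow>\<^sub>0 int) \<Rightarrow> 'g set" where
  "Gd \<gamma> = \<pi> ` mspan {w \<in> G.M. cmw w = \<gamma>}"

text \<open>Projection of g(A) to coarse degree \<gamma>. The choice of preimage is harmless because
  the kernel \<open>G.C\<close> is stable under coarse components, see \<open>P_pi\<close>.\<close>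

definition P :: "('i \<Rightarrow>\<^sub>0 int) \<Rightarrow> 'g \<Rightarrow> 'g" where
  "P \<gamma> x = \<pi> (pres (\<lambda>w. cmw w = \<gamma>) (SOME p. p \<in> mspan G.M \<and> \<pi> p = x))"

lemma P_pi:
  assumes p: "p \<in> mspan G.M"
  shows "P \<gamma> (\<pi> p) = \<pi> (pres (\<lambda>w. cmw w = \<gamma>) p)"
proof -
  define q where "q = (SOME q. q \<in> mspan G.M \<and> \<pi> q = \<pi> p)"
  have "q \<in> mspan G.M \<and> \<pi> q = \<pi> p"
    unfolding q_def by (rule someI[of _ p]) (use p in simp)
  then have q: "q \<in> mspan G.M" "\<pi> q = \<pi> p" by auto
  have "\<pi> (q - p) = 0" using q p by (simp add: G.pi_diff)
  then have "q - p \<in> G.C" using p q by (simp add: G.pi_eq_0_iff mspan_diff)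
  then have "pres (\<lambda>w. cmw w = \<gamma>) (q - p) \<in> G.C"
    by (rule G.C_pres_weight[where P = "\<lambda>\<beta>. cw \<beta> = \<gamma>"])
  then have "\<pi> (pres (\<lambda>w. cmw w = \<gamma>) q) = \<pi> (pres (\<lambda>w. cmw w = \<gamma>) p)"
    using p q by (intro G.pi_eqI) (auto intro: pres_mspan')
  then show ?thesis by (simp add: P_def q_def)
qed

lemma G_rep: "x \<in> D \<Longrightarrow> \<exists>p\<in>mspan G.BrM. x = \<pi> p"
  using G.carrier_derived by blast

lemma BrM_mspan: "p \<in> mspan G.BrM \<Longrightarrow> p \<in> mspan G.M"
  using mspan_mono[OF G.BrM_M] .

lemma G_repE:
  assumes "x \<in> D"
  obtains p where "p \<in> mspan G.M" "x = \<pi> p"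
  using G_rep[OF assms] BrM_mspan by blast

lemma P_D: "x \<in> D \<Longrightarrow> P \<gamma> x \<in> D"
proof -
  assume "x \<in> D"
  then obtain p where p: "p \<in> mspan G.BrM" "x = \<pi> p" using G_rep by blast
  then have "P \<gamma> x = \<pi> (pres (\<lambda>w. cmw w = \<gamma>) p)" using P_pi BrM_mspan by blast
  then show ?thesis unfolding G.carrier_derived using pres_mspan'[OF p(1)] by blast
qed

lemma P_add: "x \<in> D \<Longrightarrow> y \<in> D \<Longrightarrow> P \<gamma> (x + y) = P \<gamma> x + P \<gamma> y"
proof -
  assume x: "x \<in> D" and y: "y \<in> D"
  obtain p where p: "p \<in> mspan G.M" "x = \<pi> p" using x by (rule G_repE)
  obtain q where q: "q \<in> mspan G.M" "y = \<pi> q" using y by (rule G_repE)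
  note pq = p q
  then have "P \<gamma> (x + y) = P \<gamma> (\<pi> (p + q))" by (simp add: G.pi_add)
  also have "\<dots> = \<pi> (pres (\<lambda>w. cmw w = \<gamma>) (p + q))"
    using pq by (intro P_pi mspan_add)
  finally show ?thesis using pq by (simp add: P_pi G.pi_add pres_mspan')
qed

lemma P_scale: "x \<in> D \<Longrightarrow> P \<gamma> (smul G c x) = smul G c (P \<gamma> x)"
proof -
  assume "x \<in> D"
  then obtain p where p: "p \<in> mspan G.M" "x = \<pi> p" by (rule G_repE)
  then have "P \<gamma> (smul G c x) = P \<gamma> (\<pi> (pscale c p))" by (simp add: G.pi_scale)
  also have "\<dots> = \<pi> (pres (\<lambda>w. cmw w = \<gamma>) (pscale c p))"
    using p by (intro P_pi mspan_scale)
  finally show ?thesis using p by (simp add: P_pi G.pi_scale pres_mspan')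
qed

lemma P_0 [simp]: "P \<gamma> 0 = 0"
  using P_pi[of 0 \<gamma>] by (simp add: pm.subspace_0)

lemma P_Gd: "x \<in> Gd \<delta> \<Longrightarrow> P \<gamma> x = (if \<gamma> = \<delta> then x else 0)"
proof -
  assume "x \<in> Gd \<delta>"
  then obtain p where p: "p \<in> mspan {w \<in> G.M. cmw w = \<delta>}" "x = \<pi> p" by (auto simp: Gd_def)
  have M: "p \<in> mspan G.M" by (rule mspan_mono[OF _ p(1)]) auto
  have "pres (\<lambda>w. cmw w = \<gamma>) p = (if \<gamma> = \<delta> then p else 0)"
    using p(1) by (intro poly_mapping_eqI) (auto simp: lookup_pres mspan_iff)
  then show ?thesis using P_pi[OF M, of \<gamma>] p(2) by simp
qed

definition pe :: "('i, 'h) gen mono \<Rightarrow>\<^sub>0 'k" where "pe = (\<Sum>i\<in>I. mon (Gen (EG i)))"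
definition pf :: "('i, 'h) gen mono \<Rightarrow>\<^sub>0 'k" where "pf = (\<Sum>i\<in>I. mon (Gen (FG i)))"

lemma pe_pf: "pe \<in> mspan {w \<in> G.M. cmw w = 0}" "pf \<in> mspan {w \<in> G.M. cmw w = 0}"
  "\<pi> pe = ee" "\<pi> pf = ff"
  using I_S by (auto simp: pe_def pf_def G.pi_sum subsetD gE_def gF_def gvar_def intro!: mspan_sum single_in_mspan)

lemma ee_Gd: "ee \<in> Gd 0" and ff_Gd: "ff \<in> Gd 0"
  using imageI[OF pe_pf(1), of \<pi>] imageI[OF pe_pf(2), of \<pi>] by (simp_all add: Gd_def pe_pf(3,4))

text \<open>t is the bracket with an element of coarse degree 0; this is what dividing out the
  \<alpha>'s of I achieves.\<close>

lemma P_t: "x \<in> D \<Longrightarrow> P \<gamma> (t x) = t (P \<gamma> x)"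
proof -
  assume "x \<in> D"
  then obtain p where p: "p \<in> mspan G.M" "x = \<pi> p" by (rule G_repE)
  have pe: "pe \<in> mspan G.M" by (rule mspan_mono[OF _ pe_pf(1)]) auto
  have pe0: "pe \<in> mspan {w. cmw w = 0}" by (rule mspan_mono[OF _ pe_pf(1)]) auto
  have t: "t (\<pi> q) = \<pi> (fbr pe q)" if "q \<in> mspan G.M" for q
    using G.pi_brk[OF pe that] by (simp add: ad_e_def pe_pf)
  have "pres (\<lambda>w. cmw w = \<gamma>) (fbr pe p) = fbr pe (pres (\<lambda>w. cmw w = \<gamma>) p)"
    using pres_fbr(1)[of cmw, OF _ pe0, of \<gamma> p] by simp
  then show ?thesis using p pe by (simp add: t P_pi fbr_mspan pres_mspan')
qed

lemma Gd_subspace: "G.g.subspace (Gd \<gamma>)"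
  unfolding Gd_def by (rule G.pi_image_subspace) (auto elim: mspan_mono[rotated])

lemma Gd_lie: "x \<in> Gd \<gamma> \<Longrightarrow> y \<in> Gd \<delta> \<Longrightarrow> lie x y \<in> Gd (\<gamma> + \<delta>)"
proof -
  assume "x \<in> Gd \<gamma>" "y \<in> Gd \<delta>"
  then obtain p q where p: "p \<in> mspan {w \<in> G.M. cmw w = \<gamma>}" "x = \<pi> p"
    and q: "q \<in> mspan {w \<in> G.M. cmw w = \<delta>}" "y = \<pi> q" by (auto simp: Gd_def)
  have M: "p \<in> mspan G.M" "q \<in> mspan G.M"
    using mspan_mono[OF _ p(1), of G.M] mspan_mono[OF _ q(1), of G.M] by auto
  have "fbr p q \<in> mspan {w \<in> G.M. cmw w = \<gamma> + \<delta>}"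
    by (rule fbr_in_subspace[OF _ _ p(1) q(1)]) auto
  then have "\<pi> (fbr p q) \<in> Gd (\<gamma> + \<delta>)" unfolding Gd_def by (rule imageI)
  then show ?thesis using G.pi_brk[OF M] p q by simp
qed

lemma Gd_Bk:
  assumes "x \<in> Gd \<gamma>" "y \<in> Gd \<delta>"
  shows "J.Bk a b x y \<in> Gd (\<gamma> + \<delta>)"
proof -
  have "t x \<in> Gd \<gamma>" "t y \<in> Gd \<delta>" using Gd_lie[OF ee_Gd] assms by (auto simp: ad_e_def)
  then show ?thesis using assms Gd_lie[of _ \<gamma> _ \<delta>] Gd_subspace[of "\<gamma> + \<delta>"]
    by (auto simp: J.Bk_def intro!: G.g.subspace_diff simp flip: diff_conv_add_uminus)
qed

text \<open>Words over S - I involve no \<alpha>_i with i in I, so their weight is already a coarse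
  degree; since f has degree 0, passing from f_k to [f,f_k] does not change it.\<close>

lemma X_Gd: "u \<in> H.EF \<Longrightarrow> X u \<in> Gd (mono_weight u)"
proof (induction u)
  case (Gen g)
  have E: "gE \<pi> k \<in> Gd (frag_of k)" and F: "gF \<pi> k \<in> Gd (- frag_of k)" if "k \<in> S - I" for k
    using that unfolding Gd_def gE_def gF_def gvar_def by (auto intro!: imageI)
  consider k where "k \<in> S - I" "g = EG k" | k where "k \<in> S - I" "g = FG k" using Gen by auto
  then show ?case
  proof cases
    case 1 then show ?thesis using E by simp
  next
    case 2 then show ?thesis using F Gd_lie[OF ff_Gd F[OF 2(1)]] by auto
  qed
next
  case (Br u v)
  then show ?case using Gd_Bk by simp
qed

definition Xl :: "bool \<Rightarrow> (('i, 'h2) gen mono \<Rightarrow>\<^sub>0 'k) \<Rightarrow> 'g" where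
  "Xl a = lext (smul G) (\<lambda>u. if par u = a then X u else 0)"

lemma Xl_simps [simp]:
  "Xl a (p + q) = Xl a p + Xl a q" "Xl a (single u c) = smul G c (if par u = a then X u else 0)" "Xl a 0 = 0"
  by (simp_all add: Xl_def)

lemma Xl_K: "p \<in> mspan H.EF \<Longrightarrow> Xl a p \<in> J.K a"
  unfolding Xl_def
  by (rule G.g.lext_in_subspace[where M = H.EF]) (use X_K J.subspace_K G.g.subspace_0 in auto)

lemma psi_Xl: "p \<in> mspan H.EF \<Longrightarrow> \<psi> p = J.pr False (Xl False p) + J.pr True (Xl True p)"
proof (induction rule: mspan_induct)
  case (single c u)
  then have "X u \<in> D" using X_K J.K_D by blast
  then show ?case by (cases "par u") (auto simp: psi_mon J.pr_scale)
next
  case (add p q)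
  then have "Xl a p \<in> D" "Xl a q \<in> D" for a using Xl_K J.K_D by blast+
  then show ?case using add by (simp add: J.pr_add)
qed simp

lemma P_Xl: "p \<in> mspan H.EF \<Longrightarrow> P \<gamma> (Xl a p) = Xl a (wpres \<gamma> p)"
proof (induction rule: mspan_induct)
  case (single c u)
  have "X u \<in> D" using X_K[OF single] J.K_D by blast
  then show ?case using P_Gd[OF X_Gd[OF single], of \<gamma>] by (auto simp: pres_single P_scale)
next
  case (add p q)
  then have "Xl a p \<in> D" "Xl a q \<in> D" using Xl_K J.K_D by blast+
  then show ?case using add by (simp add: P_add)
qed simp

lemma part_bar_disjoint: "y \<in> part bar False \<Longrightarrow> y \<in> part bar True \<Longrightarrow> y = 0"
  using superalgebraD(3)[OF J.superalgebra_bar] by blast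

text \<open>Vanishing of a class means membership in im t, or in ker t + im t for odd parity. The
  projections P commute with t and so preserve these subspaces, whereas the blocks themselves need
  not be homogeneous.\<close>

lemma psi_graded:
  assumes p: "p \<in> mspan H.EF" and 0: "\<psi> p = 0"
  shows "\<psi> (wpres \<gamma> p) = 0"
proof -
  have sum: "J.pr False (Xl False p) + J.pr True (Xl True p) = 0" using psi_Xl[OF p] 0 by simp
  then have e: "J.pr False (Xl False p) = - J.pr True (Xl True p)" by (simp add: eq_neg_iff_add_eq_0)
  have "- J.pr True (Xl True p) \<in> part bar True"
    using J.pr_in_part[of True] by (auto simp: J.part_bar intro: mspan_neg)
  then have pF: "J.pr False (Xl False p) = 0" using part_bar_disjoint J.pr_in_part e by metis
  then have pa: "J.pr a (Xl a p) = 0" for a using sum by (cases a) auto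
  have "J.pr a (P \<gamma> (Xl a p)) = 0" for a
  proof -
    obtain k v where kv: "k \<in> J.K False" "a \<or> k = 0" "v \<in> D" "Xl a p = J.lift (J.pr a (Xl a p)) + (k + t v)"
      using J.K_decomposition[OF Xl_K[OF p, of a]] by blast
    have D: "k \<in> D" "t v \<in> D" "P \<gamma> k \<in> D" "P \<gamma> v \<in> D" using kv J.K_D P_D by auto
    have "P \<gamma> (Xl a p) = P \<gamma> (k + t v)" using kv(4) pa by simp
    also have "\<dots> = P \<gamma> k + t (P \<gamma> v)" using D kv by (simp add: P_add P_t)
    finally have "P \<gamma> (Xl a p) = P \<gamma> k + t (P \<gamma> v)" .
    moreover have "t (P \<gamma> k) = 0" using P_t[OF D(1), of \<gamma>] kv(1) by (simp add: J.K_def)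
    then have "P \<gamma> k \<in> J.K False" using D by (simp add: J.K_def)
    then have "J.pr a (P \<gamma> k) = 0" using kv(2) J.pr_True_kernel by (cases a) auto
    ultimately show ?thesis using D by (simp add: J.pr_add J.pr_t)
  qed
  then show ?thesis using psi_Xl[of "wpres \<gamma> p"] p P_Xl[OF p] pres_mspan'[OF p] by simp
qed

subsection \<open>The kernel of the comparison map\<close>

abbreviation ker_psi :: "(('i, 'h2) gen mono \<Rightarrow>\<^sub>0 'k) set" where
  "ker_psi \<equiv> {p \<in> mspan H.EF. \<psi> p = 0}"

text \<open>The triangular decomposition is taken modulo both kernels at once: modulo
  \<open>ker_psi\<close> alone it would carry no information about \<pi>'.\<close>

abbreviation W :: "(('i, 'h2) gen mono \<Rightarrow>\<^sub>0 'k) set" where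
  "W \<equiv> {p \<in> mspan H.EF. \<psi> p = 0 \<and> \<pi>' p = 0}"

abbreviation Hm :: "('i, 'h2) gen mono set" where
  "Hm \<equiv> (\<lambda>k. Br (Gen (EG k)) (Gen (FG k))) ` (S - I)"

lemma EF_mspan: "p \<in> mspan H.EF \<Longrightarrow> p \<in> mspan H.M"
  using mspan_mono[OF H.EF_M] .

lemma pi'_mon_Br: "u \<in> H.EF \<Longrightarrow> v \<in> H.EF \<Longrightarrow> \<pi>' (mon (Br u v)) = brk G' (\<pi>' (mon u)) (\<pi>' (mon v))"
  using H.pi_brk_mon[of u v] H.EF_M[THEN subsetD] by simp

lemma pi'_gens: "\<pi>' (mon (Gen (EG k))) = gE \<pi>' k" "\<pi>' (mon (Gen (FG k))) = gF \<pi>' k"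
  by (simp_all add: gE_def gF_def gvar_def)

lemma pi'_Hm: "k \<in> S - I \<Longrightarrow> \<pi>' (mon (Br (Gen (EG k)) (Gen (FG k)))) = \<pi>' (mon (Gen (HG (h' k))))"
  by (subst pi'_mon_Br) (auto simp: pi'_gens H.brk_EF gH_def gvar_def)

lemma subspace_ker_psi: "pm.subspace ker_psi" and subspace_W: "pm.subspace W"
proof -
  note I = mspan_add mspan_scale mspan_0
  show "pm.subspace ker_psi" by (rule pm.subspaceI) (auto intro: I)
  show "pm.subspace W"
    by (rule pm.subspaceI) (auto intro: I simp: H.pi_add H.pi_scale EF_mspan)
qed

lemma in_W: "p \<in> mspan H.EF \<Longrightarrow> \<psi> p = 0 \<Longrightarrow> \<pi>' p = 0 \<Longrightarrow> p \<in> W"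
  by simp

lemma lie_ideal_W: "lie_ideal (\<lambda>k. k \<in> NJ) (EG ` (S - I) \<union> FG ` (S - I)) W"
proof
  show "pm.subspace W" by (rule subspace_W)
  show "fbr x y \<in> W \<and> fbr y x \<in> W" if x: "x \<in> mspan H.EF" and y: "y \<in> W" for x y
  proof -
    have y': "y \<in> mspan H.EF" "\<psi> y = 0" "\<pi>' y = 0" using y by auto
    have "y \<in> H.C" using y' H.pi_eq_0_iff EF_mspan by blast
    then have "fbr x y \<in> H.C" "fbr y x \<in> H.C" using H.C_closed EF_mspan[OF x] by auto
    then have "\<pi>' (fbr x y) = 0" "\<pi>' (fbr y x) = 0" using H.pi_eq_0_iff H.C_M by blast+
    then show ?thesis using x y' by (auto simp: psi_fbr bar_bilinear intro: fbr_mspan)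
  qed
  note I = mspan_add mspan_scale mspan_diff fbr_mspan
  have psi_mon_part: "\<psi> (mon u) \<in> part bar (par u)" if "u \<in> H.EF" for u
    using that by (intro psi_part) auto
  show "anti_rel (par u) (par v) (mon u) (mon v) \<in> W" if uv: "u \<in> H.EF" "v \<in> H.EF" for u v
  proof (rule in_W)
    have m: "mon u \<in> mspan H.EF" "mon v \<in> mspan H.EF" using uv by auto
    show "anti_rel (par u) (par v) (mon u) (mon v) \<in> mspan H.EF"
      unfolding anti_rel_def using m by (intro I)
    show "\<psi> (anti_rel (par u) (par v) (mon u) (mon v)) = 0"
      unfolding anti_rel_def using J.bar_antisym[OF psi_mon_part[OF uv(1)] psi_mon_part[OF uv(2)]] m
      by (simp only: psi_simps psi_fbr[OF m(1) m(2)] psi_fbr[OF m(2) m(1)])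
    show "\<pi>' (anti_rel (par u) (par v) (mon u) (mon v)) = 0"
      by (rule H.pi_T[OF H.T.anti_mon]) (use uv H.EF_M in auto)
  qed
  show "jac_rel (par u) (par v) (mon u) (mon v) (mon w) \<in> W" if uv: "u \<in> H.EF" "v \<in> H.EF" "w \<in> H.EF" for u v w
  proof (rule in_W)
    have m: "mon u \<in> mspan H.EF" "mon v \<in> mspan H.EF" "mon w \<in> mspan H.EF" using uv by auto
    show "jac_rel (par u) (par v) (mon u) (mon v) (mon w) \<in> mspan H.EF"
      unfolding jac_rel_def using m by (intro I)
    show "\<psi> (jac_rel (par u) (par v) (mon u) (mon v) (mon w)) = 0"
      unfolding jac_rel_def
      using J.bar_jacobi[OF psi_mon_part[OF uv(1)] psi_mon_part[OF uv(2)] psi_mon_part[OF uv(3)]] m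
      by (simp only: psi_simps psi_fbr[OF m(1) fbr_mspan[OF m(2,3)]] psi_fbr[OF m(2,3)] psi_fbr[OF m(1,2)]
          psi_fbr[OF fbr_mspan[OF m(1,2)] m(3)] psi_fbr[OF m(2) fbr_mspan[OF m(1,3)]] psi_fbr[OF m(1,3)])
    show "\<pi>' (jac_rel (par u) (par v) (mon u) (mon v) (mon w)) = 0"
      by (rule H.pi_T[OF H.T.jac_mon]) (use uv H.EF_M in auto)
  qed
qed

lemma mod_W:
  assumes "pm.subspace Y" "p \<in> Y" "q \<in> mspan H.EF" "p \<in> mspan H.EF" "\<psi> q = \<psi> p" "\<pi>' q = \<pi>' p"
  shows "q \<in> Y \<oplus> W"
proof -
  have "q - p \<in> W"
    using assms by (auto simp: H.pi_diff EF_mspan intro: mspan_diff)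
  then show ?thesis using plus_sets_cong_mod[OF subspace_W assms(1) plus_sets_left[OF subspace_W assms(2)]] by blast
qed

lemma X_Hm: "k \<in> S - I \<Longrightarrow> X (Br (Gen (EG k)) (Gen (FG k))) = Hg k"
  using X_EF[of k k] by simp

text \<open>Each required relation holds in the semisimplification and in G' with the same structure
  constants, the entries of A~, so the differences lie in the common kernel.\<close>

lemma triangular_W: "triangular (\<lambda>k. k \<in> NJ) (EG ` (S - I) \<union> FG ` (S - I)) W (S - I) Hm"
proof (intro triangular.intro lie_ideal_W triangular_axioms.intro)
  fix u :: "('i, 'h2) gen mono" assume "u \<in> Hm"
  then obtain k where k: "k \<in> S - I" "u = Br (Gen (EG k)) (Gen (FG k))" by blast
  have ueF: "u \<in> H.EF" and pu: "\<not> par u" using k by auto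
  {
    fix v assume "v \<in> Hm"
    then obtain m where m: "m \<in> S - I" "v = Br (Gen (EG m)) (Gen (FG m))" by blast
    have "mon (Br u v) \<in> W"
    proof (rule in_W)
      show "mon (Br u v) \<in> mspan H.EF" using k m by auto
      show "\<psi> (mon (Br u v)) = 0"
        using k m X_Hm by (simp add: psi_mon J.Bk_def[of False False] Hg_Hg del: X.simps) (simp add: X_Hm[simplified] J.Bk_def[of False False] Hg_Hg)
      show "\<pi>' (mon (Br u v)) = 0"
        using k m by (subst pi'_mon_Br) (auto simp: pi'_Hm H.brk_HH)
    qed
    then show "mon (Br u v) \<in> mspan Hm \<oplus> W" by (intro plus_sets_right) auto
  }
  fix i assume i: "i \<in> S - I"
  let ?a = "tilde_matrix A NJ k i"
  have D: "XG (EG i) \<in> D" "XG (FG i) \<in> D" using X_gen_D[OF i] by auto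
  have B0: "J.Bk False b (Hg k) y = lie (Hg k) y" for b y by (simp add: J.Bk_def)
  show "mon (Br u (Gen (EG i))) \<in> mspan (words (EG ` (S - I))) \<oplus> W"
  proof (rule mod_W[of _ "pscale (of_int ?a) (mon (Gen (EG i)))"])
    have "X (Br u (Gen (EG i))) = smul G (of_int ?a) (XG (EG i))"
      using pu X_Hm[OF k(1)] k Hg_XE[OF k(1) i] by (simp add: B0 del: XG.simps)
    then show "\<psi> (mon (Br u (Gen (EG i)))) = \<psi> (pscale (of_int ?a) (mon (Gen (EG i))))"
      using D pu by (simp add: psi_mon J.pr_scale del: X.simps(2) XG.simps)
    have "\<pi>' (mon (Br u (Gen (EG i)))) = smul G' (of_int ?a) (gE \<pi>' i)"
      using i k by (subst pi'_mon_Br) (auto simp: pi'_Hm pi'_gens H.brk_HE H.alpha_h)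
    then show "\<pi>' (mon (Br u (Gen (EG i)))) = \<pi>' (pscale (of_int ?a) (mon (Gen (EG i))))"
      using i H.pi_scale[of "mon (Gen (EG i))" "of_int ?a"] by (simp add: pi'_gens)
  qed (use i ueF in auto)
  show "mon (Br u (Gen (FG i))) \<in> mspan (words (FG ` (S - I))) \<oplus> W"
  proof (rule mod_W[of _ "pscale (- of_int ?a) (mon (Gen (FG i)))"])
    have "X (Br u (Gen (FG i))) = smul G (- of_int ?a) (XG (FG i))"
      using pu X_Hm[OF k(1)] k Hg_XF[OF k(1) i] by (simp add: B0 del: XG.simps)
    then show "\<psi> (mon (Br u (Gen (FG i)))) = \<psi> (pscale (- of_int ?a) (mon (Gen (FG i))))"
      using D pu by (simp add: psi_mon J.pr_scale J.pr_neg del: X.simps(2) XG.simps pscale_single)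
    have "\<pi>' (mon (Br u (Gen (FG i)))) = smul G' (- of_int ?a) (gF \<pi>' i)"
      using i k by (subst pi'_mon_Br) (auto simp: pi'_Hm pi'_gens H.brk_HF H.alpha_h)
    then show "\<pi>' (mon (Br u (Gen (FG i)))) = \<pi>' (pscale (- of_int ?a) (mon (Gen (FG i))))"
      using i H.pi_scale[of "mon (Gen (FG i))" "- of_int ?a"] by (simp add: pi'_gens del: pscale_single)
  qed (use i ueF in auto)
next
  fix i j assume i: "i \<in> S - I" and j: "j \<in> S - I"
  show "mon (Br (Gen (EG i)) (Gen (FG j))) \<in> mspan Hm \<oplus> W"
  proof (cases "i = j")
    case True
    then show ?thesis using i by (intro plus_sets_left subspace_W) auto
  next
    case False
    have "mon (Br (Gen (EG i)) (Gen (FG j))) \<in> W"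
    proof (rule in_W)
      show "\<psi> (mon (Br (Gen (EG i)) (Gen (FG j)))) = 0"
        using X_EF[OF i j] False by (simp add: psi_mon del: XG.simps)
      show "\<pi>' (mon (Br (Gen (EG i)) (Gen (FG j)))) = 0"
        using i j False by (subst pi'_mon_Br) (auto simp: pi'_gens H.brk_EF)
    qed (use i j in auto)
    then show ?thesis by (intro plus_sets_right) auto
  qed
qed auto

text \<open>The correction term h_i has i in I, so along S - I the coordinates of
  \<open>hv m\<close> in the independent family h are those of the unit vector m.\<close>

lemma hv_inj:
  assumes k: "k \<in> S - I" and l: "l \<in> S - I" and e: "hv k = hv l"
  shows "k = l"
proof (rule ccontr)
  assume kl: "k \<noteq> l"
  interpret V: vector_space sH using G.realization by (simp add: realization_def)
  have ex: "\<exists>c. hv m = (\<Sum>i\<in>S. sH (c i) (h i)) \<and> (\<forall>i\<in>S - I. c i = (if i = m then 1 else 0))" if m: "m \<in> S - I" for m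
  proof -
    define c where "c i = (if i = m then 1 else 0) - (if m \<in> NJ \<and> i = inv_into I nb m then 1 else (0::'k))" for i
    have iI: "m \<in> NJ \<Longrightarrow> inv_into I nb m \<in> I" by (rule inv_into_into)
    have "(\<Sum>i\<in>S. sH (c i) (h i)) = (\<Sum>i\<in>S. (if i = m then h i else 0) - (if m \<in> NJ \<and> i = inv_into I nb m then h i else 0))"
      by (intro sum.cong refl) (auto simp: c_def V.scale_left_diff_distrib)
    also have "\<dots> = hv m"
      using m iI I_S G.finite_S by (cases "m \<in> NJ") (auto simp: sum_subtractf hv_def)
    finally show ?thesis using iI by (intro exI[of _ c]) (auto simp: c_def)
  qed
  obtain c where c: "hv k = (\<Sum>i\<in>S. sH (c i) (h i)) \<and> (\<forall>i\<in>S - I. c i = (if i = k then 1 else 0))"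
    using ex[OF k] by (rule exE)
  obtain d where d: "hv l = (\<Sum>i\<in>S. sH (d i) (h i)) \<and> (\<forall>i\<in>S - I. d i = (if i = l then 1 else 0))"
    using ex[OF l] by (rule exE)
  have cd: "(\<Sum>i\<in>S. sH (c i - d i) (h i)) = 0"
    using conjunct1[OF c] conjunct1[OF d] e by (simp add: V.scale_left_diff_distrib sum_subtractf)
  have "\<forall>c. (\<Sum>i\<in>S. sH (c i) (h i)) = 0 \<longrightarrow> (\<forall>i\<in>S. c i = 0)"
    using G.realization unfolding realization_def by (elim conjE)
  from mp[OF spec[OF this, of "\<lambda>i. c i - d i"] cd]
  have "\<forall>i\<in>S. c i - d i = 0" .
  then have "c k - d k = 0" using k by blast
  moreover have "c k = 1" "d k = 0" using conjunct2[OF c] conjunct2[OF d] k kl by (metis (full_types))+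
  ultimately show False by simp
qed

lemma Hg_inj:
  assumes k: "k \<in> S - I" and l: "l \<in> S - I" and e: "Hg k = Hg l"
  shows "k = l"
proof -
  have "\<pi> (mon (Gen (HG (hv k - hv l)))) = 0" using e by (simp add: G.pi_HG_diff Hg_def)
  then have "mon (Gen (HG (hv k - hv l))) \<in> G.C" by (simp add: G.pi_eq_0_iff)
  then have "hv k - hv l = 0"
    by (rule G.HG_injective[rotated -1]) (use G.realization in \<open>auto simp: realization_def\<close>)
  then show ?thesis using hv_inj[OF k l] by simp
qed

text \<open>Each [Hg k] is itself a block, so \<psi> sends the monomials of \<open>Hm\<close> to
  basis vectors; by \<open>Hg_inj\<close> these are distinct, hence independent.\<close>

lemma psi_Hm_injective:
  assumes r: "r \<in> mspan Hm" and 0: "\<psi> r = 0"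
  shows "r = 0"
proof (rule poly_mapping_eqI)
  fix u
  define f where "f u = (case u of Br (Gen (EG k)) v \<Rightarrow> [Hg k] | _ \<Rightarrow> [])" for u :: "('i, 'h2) gen mono"
  have fk: "f (Br (Gen (EG k)) (Gen (FG k))) = [Hg k]" for k by (simp add: f_def)
  have f: "\<psi> (mon u) = mon (f u)" if "u \<in> Hm" for u using that psi_gens(3) fk by auto
  have inj: "u = v" if "u \<in> Hm" "v \<in> Hm" "f u = f v" for u v
    using that Hg_inj fk by auto
  show "lookup r u = lookup 0 u"
  proof (cases "u \<in> Hm")
    case True
    have "lookup (\<psi> r) (f u) = (\<Sum>v\<in>keys r. lookup r v * lookup (\<psi> (mon v)) (f u))"
      unfolding \<psi>_def lext_def by (simp add: lookup_sum)
    also have "\<dots> = (\<Sum>v\<in>keys r. if v = u then lookup r u else 0)"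
      using r inj True by (intro sum.cong refl) (auto simp: f mspan_def lookup_single when_def subset_iff)
    also have "\<dots> = lookup r u" by (simp add: in_keys_iff)
    finally show ?thesis using 0 by simp
  next
    case False
    then show ?thesis using r by (auto simp: mspan_iff)
  qed
qed

text \<open>Write p = r + q with r in the span of \<open>Hm\<close> and q in W. Then \<psi> kills r,
  so r = 0 and p lies in W.\<close>

lemma ker_weight_zero:
  assumes p: "p \<in> ker_psi" and w: "p \<in> mspan {u. mono_weight u = 0}"
  shows "\<pi>' p = 0"
proof -
  interpret T: triangular "\<lambda>k. k \<in> NJ" "EG ` (S - I) \<union> FG ` (S - I)" W "S - I" Hm by (rule triangular_W)
  have gr: "wpres 0 q \<in> W" if "q \<in> W" for q
  proof -
    have "q \<in> H.C" using that H.pi_eq_0_iff EF_mspan by blast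
    then have "wpres 0 q \<in> H.C" by (rule H.C_graded)
    then have "\<pi>' (wpres 0 q) = 0" using H.pi_eq_0_iff H.C_M by blast
    then show ?thesis using that psi_graded[of q 0] pres_mspan' by auto
  qed
  have "p \<in> mspan Hm \<oplus> W" by (rule T.weight_zero[OF _ w gr]) (use p in auto)
  then obtain r q where rq: "r \<in> mspan Hm" "q \<in> W" "p = r + q" by (rule plus_setsE)
  then have "\<psi> r = 0" using p by simp
  then have "r = 0" using psi_Hm_injective rq by blast
  then show ?thesis using rq by simp
qed

lemma ker_psi_closed:
  assumes "p \<in> mspan H.EF" "k \<in> ker_psi"
  shows "fbr p k \<in> ker_psi" "fbr k p \<in> ker_psi"
  using assms by (auto simp: psi_fbr bar_bilinear intro: fbr_mspan)

text \<open>Adding \<open>H.C\<close> secures containment of T and makes the sum an ideal of the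
  whole free superalgebra: up to T a word is a combination of e,f-words, under which
  \<open>ker_psi\<close> is stable, and Cartan generators.\<close>

lemma admitted_ker: "H.admitted (H.C \<oplus> ker_psi)"
  unfolding H.admitted_def ideal_free_iff
proof (intro conjI ballI allI impI)
  let ?J = "H.C \<oplus> ker_psi"
  show sub: "pm.subspace ?J" using H.subspace_C subspace_ker_psi by (rule subspace_plus_sets)
  have kJ: "k \<in> ?J" if "k \<in> ker_psi" for k using H.subspace_C that by (rule plus_sets_right)
  have cJ: "c \<in> ?J" if "c \<in> H.C" for c using subspace_ker_psi that by (rule plus_sets_left)
  show TJ: "H.T \<subseteq> ?J" using cJ H.T_C by blast
  show "?J \<subseteq> mspan H.M"
    using H.C_M EF_mspan by (auto elim!: plus_setsE intro!: mspan_add)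
  \<comment> \<open>A Cartan generator acts on each weight component of k as a scalar modulo T, and
    the components stay in \<open>ker_psi\<close> because the kernel is graded.\<close>
  have HGk: "fbr (mon (Gen (HG x))) k \<in> ?J \<and> fbr k (mon (Gen (HG x))) \<in> ?J" if k: "k \<in> ker_psi" for x k
  proof
    have kM: "k \<in> mspan H.M" using k EF_mspan by blast
    let ?Z = "mono_weight ` keys k"
    have "fbr (mon (Gen (HG x))) (wpres \<gamma> k) \<in> ?J" for \<gamma>
    proof -
      have w: "wpres \<gamma> k \<in> ker_psi" using k psi_graded pres_mspan' by auto
      have "fbr (mon (Gen (HG x))) (wpres \<gamma> k) - pscale (H.wval x \<gamma>) (wpres \<gamma> k) \<in> H.T"
        by (rule H.HG_action) (use kM in \<open>auto simp: mspan_iff lookup_pres\<close>)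
      then have "(fbr (mon (Gen (HG x))) (wpres \<gamma> k) - pscale (H.wval x \<gamma>) (wpres \<gamma> k)) + pscale (H.wval x \<gamma>) (wpres \<gamma> k) \<in> ?J"
        using TJ kJ[OF w] sub by (intro pm.subspace_add pm.subspace_scale) auto
      then show ?thesis by simp
    qed
    then have "(\<Sum>\<gamma>\<in>?Z. fbr (mon (Gen (HG x))) (wpres \<gamma> k)) \<in> ?J" using sub by (intro pm.subspace_sum)
    also have "(\<Sum>\<gamma>\<in>?Z. fbr (mon (Gen (HG x))) (wpres \<gamma> k)) = fbr (mon (Gen (HG x))) (\<Sum>\<gamma>\<in>?Z. wpres \<gamma> k)"
      by (simp add: bilinear_ext_lext' pm.lext_sum)
    also have "(\<Sum>\<gamma>\<in>?Z. wpres \<gamma> k) = k" by (rule sum_pres) auto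
    finally show 1: "fbr (mon (Gen (HG x))) k \<in> ?J" .
    have "fbr (mon (Gen (HG x))) k + fbr k (mon (Gen (HG x))) \<in> H.T"
    proof (rule plin_mspan[where f = "\<lambda>k. fbr (mon (Gen (HG x))) k + fbr k (mon (Gen (HG x)))", OF _ _ _ kM])
      show "fbr (mon (Gen (HG x))) (mon u) + fbr (mon u) (mon (Gen (HG x))) \<in> H.T" if "u \<in> H.M" for u
        using H.T.anti_mon[of "Gen (HG x)" u] that by (simp add: anti_rel_def koszul_def)
    qed (auto simp: plin_def bilinear_ext_simps algebra_simps)
    then have "(fbr (mon (Gen (HG x))) k + fbr k (mon (Gen (HG x)))) - fbr (mon (Gen (HG x))) k \<in> ?J"
      using TJ 1 sub by (intro pm.subspace_diff) auto
    then show "fbr k (mon (Gen (HG x))) \<in> ?J" by simp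
  qed
  have Mk: "fbr x k \<in> ?J \<and> fbr k x \<in> ?J" if x: "x \<in> mspan H.M" and k: "k \<in> ker_psi" for x k
  proof -
    have kM: "k \<in> mspan H.M" using k EF_mspan by blast
    have u: "fbr (mon u) k \<in> ?J \<and> fbr k (mon u) \<in> ?J" if u: "u \<in> H.M" for u
    proof -
      obtain q s where q: "q \<in> mspan (H.EF \<union> H.HM)" "s \<in> H.T" "mon u = q + s"
        using H.mon_EF_HM[OF u] by (rule plus_setsE)
      have g: "fbr (mon v) k \<in> ?J" "fbr k (mon v) \<in> ?J" if "v \<in> H.EF \<union> H.HM" for v
        using that HGk[OF k] ker_psi_closed[of "mon v", OF _ k] kJ by auto
      have "fbr q k \<in> ?J"
        by (rule plin_mspan[where f = "\<lambda>q. fbr q k", OF _ sub g(1) q(1)]) (auto simp: plin_def bilinear_ext_simps)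
      moreover have "fbr k q \<in> ?J"
        by (rule plin_mspan[where f = "fbr k", OF _ sub g(2) q(1)]) (auto simp: plin_def bilinear_ext_simps)
      moreover have "fbr s k \<in> ?J" "fbr k s \<in> ?J" using H.T_closed[OF kM q(2)] TJ by auto
      ultimately show ?thesis unfolding q(3) using sub by (simp add: bilinear_ext_simps pm.subspace_add)
    qed
    have "fbr x k \<in> ?J"
      by (rule plin_mspan[where f = "\<lambda>x. fbr x k", OF _ sub _ x]) (use u in \<open>auto simp: plin_def bilinear_ext_simps\<close>)
    moreover have "fbr k x \<in> ?J"
      by (rule plin_mspan[where f = "fbr k", OF _ sub _ x]) (use u in \<open>auto simp: plin_def bilinear_ext_simps\<close>)
    ultimately show ?thesis ..
  qed
  {
    fix x y :: "('i, 'h2) gen mono \<Rightarrow>\<^sub>0 'k" assume x: "x \<in> mspan H.M" and y: "y \<in> ?J"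
    obtain c k where ck: "c \<in> H.C" "k \<in> ker_psi" "y = c + k" using y by (rule plus_setsE)
    have "fbr x c \<in> ?J" "fbr c x \<in> ?J" using H.C_closed[OF x ck(1)] cJ by auto
    then show "fbr x y \<in> ?J" "fbr y x \<in> ?J"
      unfolding ck(3) using Mk[OF x ck(2)] sub by (simp_all add: bilinear_ext_simps pm.subspace_add)
  }
  {
    fix p :: "('i, 'h2) gen mono \<Rightarrow>\<^sub>0 'k" and \<gamma> assume "p \<in> ?J"
    then obtain c k where ck: "c \<in> H.C" "k \<in> ker_psi" "p = c + k" by (rule plus_setsE)
    have "wpres \<gamma> k \<in> ker_psi" using ck psi_graded pres_mspan' by auto
    then show "wpres \<gamma> p \<in> ?J" using ck H.C_graded by (simp add: plus_setsI)
  }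
  fix x assume "mon (Gen (HG x)) \<in> ?J"
  then obtain c k where ck: "c \<in> H.C" "k \<in> ker_psi" "mon (Gen (HG x)) = c + k" by (rule plus_setsE)
  \<comment> \<open>Only the weight-zero component matters for \<open>HG x\<close>; its part from
    \<open>ker_psi\<close> lies in C by \<open>ker_weight_zero\<close>, so \<open>HG x\<close> is in
    C and therefore in T.\<close>
  have "wpres 0 k \<in> ker_psi" using ck psi_graded pres_mspan' by auto
  moreover have "wpres 0 k \<in> mspan {u. mono_weight u = 0}" by (auto simp: mspan_iff lookup_pres)
  ultimately have "\<pi>' (wpres 0 k) = 0" "wpres 0 k \<in> mspan H.M" using ker_weight_zero EF_mspan by auto
  then have "wpres 0 k \<in> H.C" using H.pi_eq_0_iff by blast
  moreover have "wpres 0 (mon (Gen (HG x))) = wpres 0 c + wpres 0 k" using ck by simp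
  then have "mon (Gen (HG x)) = wpres 0 c + wpres 0 k" by (simp add: pres_single)
  ultimately have "mon (Gen (HG x)) \<in> H.C"
    using H.C_graded[OF ck(1)] pm.subspace_add[OF H.subspace_C] by metis
  then show "mon (Gen (HG x)) \<in> H.T" by (rule H.C_HG)
qed

lemma ker_psi_le: "p \<in> mspan H.EF \<Longrightarrow> \<psi> p = 0 \<Longrightarrow> \<pi>' p = 0"
proof -
  assume p: "p \<in> mspan H.EF" "\<psi> p = 0"
  then have "p \<in> H.C \<oplus> ker_psi" by (intro plus_sets_right) auto
  then have "p \<in> H.C" using H.admitted_max[OF admitted_ker] by blast
  then show ?thesis using H.pi_eq_0_iff EF_mspan p by blast
qed

end


section \<open>Consequences of equal superdimensions\<close>

lemma finite_dimensional_mspan: "finite X \<Longrightarrow> finite_dimensional pscale (mspan X :: ('x \<Rightarrow>\<^sub>0 'k::field) set)"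
proof -
  assume X: "finite X"
  have "p \<in> pm.span (mon ` X)" if "p \<in> mspan X" for p :: "'x \<Rightarrow>\<^sub>0 'k"
    by (rule mspan_subset[OF _ _ that]) (auto intro: pm.span_base)
  then show ?thesis using X unfolding finite_dimensional_def by (intro exI[of _ "mon ` X"]) blast
qed

lemma restrict_to_superset: "even_part L \<subseteq> U \<Longrightarrow> odd_part L \<subseteq> U \<Longrightarrow> restrict_to L U = L"
  by (simp add: restrict_to_def Int_absorb2)

context semisimplification_setup
begin

abbreviation EFp :: "bool \<Rightarrow> ('i, 'h2) gen mono set" where
  "EFp a \<equiv> {u \<in> H.EF. par u = a}"

lemma EFp_EF: "p \<in> mspan (EFp a) \<Longrightarrow> p \<in> mspan H.EF"
  by (erule mspan_mono[rotated]) auto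

text \<open>The dimension count is made in each parity separately, as equality of superdimensions
  gives two equalities.\<close>

lemma comparison_part:
  assumes dim: "sdim bar = sdim (derived G')"
  shows "\<psi> ` mspan (EFp a) = part bar a" and "\<And>p. p \<in> mspan (EFp a) \<Longrightarrow> \<pi>' p = 0 \<Longrightarrow> \<psi> p = 0"
proof -
  have e: "edim pscale (part bar a) = edim (smul G') (\<pi>' ` mspan (EFp a))"
    using dim H.part_derived_EF[of a] by (cases a) (simp_all add: sdim_def part_def)
  have A: "pm.subspace (part bar a)" "finite_dimensional pscale (part bar a)"
    using finite_B unfolding J.part_bar by (auto intro!: finite_dimensional_mspan)
  have f: "\<psi> (x + y) = \<psi> x + \<psi> y" "\<psi> (pscale c x) = pscale c (\<psi> x)" for x y c by simp_all
  have g: "\<pi>' (x + y) = \<pi>' x + \<pi>' y" "\<pi>' (pscale c x) = smul G' c (\<pi>' x)"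
    if "x \<in> mspan (EFp a)" "y \<in> mspan (EFp a)" for x y c
    using EF_mspan[OF EFp_EF[OF that(1)]] EF_mspan[OF EFp_EF[OF that(2)]] by (simp_all add: H.pi_add H.pi_scale)
  have fA: "\<psi> ` mspan (EFp a) \<subseteq> part bar a" using psi_part by blast
  note k = kernels_equal_by_dimension[where f = \<psi> and g = \<pi>', OF vector_space_pscale vector_space_pscale
      H.g.vector_space_axioms subspace_mspan A(1) f g(1) g(2) fA ker_psi_le[OF EFp_EF] A(2) e]
  show "\<psi> ` mspan (EFp a) = part bar a" "\<And>p. p \<in> mspan (EFp a) \<Longrightarrow> \<pi>' p = 0 \<Longrightarrow> \<psi> p = 0"
    by (rule k; assumption?)+
qed

lemma EF_parts:
  "p \<in> mspan H.EF \<Longrightarrow> \<exists>q\<in>mspan (EFp False). \<exists>r\<in>mspan (EFp True). p = q + r"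
proof -
  assume p: "p \<in> mspan H.EF"
  have "pres (\<lambda>u. \<not> par u) p \<in> mspan (EFp False)" "pres (\<lambda>u. par u) p \<in> mspan (EFp True)"
    using pres_mspan[OF p] by auto
  then show ?thesis using pres_parity_sum[of p] by blast
qed

lemma pi'_part: "p \<in> mspan (EFp a) \<Longrightarrow> \<pi>' p \<in> part (derived G') a"
  using H.part_derived_EF by blast

lemma kernels_equal:
  assumes dim: "sdim bar = sdim (derived G')" and p: "p \<in> mspan H.EF" and 0: "\<pi>' p = 0"
  shows "\<psi> p = 0"
proof -
  obtain q r where qr: "q \<in> mspan (EFp False)" "r \<in> mspan (EFp True)" "p = q + r" using EF_parts[OF p] by blast
  have s: "\<pi>' q + \<pi>' r = 0" using 0 qr(3) H.pi_add[OF EF_mspan[OF EFp_EF[OF qr(1)]] EF_mspan[OF EFp_EF[OF qr(2)]]] by simp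
  have m: "\<pi>' q \<in> part G' False" "\<pi>' r \<in> part G' True"
    using pi'_part[OF qr(1)] pi'_part[OF qr(2)] H.part_derived' by auto
  have "- \<pi>' r \<in> part G' True"
    using m(2) superalgebraD(2)[OF H.superalgebra_G] by (intro H.g.subspace_neg)
  moreover have "\<pi>' q = - \<pi>' r" using s by (simp add: eq_neg_iff_add_eq_0)
  ultimately have "\<pi>' q \<in> part G' False \<inter> part G' True" using m by simp
  then have "\<pi>' q = 0" using superalgebraD(3)[OF H.superalgebra_G] by simp
  moreover from this have "\<pi>' r = 0" using s by simp
  ultimately have "\<psi> q = 0" "\<psi> r = 0"
    using comparison_part(2)[OF dim qr(1)] comparison_part(2)[OF dim qr(2)] by auto
  then show ?thesis using qr(3) by simp
qed

lemma psi_surj: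
  assumes dim: "sdim bar = sdim (derived G')"
  shows "\<psi> ` mspan H.EF = carrier bar"
proof
  show "\<psi> ` mspan H.EF \<subseteq> carrier bar"
  proof clarify
    fix p :: "('i, 'h2) gen mono \<Rightarrow>\<^sub>0 'k" assume "p \<in> mspan H.EF"
    then obtain q r where qr: "q \<in> mspan (EFp False)" "r \<in> mspan (EFp True)" "p = q + r" using EF_parts by blast
    then have "\<psi> p = \<psi> q + \<psi> r" by simp
    then show "\<psi> p \<in> carrier bar" unfolding carrier_parts using psi_part[OF qr(1)] psi_part[OF qr(2)] by blast
  qed
  show "carrier bar \<subseteq> \<psi> ` mspan H.EF"
  proof
    fix y assume "y \<in> carrier bar"
    then obtain a b where ab: "a \<in> part bar False" "b \<in> part bar True" "y = a + b" unfolding carrier_parts by blast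
    then obtain q r where qr: "q \<in> mspan (EFp False)" "a = \<psi> q" "r \<in> mspan (EFp True)" "b = \<psi> r"
      using comparison_part(1)[OF dim] by blast
    have "y = \<psi> (q + r)" using ab(3) qr by simp
    moreover have "q + r \<in> mspan H.EF"
      by (rule mspan_add[OF EFp_EF[OF qr(1)] EFp_EF[OF qr(3)]])
    ultimately show "y \<in> \<psi> ` mspan H.EF" by blast
  qed
qed

text \<open>The cubic identity is transported from g(A~): an odd x equals \<open>\<psi> p\<close>
  with p odd, the cube of p lies in \<open>H.T\<close> and so is killed by \<pi>', hence by \<psi>,
  the kernels being equal.\<close>

lemma lie_superalgebra_bar:
  assumes dim: "sdim bar = sdim (derived G')"
  shows "lie_superalgebra bar"
proof -
  have "r = 0" if "r \<in> lie_relators bar" for r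
    using that unfolding lie_relators_def J.bar_simps
  proof (elim UnE)
    assume "r \<in> {brk bar x y + pscale (koszul a b) (brk bar y x) | a b x y. x \<in> part bar a \<and> y \<in> part bar b}"
    then obtain a b x y where "r = brk bar x y + pscale (koszul a b) (brk bar y x)" "x \<in> part bar a" "y \<in> part bar b"
      by blast
    then show "r = 0" using J.bar_antisym by blast
  next
    assume "r \<in> {brk bar x (brk bar y z) - brk bar (brk bar x y) z - pscale (koszul a b) (brk bar y (brk bar x z))
        | a b c x y z. x \<in> part bar a \<and> y \<in> part bar b \<and> z \<in> part bar c}"
    then obtain a b c x y z where "r = brk bar x (brk bar y z) - brk bar (brk bar x y) z - pscale (koszul a b) (brk bar y (brk bar x z))"
      "x \<in> part bar a" "y \<in> part bar b" "z \<in> part bar c" by blast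
    then show "r = 0" using J.bar_jacobi by blast
  next
    assume "r \<in> {brk bar x (brk bar x x) | x. x \<in> odd_part bar}"
    then obtain x where x: "r = brk bar x (brk bar x x)" "x \<in> part bar True" by (auto simp: part_def)
    then obtain p where p: "p \<in> mspan (EFp True)" "x = \<psi> p" using comparison_part(1)[OF dim, of True] by blast
    have EF: "p \<in> mspan H.EF" using EFp_EF p(1) .
    have "p \<in> H.Pt True" by (rule mspan_mono[OF _ p(1)]) (use H.EF_M in auto)
    then have "fbr p (fbr p p) \<in> H.T" using H.relator_intros(3) H.Rel_T by blast
    then have "\<psi> (fbr p (fbr p p)) = 0"
      using kernels_equal[OF dim _ H.pi_T] EF by (blast intro: fbr_mspan)
    then show "r = 0" using x p EF by (simp add: psi_fbr fbr_mspan)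
  qed
  then show ?thesis using J.superalgebra_bar by (auto simp: lie_superalgebra_def)
qed

text \<open>The isomorphism is \<pi>' composed with any section of \<psi>. It is well defined by
  \<open>ker_psi_le\<close> and injective by \<open>kernels_equal\<close>.\<close>

lemma bar_isomorphic:
  assumes dim: "sdim bar = sdim (derived G')"
  shows "lie_superalgebra_isomorphic bar (derived G')"
proof -
  define \<phi> where "\<phi> y = \<pi>' (SOME p. p \<in> mspan H.EF \<and> \<psi> p = y)" for y
  have phi: "\<phi> (\<psi> p) = \<pi>' p" if p: "p \<in> mspan H.EF" for p
  proof -
    define q where "q = (SOME q. q \<in> mspan H.EF \<and> \<psi> q = \<psi> p)"
    have "q \<in> mspan H.EF \<and> \<psi> q = \<psi> p"
      unfolding q_def by (rule someI[of _ p]) (use p in simp)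
    then have q: "q \<in> mspan H.EF" "\<psi> q = \<psi> p" by auto
    then have "\<pi>' (q - p) = 0" using p by (intro ker_psi_le) (auto intro: mspan_diff)
    then have "\<pi>' q = \<pi>' p" using H.pi_diff[OF EF_mspan[OF q(1)] EF_mspan[OF p]] by simp
    then show ?thesis by (simp add: \<phi>_def q_def)
  qed
  have rep: "\<exists>p\<in>mspan H.EF. y = \<psi> p" if "y \<in> carrier bar" for y using that psi_surj[OF dim] by blast
  have "superalg_hom bar (derived G') \<phi>"
    unfolding superalg_hom_def
  proof (intro conjI ballI allI)
    fix x y assume "x \<in> carrier bar" "y \<in> carrier bar"
    then obtain p q where p: "p \<in> mspan H.EF" "x = \<psi> p" and q: "q \<in> mspan H.EF" "y = \<psi> q"
      using rep by blast
    have "p + q \<in> mspan H.EF" "fbr p q \<in> mspan H.EF" using p q by (auto intro: mspan_add fbr_mspan)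
    then have "\<phi> (\<psi> (p + q)) = \<pi>' (p + q)" "\<phi> (\<psi> (fbr p q)) = \<pi>' (fbr p q)" by (simp_all only: phi)
    then show "\<phi> (x + y) = \<phi> x + \<phi> y" "\<phi> (brk bar x y) = brk (derived G') (\<phi> x) (\<phi> y)"
      using p q EF_mspan[OF p(1)] EF_mspan[OF q(1)] by (simp_all add: phi psi_fbr H.pi_add H.pi_brk)
  next
    fix c x assume "x \<in> carrier bar"
    then obtain p where p: "p \<in> mspan H.EF" "x = \<psi> p" using rep by blast
    have "\<phi> (\<psi> (pscale c p)) = \<pi>' (pscale c p)" using p by (intro phi) (auto intro: mspan_scale)
    then show "\<phi> (smul bar c x) = smul (derived G') c (\<phi> x)" using p EF_mspan[OF p(1)] by (simp add: phi H.pi_scale)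
  next
    have "\<phi> ` part bar a \<subseteq> part (derived G') a" for a
      unfolding comparison_part(1)[OF dim, of a, symmetric]
    proof clarify
      fix p :: "('i, 'h2) gen mono \<Rightarrow>\<^sub>0 'k" assume p: "p \<in> mspan (EFp a)"
      then show "\<phi> (\<psi> p) \<in> part (derived G') a" using phi[OF EFp_EF[OF p]] pi'_part[OF p] by simp
    qed
    from this[of False] this[of True]
    show "\<phi> ` even_part bar \<subseteq> even_part (derived G')" "\<phi> ` odd_part bar \<subseteq> odd_part (derived G')"
      by (simp_all add: part_def)
  qed
  moreover have "bij_betw \<phi> (carrier bar) (carrier (derived G'))"
    unfolding bij_betw_def
  proof
    show "inj_on \<phi> (carrier bar)"
    proof (rule inj_onI)
      fix x y assume xy: "x \<in> carrier bar" "y \<in> carrier bar" "\<phi> x = \<phi> y"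
      then obtain p q where p: "p \<in> mspan H.EF" "x = \<psi> p" and q: "q \<in> mspan H.EF" "y = \<psi> q"
        using rep by blast
      have "\<pi>' (p - q) = 0" using xy(3) p q EF_mspan[OF p(1)] EF_mspan[OF q(1)] by (simp add: phi H.pi_diff)
      then have "\<psi> (p - q) = 0" using p q by (intro kernels_equal[OF dim]) (auto intro: mspan_diff)
      then show "x = y" using p q by simp
    qed
    have "\<phi> ` \<psi> ` mspan H.EF = \<pi>' ` mspan H.EF" using phi by (force simp: image_image)
    then show "\<phi> ` carrier bar = carrier (derived G')" using psi_surj[OF dim] H.carrier_derived_EF by simp
  qed
  ultimately show ?thesis
    unfolding lie_superalgebra_isomorphic_def using lie_superalgebra_bar[OF dim] H.lie_derived by blast
qed

text \<open>The image of \<psi> is everything, and each word is sent to an iterated bracket of the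
  block vectors of the e_k and f_k with k in S - I, all of which are generator images.\<close>

lemma generated:
  assumes dim: "sdim bar = sdim (derived G')"
  shows "carrier bar \<subseteq> subalgebra bar hull (generator_images S \<pi> B)"
proof -
  have "\<psi> p \<in> U" if U: "subalgebra bar U" "generator_images S \<pi> B \<subseteq> U" and p: "p \<in> mspan H.EF" for U p
  proof -
    have sub: "pm.subspace U" and br: "\<And>x y. x \<in> U \<Longrightarrow> y \<in> U \<Longrightarrow> brk bar x y \<in> U"
      using U(1) by (auto simp: subalgebra_def)
    have gen: "mon (EB k) \<in> U" "mon (FB k) \<in> U" if k: "k \<in> S - I" for k
    proof -
      have "length (EB k) \<noteq> 3" "length (FB k) \<noteq> 3" by (auto simp: EB_def FB_def)
      then have b: "(block_image (EB k) :: 'g list \<Rightarrow>\<^sub>0 'k) = mon (EB k)"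
        "(block_image (FB k) :: 'g list \<Rightarrow>\<^sub>0 'k) = mon (FB k)" by (simp_all add: block_image_def)
      have "EB k \<in> B" "FB k \<in> B" using in_blocks[OF k] by auto
      moreover have "gE \<pi> k \<in> set (EB k)" "gF \<pi> k \<in> set (FB k)" by (auto simp: EB_def FB_def)
      ultimately have "block_image (EB k) \<in> generator_images S \<pi> B" "block_image (FB k) \<in> generator_images S \<pi> B"
        unfolding generator_images_def using k by blast+
      then have "block_image (EB k) \<in> U" "block_image (FB k) \<in> U" using U(2) by blast+
      then show "mon (EB k) \<in> U" "mon (FB k) \<in> U" using b by simp_all
    qed
    have "\<psi> (mon u) \<in> U" if "u \<in> H.EF" for u
      using that
    proof (induction u)
      case (Gen g)
      then show ?case using psi_gens gen by auto
    next
      case (Br u v)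
      then show ?case using psi_Br[of u v] br by simp
    qed
    then show ?thesis by (rule plin_mspan[OF plin_psi sub _ p])
  qed
  then show ?thesis unfolding hull_def psi_surj[OF dim, symmetric] by blast
qed

text \<open>The subalgebra is the whole of \<open>bar\<close> by \<open>generated\<close>, and the
  cubes of odd elements already vanish in it, so the ideal divided out is zero.\<close>

lemma gen_subquotient_bar:
  assumes dim: "sdim bar = sdim (derived G')"
  shows "gen_subquotient bar (generator_images S \<pi> B) = (bar, {0})"
proof -
  let ?U = "subalgebra bar hull (generator_images S \<pi> B)"
  have pc: "part bar a \<subseteq> ?U" for a using generated[OF dim] part_subset_carrier[OF J.superalgebra_bar] by blast
  have r: "restrict_to bar ?U = bar"
    by (rule restrict_to_superset) (use pc[of False] pc[of True] in \<open>simp_all add: part_def\<close>)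
  have cube: "brk bar x (brk bar x x) = 0" if "x \<in> odd_part bar" for x
  proof -
    have "brk bar x (brk bar x x) \<in> lie_relators bar" unfolding lie_relators_def using that by blast
    then show ?thesis using lie_superalgebra_bar[OF dim] by (auto simp: lie_superalgebra_def)
  qed
  have "0 \<in> odd_part bar" using J.part_bar[of True] by (simp add: part_def pm.subspace_0)
  then have c: "{brk bar x (brk bar x x) | x. x \<in> odd_part bar} = {0}" using cube by force
  have "0 \<in> carrier bar" using J.carrier_bar by (simp add: pm.subspace_0)
  then have "ideal bar {0}" by (auto simp: ideal_def bar_bilinear)
  then have "ideal bar hull {0} = {0}" by (rule hull_same)
  then show ?thesis by (simp add: gen_subquotient_def Let_def r c)
qed

end

theorem theorem3p6p5:
  fixes n :: nat
    and A :: "nat \<Rightarrow> nat \<Rightarrow> int"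
    and I :: "nat set" and nb :: "nat \<Rightarrow> nat"
    and sH :: "'k::alg_closed_field \<Rightarrow> 'h::ab_group_add \<Rightarrow> 'h"
    and h :: "nat \<Rightarrow> 'h" and \<alpha> :: "nat \<Rightarrow> 'h \<Rightarrow> 'k"
    and G :: "('k, 'g::ab_group_add) superalg"
    and \<pi> :: "((nat, 'h) gen mono \<Rightarrow>\<^sub>0 'k) \<Rightarrow> 'g"
    and sH' :: "'k \<Rightarrow> 'h2::ab_group_add \<Rightarrow> 'h2"
    and h' :: "nat \<Rightarrow> 'h2" and \<alpha>' :: "nat \<Rightarrow> 'h2 \<Rightarrow> 'k"
    and G' :: "('k, 'g2::ab_group_add) superalg"
    and \<pi>' :: "((nat, 'h2) gen mono \<Rightarrow>\<^sub>0 'k) \<Rightarrow> 'g2"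
    and \<B> :: "'g list set"
    and bar :: "('k, 'g list \<Rightarrow>\<^sub>0 'k) superalg"
  assumes char3: "CHAR('k) = 3"
    and cartan: "cartan_matrix {1..n} (\<lambda>_. False) A"
    and G: "contragredient {1..n} (\<lambda>_. False) A sH h \<alpha> G \<pi>"
    and fin: "finite_dimensional (smul G) (carrier G)"
    and adm: "admissible {1..n} A I nb"
    and G': "contragredient ({1..n} - I) (\<lambda>k. k \<in> nb ` I) (tilde_matrix A (nb ` I))
               sH' h' \<alpha>' G' \<pi>'"
    and decomp: "adapted_decomposition {1..n} h G \<pi> I nb \<B>"
    and bar: "bar = semisimplification (derived G) \<B>"
    and sdim_eq: "sdim bar = sdim (derived G')"
  shows "gen_subquotient bar (generator_images {1..n} \<pi> \<B>) = (bar, {0}) \<and>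
         lie_superalgebra_isomorphic bar (derived G')"
proof -
  have "of_nat CHAR('k) = (0::'k)" by (rule of_nat_CHAR)
  then have three: "(3::'k) = 0" using char3 by simp
  interpret semisimplification_setup "{1..n}" I nb A sH h \<alpha> G \<pi> sH' h' \<alpha>' G' \<pi>' \<B>
    by unfold_locales (fact three G G' cartan fin adm decomp | simp)+
  show ?thesis using gen_subquotient_bar bar_isomorphic sdim_eq unfolding bar by blast
qed

end
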